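(* Let $a\in\Omega_1(\mathfrak A)$ and set $\mu(a)=\begin{pmatrix}\mu_1(a)&\mu_2(a)&\mu_3(a)\end{pmatrix}$. Then the operator $M_{\mu(a)}$ of multiplication by $\mu(a)$ on the left is a strict contraction from $\mathfrak A^3$ into $\mathfrak A$, and the map $$B_a(x)=(1-\mu(a)\mu(a)^* )^{1/2}\,(1-\mu(x)\mu(a)^* )^{-\star_{V_q}}\star_{V_q}(\mu(x)-\mu(a))\,(I_3-\mu(a)^*\mu(a))^{-1/2}$$ is a Schur multiplier from $\mathfrak A^3$ into $\mathfrak A$.
   Context: $\mathbb H$ denotes the quaternions; for a quaternionic matrix, ${}^*$ is the conjugate transpose. A point $x=(x_0,x_1,x_2,x_3)\in\mathbb R^4$ is identified with $q=x_0+\vec q$, where $\vec q=x_1\mathbf e_1+x_2\mathbf e_2+x_3\mathbf e_3$, and $\mathbb H^*=\{q:\vec q\neq0\}$. For $x\in\mathbb H^*$, $\mu_u(x)=x_u\left(1+\frac{x_0}{\vec q}\right)$, $u=1,2,3$, $\mu(x)=\begin{pmatrix}\mu_1(x)&\mu_2(x)&\mu_3(x)\end{pmatrix}$, and $\mu^\alpha=\mu_1^{\alpha_1}\mu_2^{\alpha_2}\mu_3^{\alpha_3}$; $|\alpha|=\alpha_1+\alpha_2+\alpha_3$, $\alpha!=\alpha_1!\alpha_2!\alpha_3!$. $\Omega_1(\mathfrak A)=\{x\in\mathbb H^*:\sum_{u=1}^3|\mu_u(x)|^2<1\}$ and $\Omega_A=\{x\in\mathbb H^*:\sum_{\alpha\in\mathbb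 N_0^3}|\mu^\alpha(x)|^2\frac{|\alpha|!}{\alpha!}<\infty\}$. The Arveson space $\mathfrak A$ is the right quaternionic reproducing kernel Hilbert space of series $f=\sum_\alpha\mu^\alpha f_\alpha$ ($f_\alpha\in\mathbb H$) on $\Omega_A$ with $\langle f,f\rangle=\sum_\alpha\frac{\alpha!}{|\alpha|!}|f_\alpha|^2<\infty$. The operator $V_q$ is $V_qf=\frac{\partial f}{\partial x_0}-\frac1{\vec q}\sum_{u=1}^3x_u\frac{\partial f}{\partial x_u}$. For a real analytic function $h(x_1,x_2,x_3)$ on an open subset of $\mathbb H^*\cap\{x_0=0\}$, $CK_{V_q}(h)$ is the unique real analytic solution $F$ of $V_qF=0$ with $F|_{x_0=0}=h$. The CK-product is $f\star_{V_q}g=CK_{V_q}\big(f(0,x_1,x_2,x_3)g(0,x_1,x_2,x_3)\big)$, entrywise for matrix-valued functions; in particular $\mu^\alpha c\star_{V_q}\mu^\beta d=\mu^{\alpha+\beta}cd$. The $\star_{V_q}$-inverse $f^{-\star_{V_q}}$ is the CK-extension of the pointwise inverse of $f(0,x_1,x_2,x_3)$. In the formula for $B_a$, $a$ is fixed and the expressions in $\mu(a)$ are constants; $\mu(x)\mu(a)^*=\sum_{u=1}^3\mu_u(x)\overline{\mu_u(a)}$; products with constants are also understood as $\star_{V_q}$-products. $M_{\mu(a)}$ denotes $\star_{V_q}$-multiplication on the left by the constant row $\mu(a)$: $\sum_\alpha\mu^\alpha f_\alpha\mapsto\sum_\alpha\mu^\alpha\mu(a)f_\alpha$ with $f_\alpha\in\mathbb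 H^3$ columns. Strict contraction means operator norm $<1$. An $\mathbb H^{1\times3}$-valued function $S$ is a Schur multiplier from $\mathfrak A^3$ into $\mathfrak A$ if $f\mapsto S\star_{V_q}f$ maps $\mathfrak A^3$ into $\mathfrak A$ with operator norm at most $1$. *)

theory Defs
  imports "HOL-Analysis.Analysis"
begin

section \<open>Quaternions\<close>

datatype quat = Quat (Qre: real) (Qi: real) (Qj: real) (Qk: real)

lemma quat_eq_iff: "p = q \<longleftrightarrow> Qre p = Qre q \<and> Qi p = Qi q \<and> Qj p = Qj q \<and> Qk p = Qk q"
  by (cases p; cases q) simp

instantiation quat :: real_vector
begin

definition "0 = Quat 0 0 0 0"
definition "p + q = Quat (Qre p + Qre q) (Qi p + Qi q) (Qj p + Qj q) (Qk p + Qk q)"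
definition "p - q = Quat (Qre p - Qre q) (Qi p - Qi q) (Qj p - Qj q) (Qk p - Qk q)"
definition "- q = Quat (- Qre q) (- Qi q) (- Qj q) (- Qk q)"
definition "r *\<^sub>R q = Quat (r * Qre q) (r * Qi q) (r * Qj q) (r * Qk q)"

instance
  by standard (simp_all add: quat_eq_iff zero_quat_def plus_quat_def minus_quat_def
      uminus_quat_def scaleR_quat_def algebra_simps)

end

lemma quat_add_simps [simp]:
  "Qre (0::quat) = 0" "Qi (0::quat) = 0" "Qj (0::quat) = 0" "Qk (0::quat) = 0"
  "Qre (p + q) = Qre p + Qre q" "Qi (p + q) = Qi p + Qi q"
  "Qj (p + q) = Qj p + Qj q" "Qk (p + q) = Qk p + Qk q"
  "Qre (p - q) = Qre p - Qre q" "Qi (p - q) = Qi p - Qi q"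
  "Qj (p - q) = Qj p - Qj q" "Qk (p - q) = Qk p - Qk q"
  "Qre (- q) = - Qre q" "Qi (- q) = - Qi q" "Qj (- q) = - Qj q" "Qk (- q) = - Qk q"
  "Qre (r *\<^sub>R q) = r * Qre q" "Qi (r *\<^sub>R q) = r * Qi q"
  "Qj (r *\<^sub>R q) = r * Qj q" "Qk (r *\<^sub>R q) = r * Qk q"
  by (simp_all add: zero_quat_def plus_quat_def minus_quat_def uminus_quat_def scaleR_quat_def)

instantiation quat :: real_algebra_1
begin

definition "1 = Quat 1 0 0 0"
definition "p * q = Quat
  (Qre p * Qre q - Qi p * Qi q - Qj p * Qj q - Qk p * Qk q)
  (Qre p * Qi q + Qi p * Qre q + Qj p * Qk q - Qk p * Qj q)
  (Qre p * Qj q - Qi p * Qk q + Qj p * Qre q + Qk p * Qi q)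
  (Qre p * Qk q + Qi p * Qj q - Qj p * Qi q + Qk p * Qre q)"

instance
  by standard (simp_all add: quat_eq_iff one_quat_def times_quat_def algebra_simps)

end

lemma quat_one_simps [simp]:
  "Qre (1::quat) = 1" "Qi (1::quat) = 0" "Qj (1::quat) = 0" "Qk (1::quat) = 0"
  by (simp_all add: one_quat_def)

lemma quat_mult_simps:
  "Qre (p * q) = Qre p * Qre q - Qi p * Qi q - Qj p * Qj q - Qk p * Qk q"
  "Qi (p * q) = Qre p * Qi q + Qi p * Qre q + Qj p * Qk q - Qk p * Qj q"
  "Qj (p * q) = Qre p * Qj q - Qi p * Qk q + Qj p * Qre q + Qk p * Qi q"
  "Qk (p * q) = Qre p * Qk q + Qi p * Qj q - Qj p * Qi q + Qk p * Qre q"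
  by (simp_all add: times_quat_def)

definition qcnj :: "quat \<Rightarrow> quat" where
  "qcnj q = Quat (Qre q) (- Qi q) (- Qj q) (- Qk q)"

lemma qcnj_simps [simp]:
  "Qre (qcnj q) = Qre q" "Qi (qcnj q) = - Qi q" "Qj (qcnj q) = - Qj q" "Qk (qcnj q) = - Qk q"
  by (simp_all add: qcnj_def)

instantiation quat :: real_normed_vector
begin

definition "norm q = sqrt ((Qre q)\<^sup>2 + (Qi q)\<^sup>2 + (Qj q)\<^sup>2 + (Qk q)\<^sup>2)"
definition "dist p q = norm (p - q)" for p q :: quat
definition "sgn q = q /\<^sub>R norm q" for q :: quat
definition [code del]: "(uniformity :: (quat \<times> quat) filter) =
  (INF e\<in>{0 <..}. principal {(x, y). dist x y < e})"
definition [code del]: "open (U :: quat set) \<longleftrightarrow>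
  (\<forall>x\<in>U. eventually (\<lambda>(x', y). x' = x \<longrightarrow> y \<in> U) uniformity)"

instance
proof
  have pair: "norm q = norm ((Qre q, Qi q), (Qj q, Qk q))" for q
    by (simp add: norm_quat_def norm_prod_def add.assoc)
  fix p q :: quat and r :: real
  show "norm q = 0 \<longleftrightarrow> q = 0"
    by (simp add: pair zero_prod_def quat_eq_iff)
  show "norm (p + q) \<le> norm p + norm q"
    using norm_triangle_ineq[of "((Qre p, Qi p), (Qj p, Qk p))" "((Qre q, Qi q), (Qj q, Qk q))"]
    by (simp add: pair)
  show "norm (r *\<^sub>R q) = \<bar>r\<bar> * norm q"
    using norm_scaleR[of r "((Qre q, Qi q), (Qj q, Qk q))"]
    by (simp add: pair)
qed (simp_all add: dist_quat_def sgn_quat_def uniformity_quat_def open_quat_def)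

end

instantiation quat :: real_normed_div_algebra
begin

definition "inverse q = qcnj q /\<^sub>R (norm q)\<^sup>2"
definition "p div q = p * inverse q" for p q :: quat

lemma quat_mult_qcnj_aux:
  "q * qcnj q = (norm q)\<^sup>2 *\<^sub>R 1" "qcnj q * q = (norm q)\<^sup>2 *\<^sub>R 1"
  by (simp_all add: quat_eq_iff quat_mult_simps norm_quat_def power2_eq_square)

instance
proof
  fix p q :: quat
  show "q \<noteq> 0 \<Longrightarrow> inverse q * q = 1" "q \<noteq> 0 \<Longrightarrow> q * inverse q = 1"
    by (simp_all add: inverse_quat_def quat_mult_qcnj_aux)
  show "inverse (0::quat) = 0"
    by (simp add: inverse_quat_def quat_eq_iff)
  show "norm (p * q) = norm p * norm q"
    unfolding norm_quat_def real_sqrt_mult[symmetric]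
    by (rule arg_cong[of _ _ sqrt]) (simp add: quat_mult_simps power2_eq_square algebra_simps)
qed (simp add: divide_quat_def)

end


section \<open>Quaternionic matrices\<close>

definition adj :: "quat^'n^'m \<Rightarrow> quat^'m^'n" where
  "adj A = (\<chi> i j. qcnj (A $ j $ i))"

text \<open>For Hermitian \<^term>\<open>A\<close> the number \<open>\<xi>\<^sup>* A \<xi>\<close> is real, so testing its real part loses nothing.\<close>

definition pos_semidef :: "quat^'n^'n \<Rightarrow> bool" where
  "pos_semidef A \<longleftrightarrow> adj A = A \<and> (\<forall>\<xi>::quat^1^'n. 0 \<le> Qre ((adj \<xi> ** A ** \<xi>) $ 1 $ 1))"

definition msqrt :: "quat^'n^'n \<Rightarrow> quat^'n^'n" where
  "msqrt A = (THE R. pos_semidef R \<and> R ** R = A)"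


section \<open>The functions \<open>\<mu>\<^sub>u\<close>\<close>

text \<open>A point \<open>(x\<^sub>0, x\<^sub>1, x\<^sub>2, x\<^sub>3)\<close> of four-space is the pair of \<open>x\<^sub>0\<close> and the vector
  \<open>(x\<^sub>1, x\<^sub>2, x\<^sub>3)\<close>; the hyperplane \<open>x\<^sub>0 = 0\<close> is thus a copy of \<^typ>\<open>real^3\<close>.\<close>

type_synonym point = "real \<times> (real^3)"

definition vecq :: "real^3 \<Rightarrow> quat" where
  "vecq v = Quat 0 (v $ 1) (v $ 2) (v $ 3)"

definition H_star :: "point set" where
  "H_star = {x. vecq (snd x) \<noteq> 0}"

definition mu :: "3 \<Rightarrow> point \<Rightarrow> quat" where
  "mu u x = of_real (snd x $ u) * (1 + of_real (fst x) / vecq (snd x))"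

definition mu_row :: "point \<Rightarrow> quat^3^1" where
  "mu_row x = (\<chi> i u. mu u x)"

definition mu_pow :: "nat^3 \<Rightarrow> point \<Rightarrow> quat" where
  "mu_pow \<alpha> x = mu 1 x ^ (\<alpha> $ 1) * mu 2 x ^ (\<alpha> $ 2) * mu 3 x ^ (\<alpha> $ 3)"

definition mabs :: "nat^3 \<Rightarrow> nat" where
  "mabs \<alpha> = (\<Sum>u\<in>UNIV. \<alpha> $ u)"

definition mfact :: "nat^3 \<Rightarrow> real" where
  "mfact \<alpha> = (\<Prod>u\<in>UNIV. fact (\<alpha> $ u))"

definition Omega_1 :: "point set" where
  "Omega_1 = {x \<in> H_star. (\<Sum>u\<in>UNIV. (norm (mu u x))\<^sup>2) < 1}"

definition Omega_A :: "point set" where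
  "Omega_A = {x \<in> H_star.
     (\<lambda>\<alpha>. (norm (mu_pow \<alpha> x))\<^sup>2 * (fact (mabs \<alpha>) / mfact \<alpha>)) summable_on UNIV}"


section \<open>The Arveson space and its powers\<close>

definition arveson_series :: "(nat^3 \<Rightarrow> quat) \<Rightarrow> (point \<Rightarrow> quat) \<Rightarrow> bool" where
  "arveson_series c f \<longleftrightarrow>
     (\<lambda>\<alpha>. mfact \<alpha> / fact (mabs \<alpha>) * (norm (c \<alpha>))\<^sup>2) summable_on UNIV \<and>
     (\<forall>x\<in>Omega_A. ((\<lambda>\<alpha>. mu_pow \<alpha> x * c \<alpha>) has_sum f x) UNIV)"

text \<open>Only the values on \<^term>\<open>Omega_A\<close> matter. The coefficients are determined by them, since at
  \<open>x\<^sub>0 = 0\<close> the series is an ordinary power series in \<open>x\<^sub>1, x\<^sub>2, x\<^sub>3\<close>.\<close>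

definition arveson :: "(point \<Rightarrow> quat) set" where
  "arveson = {f. \<exists>c. arveson_series c f}"

definition arveson_coeff :: "(point \<Rightarrow> quat) \<Rightarrow> nat^3 \<Rightarrow> quat" where
  "arveson_coeff f = (THE c. arveson_series c f)"

definition arveson_norm :: "(point \<Rightarrow> quat) \<Rightarrow> real" where
  "arveson_norm f =
     sqrt (\<Sum>\<^sub>\<infinity>\<alpha>. mfact \<alpha> / fact (mabs \<alpha>) * (norm (arveson_coeff f \<alpha>))\<^sup>2)"

text \<open>Column-valued functions; the Arveson space itself is the case of one row, scalars being
  identified with matrices of size one.\<close>

definition arveson_pow :: "(point \<Rightarrow> quat^1^'n) set" where
  "arveson_pow = {f. \<forall>i. (\<lambda>x. f x $ i $ 1) \<in> arveson}"

definition arveson_pow_norm :: "(point \<Rightarrow> quat^1^'n) \<Rightarrow> real" where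
  "arveson_pow_norm f = sqrt (\<Sum>i\<in>UNIV. (arveson_norm (\<lambda>x. f x $ i $ 1))\<^sup>2)"

definition arveson_op_norm ::
  "((point \<Rightarrow> quat^1^'n) \<Rightarrow> (point \<Rightarrow> quat^1^'m)) \<Rightarrow> ennreal" where
  "arveson_op_norm T =
     Inf {K. \<forall>f\<in>arveson_pow. ennreal (arveson_pow_norm (T f)) \<le> K * ennreal (arveson_pow_norm f)}"


section \<open>Cauchy--Kovalevskaya extension and product\<close>

text \<open>Local expansion into a multiple power series, the multi-indices being the functions from the
  basis to the naturals. Intended for open sets.\<close>

definition real_analytic_on ::
  "('a::euclidean_space \<Rightarrow> 'b::real_normed_vector) \<Rightarrow> 'a set \<Rightarrow> bool"
  (infix \<open>real'_analytic'_on\<close> 50) where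
  "f real_analytic_on U \<longleftrightarrow> (\<forall>p\<in>U. \<exists>r>0. \<exists>c. \<forall>x\<in>ball p r.
     ((\<lambda>\<alpha>. (\<Prod>b\<in>Basis. ((x - p) \<bullet> b) ^ \<alpha> b) *\<^sub>R c \<alpha>) has_sum f x) (Basis \<rightarrow>\<^sub>E UNIV))"

definition partial_deriv :: "point \<Rightarrow> (point \<Rightarrow> quat) \<Rightarrow> point \<Rightarrow> quat" where
  "partial_deriv b f x = vector_derivative (\<lambda>t. f (x + t *\<^sub>R b)) (at 0)"

definition Vq :: "(point \<Rightarrow> quat) \<Rightarrow> point \<Rightarrow> quat" where
  "Vq f x = partial_deriv (1, 0) f x -
     inverse (vecq (snd x)) * (\<Sum>u\<in>UNIV. of_real (snd x $ u) * partial_deriv (0, axis u 1) f x)"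

text \<open>The solution on the domain \<open>U\<close>, extended by zero to make it a unique total function.\<close>

definition CK :: "point set \<Rightarrow> (real^3 \<Rightarrow> quat) \<Rightarrow> point \<Rightarrow> quat" where
  "CK U h = (THE F. F real_analytic_on U \<and> (\<forall>x\<in>U. Vq F x = 0) \<and>
     (\<forall>v. (0, v) \<in> U \<longrightarrow> F (0, v) = h v) \<and> (\<forall>x. x \<notin> U \<longrightarrow> F x = 0))"

text \<open>All functions in play live on \<^term>\<open>Omega_A\<close>, so extensions are taken there.\<close>

definition CK_mat :: "(real^3 \<Rightarrow> quat^'n^'m) \<Rightarrow> point \<Rightarrow> quat^'n^'m" where
  "CK_mat h x = (\<chi> i j. CK Omega_A (\<lambda>v. h v $ i $ j) x)"

definition ck_prod ::
  "(point \<Rightarrow> quat^'k^'m) \<Rightarrow> (point \<Rightarrow> quat^'n^'k) \<Rightarrow> point \<Rightarrow> quat^'n^'m"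
  (infixl \<open>\<star>\<close> 70) where
  "f \<star> g = CK_mat (\<lambda>v. f (0, v) ** g (0, v))"

definition ck_inverse :: "(point \<Rightarrow> quat^'n^'n) \<Rightarrow> point \<Rightarrow> quat^'n^'n" where
  "ck_inverse f = CK_mat (\<lambda>v. matrix_inv (f (0, v)))"


section \<open>Multipliers\<close>

definition left_mult :: "quat^'n^1 \<Rightarrow> (point \<Rightarrow> quat^1^'n) \<Rightarrow> point \<Rightarrow> quat^1^1" where
  "left_mult C f = (\<lambda>x. C) \<star> f"

definition strict_contraction :: "((point \<Rightarrow> quat^1^'n) \<Rightarrow> (point \<Rightarrow> quat^1^'m)) \<Rightarrow> bool" where
  "strict_contraction T \<longleftrightarrow> T ` arveson_pow \<subseteq> arveson_pow \<and> arveson_op_norm T < 1"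

definition schur_multiplier :: "(point \<Rightarrow> quat^'n^'m) \<Rightarrow> bool" where
  "schur_multiplier S \<longleftrightarrow>
     (\<lambda>f. S \<star> f) ` arveson_pow \<subseteq> arveson_pow \<and> arveson_op_norm (\<lambda>f. S \<star> f) \<le> 1"

definition blaschke :: "point \<Rightarrow> point \<Rightarrow> quat^3^1" where
  "blaschke a =
     (\<lambda>x. msqrt (mat 1 - mu_row a ** adj (mu_row a)))
       \<star> ck_inverse (\<lambda>x. mat 1 - mu_row x ** adj (mu_row a))
       \<star> (\<lambda>x. mu_row x - mu_row a)
       \<star> (\<lambda>x. matrix_inv (msqrt (mat 1 - adj (mu_row a) ** mu_row a)))"

end

(*
  On a slice (x0, r w), with w a unit vector and \<omega> the imaginary unit it defines, \<mu>_u equals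
  w_u (r - x0 \<omega>).  There Vq is a Cauchy-Riemann operator in z = r - i x0, so series in the \<mu>^\<alpha> are
  annihilated by Vq, and a solution that vanishes on x0 = 0 vanishes by the identity theorem.  Hence
  the CK-product is the product of power series in x1, x2, x3 with real variables.

  At the level of coefficients, multiplication by the row of the three variables is a contraction,
  by the recursion |\<alpha>|!/\<alpha>! = \<Sum>_u |\<alpha> - e_u|!/(\<alpha> - e_u)!.  The Blaschke factor is the transfer function
  of the unitary colligation [[-\<mu>(a), C], [D, \<mu>(a)^*]] with C^2 = 1 - \<mu>(a) \<mu>(a)^* and
  D^2 = 1 - \<mu>(a)^* \<mu>(a), closed up by this row: if w = D f + \<mu>(a)^* y, b = C y - \<mu>(a) f and y = \<Sum>_u x_u w_u,
  then b = B_a f, and |b|^2 + |w|^2 = |f|^2 + |y|^2 with |y| \<le> |w| gives |b| \<le> |f|.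
*)
theory Submission
  imports Defs "HOL-Complex_Analysis.Conformal_Mappings"
begin


section \<open>The quaternions as a Euclidean space\<close>

text \<open>Two features of the definitions shape the proof. \<open>CK\<close> and
  \<open>arveson_coeff\<close> are definite descriptions, so nothing can be evaluated before
  existence and uniqueness are known, on all of \<open>Omega_A\<close> and not only near x0 = 0. And
  \<open>\<star>\<close> associates to the left, so each partial product of the Blaschke formula
  needs such a global extension of its own. The resolvent and the partial products are therefore
  obtained from the same colligation at constant inputs, which places their coefficients in the
  Arveson space at once. The energy balance cannot be used with total norms: the internal signal y
  is built as a formal series, and cancelling its norm would presuppose that it is finite. As the
  row of variables raises the degree by one, the balance telescopes over degrees, and dropping the
  nonnegative top term of y bounds b. Then y = (b + \<mu>(a) f) / C has finite norm as well. At x0 =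
  0 the \<mu>_u are real and commute with all quaternions, so the transfer function is computed
  there by plain matrix algebra.\<close>

instantiation quat :: euclidean_space
begin

definition "inner p q = Qre p * Qre q + Qi p * Qi q + Qj p * Qj q + Qk p * Qk q"
definition "(Basis :: quat set) = {1, Quat 0 1 0 0, Quat 0 0 1 0, Quat 0 0 0 1}"

instance
proof
  fix p q r :: quat and c :: real
  show "norm p = sqrt (inner p p)"
    by (simp add: inner_quat_def norm_quat_def power2_eq_square)
  show "inner p p = 0 \<longleftrightarrow> p = 0"
  proof -
    have "inner p p = (norm p)\<^sup>2"
      by (simp add: inner_quat_def norm_quat_def power2_eq_square)
    then show ?thesis by simp
  qed
  show "(\<forall>u\<in>Basis. inner p u = 0) \<longleftrightarrow> p = 0"
    unfolding Basis_quat_def quat_eq_iff[of p 0] by (simp add: inner_quat_def)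
qed (auto simp: inner_quat_def Basis_quat_def quat_eq_iff algebra_simps one_quat_def)

end

section \<open>Absolutely convergent power series\<close>

text \<open>Absolute summability provides a joint sum; \<open>has_sum_SigmaD\<close> then forces it
  to agree with the iterated one.\<close>

lemma has_sum_Sigma_abs:
  fixes f :: "'j \<times> 'k \<Rightarrow> 'b::banach"
  assumes "(\<lambda>z. norm (f z)) summable_on Sigma A B"
    and g: "\<And>j. j \<in> A \<Longrightarrow> ((\<lambda>k. f (j, k)) has_sum g j) (B j)"
    and "(g has_sum S) A"
  shows "(f has_sum S) (Sigma A B)"
proof -
  have "f summable_on Sigma A B" using assms(1) by (rule abs_summable_summable)
  then have 1: "(f has_sum infsum f (Sigma A B)) (Sigma A B)" by simp
  have "(g has_sum infsum f (Sigma A B)) A" by (rule has_sum_SigmaD[OF 1 g])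
  then show ?thesis using 1 assms(3) has_sum_unique by blast
qed

definition midx :: "('a::euclidean_space \<Rightarrow> nat) set" where
  "midx = Basis \<rightarrow>\<^sub>E UNIV"

definition mon :: "'a::euclidean_space \<Rightarrow> ('a \<Rightarrow> nat) \<Rightarrow> real" where
  "mon h \<alpha> = (\<Prod>b\<in>Basis. (h \<bullet> b) ^ \<alpha> b)"

definition mdeg :: "('a::euclidean_space \<Rightarrow> nat) \<Rightarrow> nat" where
  "mdeg \<alpha> = (\<Sum>b\<in>Basis. \<alpha> b)"

text \<open>A real closed polydisc. Boxes suit multiple power series better than balls, because a
  corner attains the bound \<open>r ^ mdeg \<alpha>\<close> for all monomials
  simultaneously.\<close>

definition box_at :: "'a::euclidean_space \<Rightarrow> real \<Rightarrow> 'a set" where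
  "box_at p r = {x. \<forall>b\<in>Basis. \<bar>(x - p) \<bullet> b\<bar> \<le> r}"

lemma mon_bound:
  assumes "x \<in> box_at p r"
  shows "\<bar>mon (x - p) \<alpha>\<bar> \<le> r ^ mdeg \<alpha>"
proof -
  have "\<bar>mon (x - p) \<alpha>\<bar> = (\<Prod>b\<in>Basis. \<bar>(x - p) \<bullet> b\<bar> ^ \<alpha> b)"
    by (simp add: mon_def abs_prod power_abs)
  also have "\<dots> \<le> (\<Prod>b\<in>(Basis::'a set). r ^ \<alpha> b)"
    using assms by (intro prod_mono) (auto simp: box_at_def intro!: power_mono)
  finally show ?thesis by (simp add: mdeg_def power_sum)
qed

lemma box_at_mono: "r' \<le> r \<Longrightarrow> box_at p r' \<subseteq> box_at p r"
  by (force simp: box_at_def)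

lemma ball_subset_box_at: "ball p r \<subseteq> box_at p r"
proof
  fix x assume "x \<in> ball p r"
  then have "norm (x - p) \<le> r" by (simp add: dist_norm norm_minus_commute)
  then show "x \<in> box_at p r"
    unfolding box_at_def using Basis_le_norm order_trans by blast
qed

text \<open>\<open>M\<close> bounds a weighted l1 norm of the coefficients, which is
  submultiplicative and dominates the sup norm on the box. With the bound as a parameter,
  convergence of composite series reduces to convergence of numerical series.\<close>

definition has_pser :: "'a::euclidean_space \<Rightarrow> real \<Rightarrow> real \<Rightarrow> ('a \<Rightarrow> 'b::banach) \<Rightarrow> bool" where
  "has_pser p r M f \<longleftrightarrow> 0 < r \<and> (\<exists>c S. ((\<lambda>\<alpha>. r ^ mdeg \<alpha> * norm (c \<alpha>)) has_sum S) midx \<and> S \<le> M \<and>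
     (\<forall>x\<in>box_at p r. ((\<lambda>\<alpha>. mon (x - p) \<alpha> *\<^sub>R c \<alpha>) has_sum f x) midx))"

text \<open>The exponents \<open>e k\<close> may repeat, so that products and compositions need no regrouping.\<close>

lemma has_pserI:
  fixes d :: "'k \<Rightarrow> 'b::banach" and e :: "'k \<Rightarrow> 'a::euclidean_space \<Rightarrow> nat"
  assumes r: "0 < r" and e: "\<And>k. k \<in> K \<Longrightarrow> e k \<in> midx"
    and S: "((\<lambda>k. r ^ mdeg (e k) * norm (d k)) has_sum S) K" "S \<le> M"
    and f: "\<And>x. x \<in> box_at p r \<Longrightarrow> ((\<lambda>k. mon (x - p) (e k) *\<^sub>R d k) has_sum f x) K"
  shows "has_pser p r M f"
proof -
  define B where "B \<alpha> = {k\<in>K. e k = \<alpha>}" for \<alpha>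
  \<comment> \<open>Terms of equal exponent are collected; the weight is constant on each fibre of
    \<open>e\<close>, so absolute summability survives.\<close>
  define c where "c \<alpha> = infsum d (B \<alpha>)" for \<alpha>
  have bij: "bij_betw snd (Sigma midx B) K"
    using e by (auto simp: bij_betw_def inj_on_def B_def image_iff)
  have S1: "((\<lambda>z. r ^ mdeg (fst z) * norm (d (snd z))) has_sum S) (Sigma midx B)"
  proof -
    have "((\<lambda>z. r ^ mdeg (e (snd z)) * norm (d (snd z))) has_sum S) (Sigma midx B)"
      using has_sum_reindex_bij_betw[OF bij, of "\<lambda>k. r ^ mdeg (e k) * norm (d k)"] S by simp
    then show ?thesis
      by (rule has_sum_cong[THEN iffD1, rotated]) (auto simp: B_def)
  qed
  have abs_B: "(\<lambda>k. norm (d k)) summable_on B \<alpha>" if "\<alpha> \<in> midx" for \<alpha>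
  proof -
    have "(\<lambda>k. r ^ mdeg (e k) * norm (d k)) summable_on B \<alpha>"
      by (rule summable_on_subset_banach[OF has_sum_imp_summable[OF S(1)]]) (auto simp: B_def)
    then have "(\<lambda>k. r ^ mdeg \<alpha> * norm (d k)) summable_on B \<alpha>"
      by (rule summable_on_cong[THEN iffD1, rotated]) (auto simp: B_def)
    then show ?thesis using r by (simp add: summable_on_cmult_right')
  qed
  have d_B: "(d has_sum c \<alpha>) (B \<alpha>)" if "\<alpha> \<in> midx" for \<alpha>
    using abs_summable_summable[OF abs_B[OF that]] by (simp add: c_def)
  define n where "n \<alpha> = (\<Sum>\<^sub>\<infinity>k\<in>B \<alpha>. norm (d k))" for \<alpha>
  have n_sum: "((\<lambda>\<alpha>. r ^ mdeg \<alpha> * n \<alpha>) has_sum S) midx"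
    using abs_B by (intro has_sum_SigmaD[OF S1]) (auto simp: n_def intro!: has_sum_cmult_right)
  have cn: "norm (c \<alpha>) \<le> n \<alpha>" if "\<alpha> \<in> midx" for \<alpha>
    unfolding c_def n_def by (rule norm_infsum_bound[OF abs_B[OF that]])
  have c_sum: "(\<lambda>\<alpha>. r ^ mdeg \<alpha> * norm (c \<alpha>)) summable_on midx"
    using has_sum_imp_summable[OF n_sum]
    by (rule summable_on_comparison_test) (use r cn in \<open>auto intro!: mult_left_mono\<close>)
  have "infsum (\<lambda>\<alpha>. r ^ mdeg \<alpha> * norm (c \<alpha>)) midx \<le> S"
    using r cn by (intro has_sum_mono[OF has_sum_infsum[OF c_sum] n_sum]) (auto intro!: mult_left_mono)
  moreover have "((\<lambda>\<alpha>. mon (x - p) \<alpha> *\<^sub>R c \<alpha>) has_sum f x) midx" if x: "x \<in> box_at p r" for x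
  proof -
    have "((\<lambda>z. mon (x - p) (e (snd z)) *\<^sub>R d (snd z)) has_sum f x) (Sigma midx B)"
      using has_sum_reindex_bij_betw[OF bij, of "\<lambda>k. mon (x - p) (e k) *\<^sub>R d k"] f[OF x] by simp
    then have "((\<lambda>z. mon (x - p) (fst z) *\<^sub>R d (snd z)) has_sum f x) (Sigma midx B)"
      by (rule has_sum_cong[THEN iffD1, rotated]) (auto simp: B_def)
    then show ?thesis
      by (rule has_sum_SigmaD) (use d_B in \<open>auto intro!: has_sum_scaleR\<close>)
  qed
  ultimately show ?thesis
    unfolding has_pser_def using r c_sum S(2) by (meson has_sum_infsum order_trans)
qed

lemma has_pser_cong:
  assumes "has_pser p r M f" "\<And>x. x \<in> box_at p r \<Longrightarrow> f x = g x"
  shows "has_pser p r M g"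
  using assms unfolding has_pser_def by metis

lemma has_pser_pos: "has_pser p r M f \<Longrightarrow> 0 < r"
  by (simp add: has_pser_def)

lemma has_pser_mono:
  assumes "has_pser p r M f" "M \<le> N"
  shows "has_pser p r N f"
  using assms unfolding has_pser_def by (blast intro: order_trans)

lemma has_pser_norm_le:
  assumes "has_pser p r M f" "x \<in> box_at p r"
  shows "norm (f x) \<le> M"
proof -
  obtain c S where c: "((\<lambda>\<alpha>. r ^ mdeg \<alpha> * norm (c \<alpha>)) has_sum S) midx" "S \<le> M"
      "((\<lambda>\<alpha>. mon (x - p) \<alpha> *\<^sub>R c \<alpha>) has_sum f x) midx" and r: "0 < r"
    using assms unfolding has_pser_def by blast
  have le: "norm (mon (x - p) \<alpha> *\<^sub>R c \<alpha>) \<le> r ^ mdeg \<alpha> * norm (c \<alpha>)" for \<alpha>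
    using mon_bound[OF assms(2), of \<alpha>] by (simp add: mult_right_mono)
  have *: "(\<lambda>\<alpha>. norm (mon (x - p) \<alpha> *\<^sub>R c \<alpha>)) summable_on midx"
    using has_sum_imp_summable[OF c(1)] by (rule summable_on_comparison_test) (use le in auto)
  have "norm (f x) \<le> (\<Sum>\<^sub>\<infinity>\<alpha>\<in>midx. norm (mon (x - p) \<alpha> *\<^sub>R c \<alpha>))"
    by (rule norm_has_sum_bound[OF has_sum_infsum[OF *] c(3)])
  also have "\<dots> \<le> S" by (rule has_sum_mono[OF has_sum_infsum[OF *] c(1) le])
  finally show ?thesis using c(2) by simp
qed

lemma has_pser_nonneg:
  assumes "has_pser p r M f"
  shows "0 \<le> M"
proof -
  have "p \<in> box_at p r" using has_pser_pos[OF assms] by (simp add: box_at_def)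
  then have "norm (f p) \<le> M" by (rule has_pser_norm_le[OF assms])
  then show ?thesis by (rule order_trans[OF norm_ge_zero])
qed

text \<open>Completeness of the algebra: the double family over \<open>J \<times> midx\<close> is
  absolutely summable because the bounds \<open>M j\<close> are, and \<open>has_pserI\<close>
  absorbs the repeated exponents.\<close>

lemma has_pser_sum:
  fixes f :: "'j \<Rightarrow> 'a::euclidean_space \<Rightarrow> 'b::banach"
  assumes r: "0 < r" and f: "\<And>j. j \<in> J \<Longrightarrow> has_pser p r (M j) (f j)"
    and M: "(M has_sum M0) J"
    and F: "\<And>x. x \<in> box_at p r \<Longrightarrow> ((\<lambda>j. f j x) has_sum F x) J"
  shows "has_pser p r M0 F"
proof -
  define P where "P j c S \<longleftrightarrow> ((\<lambda>\<alpha>. r ^ mdeg \<alpha> * norm (c \<alpha>)) has_sum S) midx \<and> S \<le> M j \<and>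
     (\<forall>x\<in>box_at p r. ((\<lambda>\<alpha>. mon (x - p) \<alpha> *\<^sub>R c \<alpha>) has_sum f j x) midx)" for j c S
  have "\<forall>j\<in>J. \<exists>c S. P j c S"
    using f unfolding has_pser_def P_def by blast
  then obtain c where "\<forall>j\<in>J. \<exists>S. P j (c j) S" using bchoice by metis
  then obtain S where "\<forall>j\<in>J. P j (c j) (S j)" using bchoice by metis
  then have c: "\<And>j. j \<in> J \<Longrightarrow> ((\<lambda>\<alpha>. r ^ mdeg \<alpha> * norm (c j \<alpha>)) has_sum S j) midx"
      "\<And>j. j \<in> J \<Longrightarrow> S j \<le> M j"
      "\<And>j x. j \<in> J \<Longrightarrow> x \<in> box_at p r \<Longrightarrow> ((\<lambda>\<alpha>. mon (x - p) \<alpha> *\<^sub>R c j \<alpha>) has_sum f j x) midx"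
    by (simp_all add: P_def)
  have S_nonneg: "0 \<le> S j" if "j \<in> J" for j
    using c(1)[OF that] by (rule has_sum_nonneg) (use r in auto)
  have S_sum: "S summable_on J"
    using has_sum_imp_summable[OF M] by (rule summable_on_comparison_test) (use c(2) S_nonneg in auto)
  have sum1: "(\<lambda>(j, \<alpha>). r ^ mdeg \<alpha> * norm (c j \<alpha>)) summable_on J \<times> midx"
    by (rule summable_on_SigmaI[where g = S]) (use c(1) S_sum r in auto)
  define T where "T = infsum (\<lambda>(j, \<alpha>). r ^ mdeg \<alpha> * norm (c j \<alpha>)) (J \<times> midx)"
  have T: "((\<lambda>(j, \<alpha>). r ^ mdeg \<alpha> * norm (c j \<alpha>)) has_sum T) (J \<times> midx)"
    unfolding T_def using sum1 by (rule has_sum_infsum)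
  have "(S has_sum T) J"
    by (rule has_sum_SigmaD[OF T]) (use c(1) in auto)
  then have "T \<le> M0"
    by (rule has_sum_mono) (use M c(2) in auto)
  show ?thesis
  proof (rule has_pserI[where K = "J \<times> midx" and e = snd and d = "\<lambda>(j, \<alpha>). c j \<alpha>" and S = T])
    show "((\<lambda>k. r ^ mdeg (snd k) * norm (case k of (j, \<alpha>) \<Rightarrow> c j \<alpha>)) has_sum T) (J \<times> midx)"
      using T by (simp add: case_prod_unfold)
    fix x assume x: "x \<in> box_at p r"
    show "((\<lambda>k. mon (x - p) (snd k) *\<^sub>R (case k of (j, \<alpha>) \<Rightarrow> c j \<alpha>)) has_sum F x) (J \<times> midx)"
    proof (rule has_sum_Sigma_abs[OF _ _ F[OF x]])
      show "(\<lambda>z. norm (mon (x - p) (snd z) *\<^sub>R (case z of (j, \<alpha>) \<Rightarrow> c j \<alpha>))) summable_on J \<times> midx"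
        using sum1 by (rule summable_on_comparison_test)
          (auto intro!: mult_right_mono mon_bound[OF x])
    qed (use c(3) x in auto)
  qed (use r \<open>T \<le> M0\<close> in auto)
qed

definition midx_add :: "('a::euclidean_space \<Rightarrow> nat) \<Rightarrow> ('a \<Rightarrow> nat) \<Rightarrow> 'a \<Rightarrow> nat" where
  "midx_add \<alpha> \<beta> = restrict (\<lambda>b. \<alpha> b + \<beta> b) Basis"

lemma midx_add_simps [simp]:
  "midx_add \<alpha> \<beta> \<in> midx" "mon h (midx_add \<alpha> \<beta>) = mon h \<alpha> * mon h \<beta>"
  "mdeg (midx_add \<alpha> \<beta>) = mdeg \<alpha> + mdeg \<beta>"
  by (auto simp: midx_add_def midx_def mon_def mdeg_def power_add prod.distrib sum.distrib)

lemma has_pser_mult: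
  fixes f g :: "'a::euclidean_space \<Rightarrow> 'b::{real_normed_div_algebra, banach}"
  assumes f: "has_pser p r M f" and g: "has_pser p r N g"
  shows "has_pser p r (M * N) (\<lambda>x. f x * g x)"
proof -
  obtain c S where c: "((\<lambda>\<alpha>. r ^ mdeg \<alpha> * norm (c \<alpha>)) has_sum S) midx" "S \<le> M"
      "\<And>x. x \<in> box_at p r \<Longrightarrow> ((\<lambda>\<alpha>. mon (x - p) \<alpha> *\<^sub>R c \<alpha>) has_sum f x) midx" and r: "0 < r"
    using f unfolding has_pser_def by blast
  obtain d T where d: "((\<lambda>\<alpha>. r ^ mdeg \<alpha> * norm (d \<alpha>)) has_sum T) midx" "T \<le> N"
      "\<And>x. x \<in> box_at p r \<Longrightarrow> ((\<lambda>\<alpha>. mon (x - p) \<alpha> *\<^sub>R d \<alpha>) has_sum g x) midx"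
    using g unfolding has_pser_def by blast
  have "0 \<le> S" "0 \<le> T"
    using has_sum_nonneg[OF c(1)] has_sum_nonneg[OF d(1)] r by auto
  have ST: "S * T \<le> M * N"
    using \<open>0 \<le> S\<close> \<open>0 \<le> T\<close> c(2) d(2) by (intro mult_mono) auto
  have in1: "((\<lambda>\<beta>. (r ^ mdeg \<alpha> * norm (c \<alpha>)) * (r ^ mdeg \<beta> * norm (d \<beta>)))
      has_sum (r ^ mdeg \<alpha> * norm (c \<alpha>)) * T) midx" for \<alpha>
    using d(1) by (rule has_sum_cmult_right)
  have out1: "((\<lambda>\<alpha>. (r ^ mdeg \<alpha> * norm (c \<alpha>)) * T) has_sum S * T) midx"
    using c(1) by (rule has_sum_cmult_left)
  have sum1: "(\<lambda>(\<alpha>, \<beta>). (r ^ mdeg \<alpha> * norm (c \<alpha>)) * (r ^ mdeg \<beta> * norm (d \<beta>)))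
      summable_on midx \<times> midx"
    by (rule summable_on_SigmaI[where g = "\<lambda>\<alpha>. (r ^ mdeg \<alpha> * norm (c \<alpha>)) * T"])
      (use in1 has_sum_imp_summable[OF out1] r in auto)
  have hs1: "((\<lambda>(\<alpha>, \<beta>). (r ^ mdeg \<alpha> * norm (c \<alpha>)) * (r ^ mdeg \<beta> * norm (d \<beta>)))
      has_sum S * T) (midx \<times> midx)"
    by (rule has_sum_Sigma_abs[OF _ _ out1]) (use sum1 in1 r in \<open>auto simp: case_prod_unfold abs_mult\<close>)
  show ?thesis
  proof (rule has_pserI[where K = "midx \<times> midx" and e = "\<lambda>(\<alpha>, \<beta>). midx_add \<alpha> \<beta>" and
        d = "\<lambda>(\<alpha>, \<beta>). c \<alpha> * d \<beta>" and S = "S * T", OF r _ _ ST])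
    show "((\<lambda>k. r ^ mdeg (case k of (\<alpha>, \<beta>) \<Rightarrow> midx_add \<alpha> \<beta>) * norm (case k of (\<alpha>, \<beta>) \<Rightarrow> c \<alpha> * d \<beta>))
      has_sum S * T) (midx \<times> midx)"
      using hs1 by (simp add: case_prod_unfold power_add norm_mult mult_ac)
    fix x assume x: "x \<in> box_at p r"
    have le: "norm (mon (x - p) \<alpha> *\<^sub>R u) \<le> r ^ mdeg \<alpha> * norm u" for \<alpha> and u :: 'b
      using mon_bound[OF x] by (simp add: mult_right_mono)
    have in2: "((\<lambda>\<beta>. (mon (x - p) \<alpha> *\<^sub>R c \<alpha>) * (mon (x - p) \<beta> *\<^sub>R d \<beta>))
        has_sum (mon (x - p) \<alpha> *\<^sub>R c \<alpha>) * g x) midx" for \<alpha>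
      using d(3)[OF x] by (rule has_sum_cmult_right)
    have out2: "((\<lambda>\<alpha>. (mon (x - p) \<alpha> *\<^sub>R c \<alpha>) * g x) has_sum f x * g x) midx"
      using c(3)[OF x] by (rule has_sum_cmult_left)
    have "((\<lambda>(\<alpha>, \<beta>). (mon (x - p) \<alpha> *\<^sub>R c \<alpha>) * (mon (x - p) \<beta> *\<^sub>R d \<beta>)) has_sum f x * g x)
        (midx \<times> midx)"
    proof (rule has_sum_Sigma_abs[OF _ _ out2])
      show "(\<lambda>z. norm (case z of (\<alpha>, \<beta>) \<Rightarrow> (mon (x - p) \<alpha> *\<^sub>R c \<alpha>) * (mon (x - p) \<beta> *\<^sub>R d \<beta>)))
        summable_on midx \<times> midx"
        using sum1 by (rule summable_on_comparison_test)
          (use r in \<open>auto simp: norm_mult simp del: norm_scaleR mult_scaleR_left mult_scaleR_right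
            intro!: mult_mono le\<close>)
    qed (use in2 in auto)
    then show "((\<lambda>k. mon (x - p) (case k of (\<alpha>, \<beta>) \<Rightarrow> midx_add \<alpha> \<beta>) *\<^sub>R
        (case k of (\<alpha>, \<beta>) \<Rightarrow> c \<alpha> * d \<beta>)) has_sum f x * g x) (midx \<times> midx)"
      by (simp add: case_prod_unfold mult_ac)
  qed auto
qed

definition midx0 :: "'a::euclidean_space \<Rightarrow> nat" where
  "midx0 = restrict (\<lambda>b. 0) Basis"

definition midx1 :: "'a::euclidean_space \<Rightarrow> 'a \<Rightarrow> nat" where
  "midx1 b = restrict (\<lambda>b'. if b' = b then 1 else 0) Basis"

lemma midx0_simps [simp]: "midx0 \<in> midx" "mon h midx0 = 1" "mdeg midx0 = 0"
  by (auto simp: midx0_def midx_def mon_def mdeg_def)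

lemma midx1_simps [simp]:
  assumes "b \<in> Basis"
  shows "midx1 b \<in> midx" "mon h (midx1 b) = h \<bullet> b" "mdeg (midx1 b) = 1"
proof -
  show "midx1 b \<in> midx" by (auto simp: midx1_def midx_def)
  have "mon h (midx1 b) = (\<Prod>b'\<in>Basis. if b' = b then h \<bullet> b' else 1)"
    unfolding mon_def midx1_def by (intro prod.cong) auto
  then show "mon h (midx1 b) = h \<bullet> b" using assms by (simp add: prod.delta)
  have "mdeg (midx1 b) = (\<Sum>b'\<in>Basis. if b' = b then 1 else 0)"
    unfolding mdeg_def midx1_def by (intro sum.cong) auto
  then show "mdeg (midx1 b) = 1" using assms by (simp add: sum.delta)
qed

lemma mdeg_eq_0: "\<alpha> \<in> midx \<Longrightarrow> mdeg \<alpha> = 0 \<longleftrightarrow> \<alpha> = midx0"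
  by (auto simp: mdeg_def midx0_def midx_def PiE_def extensional_def fun_eq_iff)

lemma has_pser_const: "0 < r \<Longrightarrow> has_pser p r (norm c) (\<lambda>x. c)"
  by (rule has_pserI[where K = "{()}" and e = "\<lambda>_. midx0" and d = "\<lambda>_. c" and S = "norm c"])
    (auto intro!: has_sum_finiteI)

lemma has_pser_linear:
  "0 < r \<Longrightarrow> b \<in> Basis \<Longrightarrow> has_pser p r (r * norm c) (\<lambda>x. ((x - p) \<bullet> b) *\<^sub>R c)"
  by (rule has_pserI[where K = "{()}" and e = "\<lambda>_. midx1 b" and d = "\<lambda>_. c" and S = "r * norm c"])
    (auto intro!: has_sum_finiteI)

lemma has_pser_add:
  assumes "has_pser p r M f" "has_pser p r N g"
  shows "has_pser p r (M + N) (\<lambda>x. f x + g x)"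
  by (rule has_pser_sum[where J = UNIV and f = "\<lambda>j. if j then f else g" and M = "\<lambda>j. if j then M else N"])
    (use assms has_pser_pos[OF assms(1)] in \<open>auto intro!: has_sum_finiteI simp: UNIV_bool\<close>)

text \<open>The constant term keeps its size, while every other term gains at least one factor
  \<open>r' / r\<close>.\<close>

lemma has_pser_shrink:
  assumes "has_pser p r M f" "0 < r'" "r' \<le> r"
  shows "has_pser p r' (norm (f p) + r' / r * M) f"
proof -
  obtain c S where c: "((\<lambda>\<alpha>. r ^ mdeg \<alpha> * norm (c \<alpha>)) has_sum S) midx" "S \<le> M"
      "\<And>x. x \<in> box_at p r \<Longrightarrow> ((\<lambda>\<alpha>. mon (x - p) \<alpha> *\<^sub>R c \<alpha>) has_sum f x) midx" and r: "0 < r"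
    using assms unfolding has_pser_def by blast
  have mon0: "mon 0 \<alpha> = 0" if "\<alpha> \<in> midx" "\<alpha> \<noteq> midx0" for \<alpha> :: "'a \<Rightarrow> nat"
  proof -
    have "mdeg \<alpha> > 0" using that mdeg_eq_0 by blast
    with mon_bound[of 0 0 0 \<alpha>] show ?thesis by (simp add: box_at_def zero_power)
  qed
  have "((\<lambda>\<alpha>. mon (p - p) \<alpha> *\<^sub>R c \<alpha>) has_sum f p) midx"
    using r by (intro c(3)) (simp add: box_at_def)
  moreover have "((\<lambda>\<alpha>. mon (p - p) \<alpha> *\<^sub>R c \<alpha>) has_sum c midx0) midx"
    by (rule has_sum_finite_neutralI[where B = "{midx0}"]) (use mon0 in auto)
  ultimately have fp: "f p = c midx0" using has_sum_unique by blast
  have "((\<lambda>\<alpha>. r' / r * (r ^ mdeg \<alpha> * norm (c \<alpha>)) + (if \<alpha> = midx0 then norm (c \<alpha>) else 0))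
      has_sum r' / r * S + norm (c midx0)) midx"
    by (intro has_sum_add has_sum_cmult_right c(1) has_sum_finite_neutralI[where B = "{midx0}"]) auto
  note big = this
  have le: "r' ^ mdeg \<alpha> * norm (c \<alpha>) \<le> r' / r * (r ^ mdeg \<alpha> * norm (c \<alpha>)) + (if \<alpha> = midx0 then norm (c \<alpha>) else 0)"
    if "\<alpha> \<in> midx" for \<alpha>
  proof (cases "\<alpha> = midx0")
    case False
    then have "mdeg \<alpha> > 0" using that mdeg_eq_0 by blast
    then obtain k where k: "mdeg \<alpha> = Suc k" by (cases "mdeg \<alpha>") auto
    have "r' ^ k \<le> r ^ k" using assms by (intro power_mono) auto
    then have "r' * r' ^ k \<le> r' / r * (r * r ^ k)" using r assms by simp
    then have "r' ^ mdeg \<alpha> * norm (c \<alpha>) \<le> r' / r * (r * r ^ k) * norm (c \<alpha>)"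
      unfolding k power_Suc by (intro mult_right_mono) auto
    then have "r' ^ mdeg \<alpha> * norm (c \<alpha>) \<le> r' / r * (r ^ mdeg \<alpha> * norm (c \<alpha>))"
      by (simp only: k power_Suc mult.assoc)
    then show ?thesis using False by simp
  qed (use assms r in auto)
  have s: "(\<lambda>\<alpha>. r' ^ mdeg \<alpha> * norm (c \<alpha>)) summable_on midx"
    using has_sum_imp_summable[OF big] by (rule summable_on_comparison_test) (use le assms in auto)
  have "infsum (\<lambda>\<alpha>. r' ^ mdeg \<alpha> * norm (c \<alpha>)) midx \<le> r' / r * S + norm (c midx0)"
    by (rule has_sum_mono[OF has_sum_infsum[OF s] big le])
  also have "\<dots> \<le> norm (f p) + r' / r * M"
    using c(2) assms r fp by (simp add: divide_right_mono mult_left_mono)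
  finally show ?thesis
    unfolding has_pser_def using assms(2) has_sum_infsum[OF s] c(3) box_at_mono[OF assms(3)] by blast
qed

section \<open>Germs of analytic functions\<close>

definition an :: "'a::euclidean_space \<Rightarrow> ('a \<Rightarrow> 'b::banach) \<Rightarrow> bool" where
  "an p f \<longleftrightarrow> (\<exists>r M. has_pser p r M f)"

text \<open>All but the constant term shrinks with the radius, so any bound above the value at
  \<open>p\<close> holds on small boxes. Inversion and series in the \<mu>_u both rest on
  this.\<close>

lemma an_small:
  assumes "an p f" "norm (f p) < M"
  shows "\<forall>\<^sub>F r in at_right 0. has_pser p r M f"
proof -
  obtain r N where rN: "has_pser p r N f" using assms(1) by (auto simp: an_def)
  have r: "0 < r" and N: "0 \<le> N" using rN has_pser_pos has_pser_nonneg by blast+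
  \<comment> \<open>Chosen so that \<open>r' / r * N\<close> fits into the gap
    \<open>M - norm (f p)\<close>; the added 1 avoids a division by zero when
    \<open>N = 0\<close>.\<close>
  define d where "d = min r (r * (M - norm (f p)) / (N + 1))"
  have "0 < d" using r N assms(2) by (simp add: d_def)
  have "has_pser p r' M f" if r': "0 < r'" "r' < d" for r'
  proof -
    have "has_pser p r' (norm (f p) + r' / r * N) f"
      using rN r' by (intro has_pser_shrink) (auto simp: d_def)
    moreover have "norm (f p) + r' / r * N \<le> M"
    proof -
      have "r' * (N + 1) \<le> r * (M - norm (f p))"
        using r' N by (simp add: d_def pos_less_divide_eq)
      then have "r' * N \<le> r * (M - norm (f p))" using r' by (simp add: algebra_simps)
      then show ?thesis using r by (simp add: field_simps)
    qed
    ultimately show ?thesis by (rule has_pser_mono)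
  qed
  then show ?thesis
    using \<open>0 < d\<close> by (auto simp: eventually_at_right_field intro!: exI[of _ d])
qed

lemma an_small': "an p f \<Longrightarrow> \<exists>M. \<forall>\<^sub>F r in at_right 0. has_pser p r M f"
  by (rule exI, rule an_small[of p f "norm (f p) + 1"]) simp_all

lemma eventually_at_right_ex:
  assumes "\<forall>\<^sub>F r in at_right (0::real). P r"
  shows "\<exists>r>0. P r"
proof -
  obtain b where "0 < b" "\<And>y. 0 < y \<Longrightarrow> y < b \<Longrightarrow> P y"
    using assms unfolding eventually_at_right_field by blast
  from this(2)[of "b / 2"] \<open>0 < b\<close> show ?thesis by (intro exI[of _ "b / 2"]) simp
qed

lemma an_const: "an p (\<lambda>x. c)"
  using has_pser_const[of 1] by (auto simp: an_def)

lemma an_add: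
  assumes "an p f" "an p g"
  shows "an p (\<lambda>x. f x + g x)"
proof -
  obtain M where M: "\<forall>\<^sub>F r in at_right 0. has_pser p r M f"
    using assms(1) an_small' by blast
  obtain N where "\<forall>\<^sub>F r in at_right 0. has_pser p r N g"
    using assms(2) an_small' by blast
  with M have "\<forall>\<^sub>F r in at_right 0. has_pser p r (M + N) (\<lambda>x. f x + g x)"
    by eventually_elim (rule has_pser_add)
  then show ?thesis unfolding an_def using eventually_at_right_ex by blast
qed

lemma an_mult:
  fixes f g :: "'a::euclidean_space \<Rightarrow> 'b::{real_normed_div_algebra, banach}"
  assumes "an p f" "an p g"
  shows "an p (\<lambda>x. f x * g x)"
proof -
  obtain M where M: "\<forall>\<^sub>F r in at_right 0. has_pser p r M f"
    using assms(1) an_small' by blast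
  obtain N where "\<forall>\<^sub>F r in at_right 0. has_pser p r N g"
    using assms(2) an_small' by blast
  with M have "\<forall>\<^sub>F r in at_right 0. has_pser p r (M * N) (\<lambda>x. f x * g x)"
    by eventually_elim (rule has_pser_mult)
  then show ?thesis unfolding an_def using eventually_at_right_ex by blast
qed

lemma an_coord:
  assumes "b \<in> Basis"
  shows "an p (\<lambda>x. (x \<bullet> b) *\<^sub>R c)"
proof -
  have "an p (\<lambda>x. (p \<bullet> b) *\<^sub>R c + ((x - p) \<bullet> b) *\<^sub>R c)"
    using has_pser_linear[OF zero_less_one assms] by (intro an_add an_const) (auto simp: an_def)
  then show ?thesis by (simp add: inner_diff_left flip: scaleR_add_left)
qed

lemma has_pser_power:
  fixes f :: "'a::euclidean_space \<Rightarrow> 'b::{real_normed_div_algebra, banach}"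
  assumes "has_pser p r M f"
  shows "has_pser p r (M ^ n) (\<lambda>x. f x ^ n)"
proof (induction n)
  case 0
  then show ?case using has_pser_const[of r p "1::'b"] has_pser_pos[OF assms] by simp
next
  case (Suc n)
  then show ?case using has_pser_mult[OF assms] by simp
qed

text \<open>Normalized by its value at \<open>p\<close>, the germ becomes 1 - g with g vanishing at
  \<open>p\<close>. On a small box g has bound 1/2, and the Neumann series has bound 2.\<close>

lemma an_inverse:
  fixes f :: "'a::euclidean_space \<Rightarrow> 'b::{real_normed_div_algebra, banach}"
  assumes "an p f" "f p \<noteq> 0"
  shows "an p (\<lambda>x. inverse (f x))"
proof -
  define g where "g x = 1 + (- inverse (f p)) * f x" for x
  have "an p g" unfolding g_def by (intro an_add an_mult an_const assms)
  moreover have "g p = 0" using assms(2) by (simp add: g_def)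
  ultimately obtain r where g: "has_pser p r (1/2) g"
    using an_small[of p g "1/2"] eventually_at_right_ex by fastforce
  have "has_pser p r 2 (\<lambda>x. inverse (1 - g x))"
  proof (rule has_pser_sum[where J = UNIV and f = "\<lambda>n x. g x ^ n" and M = "\<lambda>n. (1/2) ^ n"])
    show "((\<lambda>n. (1/2) ^ n) has_sum (2::real)) UNIV"
      using norm_summable_imp_has_sum[of "\<lambda>n. (1/2::real) ^ n" 2] geometric_sums[of "1/2::real"]
      by (simp add: summable_geometric norm_power)
    fix x assume "x \<in> box_at p r"
    then have *: "norm (g x) < 1" using has_pser_norm_le[OF g] by fastforce
    have "(\<Sum>n. g x ^ n) * (1 - g x) = 1"
    proof -
      have s: "summable (\<lambda>n. g x ^ n)"
        by (rule summable_norm_cancel) (use * in \<open>simp add: norm_power summable_geometric\<close>)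
      have "(\<lambda>n. g x ^ n * (1 - g x)) sums ((\<Sum>n. g x ^ n) * (1 - g x))"
        using s by (intro sums_mult2 summable_sums)
      moreover have "(\<lambda>n. g x ^ n * (1 - g x)) sums 1"
      proof -
        have "(\<lambda>n. g x ^ n) \<longlonglongrightarrow> 0" using * by (rule LIMSEQ_power_zero)
        then have "(\<lambda>n. g x ^ n - g x ^ Suc n) sums (g x ^ 0 - 0)" by (rule telescope_sums')
        then show ?thesis by (simp add: right_diff_distrib power_commutes)
      qed
      ultimately show ?thesis by (rule sums_unique2)
    qed
    then have "(\<Sum>n. g x ^ n) = inverse (1 - g x)" by (metis inverse_unique inverse_inverse_eq)
    moreover have "((\<lambda>n. g x ^ n) has_sum (\<Sum>n. g x ^ n)) UNIV"
      using * by (intro norm_summable_imp_has_sum summable_sums)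
        (auto simp: norm_power summable_geometric intro: summable_norm_cancel)
    ultimately show "((\<lambda>n. g x ^ n) has_sum inverse (1 - g x)) UNIV" by simp
  qed (use g has_pser_pos has_pser_power in auto)
  then have "an p (\<lambda>x. inverse (1 - g x))" by (auto simp: an_def)
  then have "an p (\<lambda>x. inverse (1 - g x) * inverse (f p))" by (intro an_mult an_const)
  moreover have "inverse (1 - g x) * inverse (f p) = inverse (f x)" for x
  proof (cases "f x = 0")
    case False
    then have "1 - g x = inverse (f p) * f x" by (simp add: g_def)
    then show ?thesis using False assms(2) by (simp add: nonzero_inverse_mult_distrib mult.assoc)
  qed (simp add: g_def)
  ultimately show ?thesis by simp
qed


section \<open>From germs to real analyticity and derivatives\<close>

lemma has_sum_finite_sum:
  fixes f :: "'i \<Rightarrow> 'k \<Rightarrow> 'b::topological_comm_monoid_add"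
  assumes "\<And>i. i \<in> I \<Longrightarrow> (f i has_sum s i) A"
  shows "((\<lambda>k. \<Sum>i\<in>I. f i k) has_sum (\<Sum>i\<in>I. s i)) A"
  using assms by (induction I rule: infinite_finite_induct) (auto intro: has_sum_add)

lemma has_sum_diff_vec:
  fixes f g :: "'k \<Rightarrow> 'b::real_normed_vector"
  assumes "(f has_sum a) A" "(g has_sum b) A"
  shows "((\<lambda>x. f x - g x) has_sum a - b) A"
  using has_sum_add[OF assms(1) has_sum_scaleR[OF assms(2), of "-1"]] by simp

text \<open>In finite dimension unconditional convergence is absolute, by looking at coordinates. It
  lets the bare convergence in \<open>real_analytic_on\<close> supply the norm bound of
  \<open>has_pser\<close>.\<close>

lemma abs_summable_euclidean:
  fixes f :: "'k \<Rightarrow> 'b::euclidean_space"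
  assumes "f summable_on A"
  shows "(\<lambda>k. norm (f k)) summable_on A"
proof -
  have "(\<lambda>k. \<bar>f k \<bullet> b\<bar>) summable_on A" for b
    using summable_on_bounded_linear[OF bounded_linear_inner_left assms, of b]
      summable_on_iff_abs_summable_on_real by (fastforce simp: o_def)
  then have "(\<lambda>k. \<Sum>b\<in>Basis. \<bar>f k \<bullet> b\<bar>) summable_on A"
    by (intro has_sum_imp_summable[OF has_sum_finite_sum[OF has_sum_infsum]]) auto
  then show ?thesis
    by (rule summable_on_comparison_test) (auto intro: norm_le_l1)
qed

lemma box_at_subset_ball:
  fixes p :: "'a::euclidean_space"
  assumes r: "0 < r"
  obtains t where "0 < t" "box_at p t \<subseteq> ball p r"
proof
  show "0 < r / (2 * DIM('a))" using r by simp
  show "box_at p (r / (2 * DIM('a))) \<subseteq> ball p r"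
  proof
    fix x assume x: "x \<in> box_at p (r / (2 * DIM('a)))"
    have "norm (x - p) \<le> (\<Sum>b\<in>Basis. \<bar>(x - p) \<bullet> b\<bar>)" by (rule norm_le_l1)
    also have "\<dots> \<le> (\<Sum>b\<in>(Basis::'a set). r / (2 * DIM('a)))"
      using x by (intro sum_mono) (auto simp: box_at_def)
    also have "\<dots> < r" using r by simp
    finally show "x \<in> ball p r" by (simp add: dist_norm norm_minus_commute)
  qed
qed

lemma an_transform:
  assumes "an p f" "open U" "p \<in> U" "\<And>x. x \<in> U \<Longrightarrow> f x = g x"
  shows "an p g"
proof -
  obtain r M where rM: "has_pser p r M f" using assms(1) unfolding an_def by blast
  obtain d where "0 < d" "ball p d \<subseteq> U" using assms(2,3) openE by blast
  then obtain t where t: "0 < t" "box_at p t \<subseteq> U" using box_at_subset_ball subset_trans by metis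
  have "has_pser p (min r t) (norm (f p) + min r t / r * M) f"
    using rM t has_pser_pos[OF rM] by (intro has_pser_shrink) auto
  then have "has_pser p (min r t) (norm (f p) + min r t / r * M) g"
    by (rule has_pser_cong) (use t(2) box_at_mono[of "min r t" t p] assms(4) in auto)
  then show ?thesis unfolding an_def by blast
qed

lemma real_analytic_onI:
  assumes "\<And>p. p \<in> U \<Longrightarrow> an p f"
  shows "f real_analytic_on U"
  unfolding real_analytic_on_def
proof
  fix p assume "p \<in> U"
  then obtain r M where "has_pser p r M f" using assms unfolding an_def by blast
  then obtain c where r: "0 < r" and
    c: "\<And>x. x \<in> box_at p r \<Longrightarrow> ((\<lambda>\<alpha>. mon (x - p) \<alpha> *\<^sub>R c \<alpha>) has_sum f x) midx"
    unfolding has_pser_def by blast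
  show "\<exists>r>0. \<exists>c. \<forall>x\<in>ball p r.
     ((\<lambda>\<alpha>. (\<Prod>b\<in>Basis. ((x - p) \<bullet> b) ^ \<alpha> b) *\<^sub>R c \<alpha>) has_sum f x) (Basis \<rightarrow>\<^sub>E UNIV)"
    using r c ball_subset_box_at[of p r] unfolding mon_def midx_def by blast
qed

lemma real_analytic_onD:
  fixes f :: "'a::euclidean_space \<Rightarrow> 'b::euclidean_space"
  assumes "f real_analytic_on U" "p \<in> U"
  shows "an p f"
proof -
  obtain r c where r: "0 < r" and
    c: "\<And>x. x \<in> ball p r \<Longrightarrow> ((\<lambda>\<alpha>. mon (x - p) \<alpha> *\<^sub>R c \<alpha>) has_sum f x) midx"
    using assms unfolding real_analytic_on_def mon_def midx_def by blast
  obtain t where t: "0 < t" and sub: "box_at p t \<subseteq> ball p r"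
    using box_at_subset_ball[OF r] by blast
  \<comment> \<open>A corner of the box: every monomial equals \<open>t ^ mdeg \<alpha>\<close>
    there, so summability at this one point controls all coefficients.\<close>
  define x where "x = p + t *\<^sub>R (\<Sum>b\<in>Basis. b)"
  have x: "(x - p) \<bullet> b = t" if "b \<in> Basis" for b
    using that by (simp add: x_def inner_sum_left_Basis)
  have "x \<in> box_at p t" using x t by (simp add: box_at_def)
  then have "(\<lambda>\<alpha>. mon (x - p) \<alpha> *\<^sub>R c \<alpha>) summable_on midx"
    using c sub by (blast intro: has_sum_imp_summable)
  then have "(\<lambda>\<alpha>. norm (mon (x - p) \<alpha> *\<^sub>R c \<alpha>)) summable_on midx"
    by (rule abs_summable_euclidean)
  moreover have "mon (x - p) \<alpha> = t ^ mdeg \<alpha>" for \<alpha>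
    using x by (simp add: mon_def mdeg_def power_sum)
  ultimately have "(\<lambda>\<alpha>. t ^ mdeg \<alpha> * norm (c \<alpha>)) summable_on midx"
    using t by simp
  then show ?thesis
    unfolding an_def has_pser_def using t c sub by (meson has_sum_infsum order_refl subsetD)
qed

lemma mdeg_eq_1:
  assumes "\<alpha> \<in> midx" "mdeg \<alpha> = 1"
  shows "\<exists>b\<in>Basis. \<alpha> = midx1 b"
proof -
  obtain b where b: "b \<in> Basis" "\<alpha> b = 1" "\<And>b'. b' \<in> Basis \<Longrightarrow> b \<noteq> b' \<Longrightarrow> \<alpha> b' = 0"
    using assms(2) unfolding mdeg_def by (subst (asm) sum_eq_1_iff) auto
  then have "\<alpha> = midx1 b"
    using assms(1) by (auto simp: midx1_def midx_def PiE_def extensional_def fun_eq_iff)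
  then show ?thesis using b(1) by blast
qed

text \<open>Beyond the constant and linear parts each term has degree at least 2 and gains the
  factor (|x - p| / r)^2 over its bound at radius r. The remainder is thus quadratic in x -
  p.\<close>

lemma an_has_derivative:
  fixes f :: "'a::euclidean_space \<Rightarrow> 'b::banach"
  assumes "an p f"
  obtains L where "(f has_derivative L) (at p)"
proof -
  obtain r M where rM: "has_pser p r M f" using assms by (auto simp: an_def)
  then obtain c S where c: "((\<lambda>\<alpha>. r ^ mdeg \<alpha> * norm (c \<alpha>)) has_sum S) midx"
      "\<And>x. x \<in> box_at p r \<Longrightarrow> ((\<lambda>\<alpha>. mon (x - p) \<alpha> *\<^sub>R c \<alpha>) has_sum f x) midx" and r: "0 < r"
    unfolding has_pser_def by blast
  have S: "0 \<le> S" using c(1) by (rule has_sum_nonneg) (use r in auto)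
  define L where "L h = (\<Sum>b\<in>Basis. (h \<bullet> b) *\<^sub>R c (midx1 b))" for h :: 'a
  have blL: "bounded_linear L" unfolding L_def
    by (intro bounded_linear_sum bounded_linear_scaleR_const bounded_linear_inner_left)
  have inj1: "inj_on midx1 (Basis :: 'a set)"
    by (auto simp: inj_on_def midx1_def fun_eq_iff split: if_splits)
  have L_sum: "((\<lambda>\<alpha>. if mdeg \<alpha> = 1 then mon h \<alpha> *\<^sub>R c \<alpha> else 0) has_sum L h) midx" for h :: 'a
    by (rule has_sum_finite_neutralI[where B = "midx1 ` Basis"])
      (use mdeg_eq_1 inj1 in \<open>auto simp: L_def sum.reindex\<close>)
  have zero_sum: "((\<lambda>\<alpha>. if \<alpha> = midx0 then c \<alpha> else 0) has_sum c midx0) midx"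
    by (rule has_sum_finite_neutralI[where B = "{midx0}"]) auto
  have rest: "norm (f x - c midx0 - L (x - p)) \<le> S / r\<^sup>2 * (norm (x - p))\<^sup>2" if x: "norm (x - p) \<le> r" for x
  proof -
    define s where "s = norm (x - p)"
    have xs: "x \<in> box_at p s" unfolding box_at_def s_def using Basis_le_norm by blast
    then have xr: "x \<in> box_at p r" using box_at_mono[of s r p] x by (auto simp: s_def)
    define t where "t \<alpha> = mon (x - p) \<alpha> *\<^sub>R c \<alpha> - (if \<alpha> = midx0 then c \<alpha> else 0)
        - (if mdeg \<alpha> = 1 then mon (x - p) \<alpha> *\<^sub>R c \<alpha> else 0)" for \<alpha>
    have t_sum: "(t has_sum f x - c midx0 - L (x - p)) midx"
      unfolding t_def using c(2)[OF xr] zero_sum L_sum by (intro has_sum_diff_vec)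
    have bound_sum: "((\<lambda>\<alpha>. (s / r)\<^sup>2 * (r ^ mdeg \<alpha> * norm (c \<alpha>))) has_sum (s / r)\<^sup>2 * S) midx"
      using c(1) by (rule has_sum_cmult_right)
    have le: "norm (t \<alpha>) \<le> (s / r)\<^sup>2 * (r ^ mdeg \<alpha> * norm (c \<alpha>))" if "\<alpha> \<in> midx" for \<alpha>
    proof (cases "mdeg \<alpha> < 2")
      case True
      then have "mdeg \<alpha> = 0 \<or> mdeg \<alpha> = 1" by auto
      then have "t \<alpha> = 0" using that mdeg_eq_0[OF that] by (auto simp: t_def)
      then show ?thesis using r by simp
    next
      case False
      then obtain k where k: "mdeg \<alpha> = k + 2" by (metis add.commute le_add_diff_inverse linorder_not_less)
      have "norm (t \<alpha>) = \<bar>mon (x - p) \<alpha>\<bar> * norm (c \<alpha>)"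
        using k mdeg_eq_0[OF that] by (auto simp: t_def)
      also have "\<dots> \<le> s ^ mdeg \<alpha> * norm (c \<alpha>)" by (intro mult_right_mono mon_bound xs) auto
      also have "s ^ mdeg \<alpha> \<le> (s / r)\<^sup>2 * r ^ mdeg \<alpha>"
      proof -
        have "s\<^sup>2 * s ^ k \<le> s\<^sup>2 * r ^ k" using x by (intro mult_left_mono power_mono) (auto simp: s_def)
        moreover have "(s / r)\<^sup>2 * r ^ mdeg \<alpha> = s\<^sup>2 * r ^ k"
          using r by (simp add: k power_divide power2_eq_square)
        moreover have "s ^ mdeg \<alpha> = s\<^sup>2 * s ^ k" by (simp add: k power2_eq_square)
        ultimately show ?thesis by simp
      qed
      finally show ?thesis by (simp add: mult.assoc mult_right_mono)
    qed
    have nt: "(\<lambda>\<alpha>. norm (t \<alpha>)) summable_on midx"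
      using has_sum_imp_summable[OF bound_sum] by (rule summable_on_comparison_test) (use le in auto)
    have "norm (f x - c midx0 - L (x - p)) \<le> infsum (\<lambda>\<alpha>. norm (t \<alpha>)) midx"
      by (rule norm_has_sum_bound[OF has_sum_infsum[OF nt] t_sum])
    also have "\<dots> \<le> (s / r)\<^sup>2 * S"
      by (rule has_sum_mono[OF has_sum_infsum[OF nt] bound_sum le])
    finally show ?thesis by (simp add: s_def power_divide mult_ac)
  qed
  have fp: "f p = c midx0"
    using rest[of p] r linear_0[OF bounded_linear.linear[OF blL]] by simp
  have "(f has_derivative L) (at p)"
    unfolding has_derivative_at_alt
  proof (intro conjI blL allI impI)
    fix e :: real assume e: "0 < e"
    define K where "K = S / r\<^sup>2 + 1"
    have K: "0 < K" "S / r\<^sup>2 \<le> K" using S by (simp_all add: K_def add_nonneg_pos)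
    show "\<exists>d>0. \<forall>y. norm (y - p) < d \<longrightarrow> norm (f y - f p - L (y - p)) \<le> e * norm (y - p)"
    proof (intro exI[of _ "min r (e / K)"] conjI allI impI)
      show "0 < min r (e / K)" using r e K by simp
      fix y assume y: "norm (y - p) < min r (e / K)"
      have "norm (f y - f p - L (y - p)) \<le> S / r\<^sup>2 * (norm (y - p))\<^sup>2"
        using rest[of y] y fp by simp
      also have "\<dots> \<le> K * (norm (y - p))\<^sup>2" using K by (intro mult_right_mono) auto
      also have "\<dots> = (K * norm (y - p)) * norm (y - p)" by (simp add: power2_eq_square)
      also have "\<dots> \<le> e * norm (y - p)"
        using y K by (intro mult_right_mono) (auto simp: field_simps)
      finally show "norm (f y - f p - L (y - p)) \<le> e * norm (y - p)" .
    qed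
  qed
  then show ?thesis using that by blast
qed

section \<open>The operator \<open>V\<^sub>q\<close> and slices\<close>

lemma vecq_zero_iff [simp]: "vecq v = 0 \<longleftrightarrow> v = 0"
  by (simp add: vecq_def quat_eq_iff vec_eq_iff forall_3)

lemma vecq_scaleR [simp]: "vecq (r *\<^sub>R v) = r *\<^sub>R vecq v"
  by (simp add: vecq_def quat_eq_iff)

lemma norm_vecq [simp]: "norm (vecq v) = norm v"
  by (simp add: vecq_def norm_quat_def norm_vec_def L2_set_def sum_3)

lemma vecq_square: "vecq v * vecq v = - of_real ((norm v)\<^sup>2)"
proof -
  have "(norm v)\<^sup>2 = (v $ 1)\<^sup>2 + (v $ 2)\<^sup>2 + (v $ 3)\<^sup>2"
    by (simp add: norm_vec_def L2_set_def sum_3)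
  then show ?thesis
    by (simp add: of_real_def quat_eq_iff quat_mult_simps vecq_def power2_eq_square)
qed

lemma vecq_inverse: "inverse (vecq v) = - (inverse ((norm v)\<^sup>2) *\<^sub>R vecq v)"
  by (simp add: inverse_quat_def quat_eq_iff vecq_def norm_vecq[unfolded vecq_def])

lemma partial_deriv_eq:
  assumes "(F has_derivative L) (at x)"
  shows "partial_deriv b F x = L b"
proof -
  have "((\<lambda>t. F (x + t *\<^sub>R b)) has_derivative (\<lambda>t. L (t *\<^sub>R b))) (at 0)"
    by (rule has_derivative_compose[of "\<lambda>t. x + t *\<^sub>R b" "\<lambda>t. t *\<^sub>R b"])
      (use assms in \<open>auto intro!: derivative_eq_intros\<close>)
  then have "((\<lambda>t. F (x + t *\<^sub>R b)) has_vector_derivative L b) (at 0)"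
    using linear_scale[OF has_derivative_linear[OF assms]] by (simp add: has_vector_derivative_def)
  then show ?thesis unfolding partial_deriv_def by (rule vector_derivative_at)
qed

text \<open>By linearity the weighted sum of the spatial partial derivatives is the derivative along
  \<open>v\<close> itself. So \<open>Vq\<close> differentiates only in directions tangent to the
  slice through the point.\<close>

lemma Vq_eq:
  assumes "(F has_derivative L) (at (x0, v))"
  shows "Vq F (x0, v) = L (1, 0) - inverse (vecq v) * L (0, v)"
proof -
  have lin: "linear L" using assms by (rule has_derivative_linear)
  have "(\<Sum>u\<in>UNIV. of_real (v $ u) * L (0, axis u 1)) = (\<Sum>u\<in>UNIV. L (v $ u *\<^sub>R (0, axis u 1)))"
    unfolding linear_scale[OF lin] by (simp only: scaleR_conv_of_real)
  also have "\<dots> = L (\<Sum>u\<in>UNIV. v $ u *\<^sub>R (0, axis u 1))"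
    using linear_sum[OF lin, of "\<lambda>u. v $ u *\<^sub>R (0, axis u 1)" UNIV] by simp
  also have "(\<Sum>u\<in>UNIV. v $ u *\<^sub>R (0 :: real, axis u (1 :: real))) = (0, v)"
    by (simp add: prod_eq_iff fst_sum snd_sum vec_eq_iff axis_def sum_3 forall_3)
  finally show ?thesis
    by (simp add: Vq_def partial_deriv_eq[OF assms])
qed

text \<open>For an imaginary unit \<open>\<omega>\<close> this is the embedding of the complex numbers as the real
  span of \<open>1\<close> and \<open>\<omega>\<close>. The half disc of those \<open>z\<close> with positive real part parametrizes, by
  \<open>z \<mapsto> (- Im z, Re z \<cdot> w)\<close>, the slice of \<open>\<Omega>\<close> in direction \<open>w\<close>, and \<open>V\<^sub>q\<close> becomes a
  Cauchy--Riemann operator there.\<close>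

definition cw :: "quat \<Rightarrow> complex \<Rightarrow> quat" where
  "cw \<omega> z = of_real (Re z) + of_real (Im z) * \<omega>"

lemma bounded_linear_cw: "bounded_linear (cw \<omega>)"
  unfolding cw_def
  by (intro bounded_linear_add bounded_linear_compose[OF bounded_linear_of_real]
      bounded_linear_compose[OF bounded_linear_mult_left] bounded_linear_Re bounded_linear_Im)

lemma cw_mult:
  assumes "\<omega> * \<omega> = -1"
  shows "cw \<omega> (y * z) = cw \<omega> y * cw \<omega> z"
proof -
  have "\<omega> * (\<omega> * q) = - q" for q
    using assms by (simp flip: mult.assoc)
  then show ?thesis
    using assms by (simp add: cw_def of_real_def algebra_simps)
qed

lemma cw_power: "\<omega> * \<omega> = -1 \<Longrightarrow> cw \<omega> (z ^ n) = cw \<omega> z ^ n"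
  by (induction n) (simp_all add: cw_mult, simp add: cw_def)

lemma cw_of_real_mult: "cw \<omega> (of_real t * z) = t *\<^sub>R cw \<omega> z"
  by (simp add: cw_def scaleR_conv_of_real algebra_simps)

definition slice :: "real^3 \<Rightarrow> complex \<Rightarrow> point" where
  "slice w z = (- Im z, Re z *\<^sub>R w)"

lemma slice_has_derivative: "(slice w has_derivative slice w) (at z)"
proof -
  have "bounded_linear (slice w)"
    unfolding slice_def
    by (intro bounded_linear_Pair bounded_linear_minus bounded_linear_Im
        bounded_linear_scaleR_const bounded_linear_Re)
  then show ?thesis by (rule bounded_linear_imp_has_derivative)
qed

lemma slice_surj:
  assumes "v \<noteq> 0"
  obtains w z where "norm w = 1" "0 < Re z" "(norm z)\<^sup>2 = x0\<^sup>2 + (norm v)\<^sup>2" "(x0, v) = slice w z"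
proof
  show "norm (v /\<^sub>R norm v) = 1" using assms by simp
  show "(x0, v) = slice (v /\<^sub>R norm v) (Complex (norm v) (- x0))" using assms by (simp add: slice_def)
  show "(norm (Complex (norm v) (- x0)))\<^sup>2 = x0\<^sup>2 + (norm v)\<^sup>2" by (simp add: cmod_power2)
qed (use assms in simp)

text \<open>The inverse of r w is -w / r, and the derivative along r w carries the factor r. The two
  cancel, leaving an operator with constant coefficients on the slice.\<close>

lemma Vq_slice:
  assumes "(F has_derivative L) (at (slice w z))" "norm w = 1" "0 < Re z"
  shows "Vq F (slice w z) = L (1, 0) + vecq w * L (0, w)"
proof -
  have lin: "linear L" using assms(1) by (rule has_derivative_linear)
  have "L (0, Re z *\<^sub>R w) = Re z *\<^sub>R L (0, w)"
    using linear_scale[OF lin, of "Re z" "(0, w)"] by simp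
  moreover have "Re z * (inverse (Re z) * inverse (Re z) * Re z) = 1"
    using assms(3) by (simp add: field_simps)
  ultimately show ?thesis
    using Vq_eq[OF assms(1)[unfolded slice_def]] assms(2,3)
    by (simp add: vecq_inverse[of "Re z *\<^sub>R w", unfolded vecq_scaleR] slice_def power2_eq_square)
qed

lemma vecq_unit_square: "norm w = 1 \<Longrightarrow> vecq w * vecq w = -1"
  by (simp add: vecq_square)


section \<open>Sums over multi-indices\<close>

definition wpow :: "real^3 \<Rightarrow> nat^3 \<Rightarrow> real" where
  "wpow v \<alpha> = (v $ 1) ^ (\<alpha> $ 1) * (v $ 2) ^ (\<alpha> $ 2) * (v $ 3) ^ (\<alpha> $ 3)"

definition mcoef :: "nat^3 \<Rightarrow> real" where
  "mcoef \<alpha> = fact (mabs \<alpha>) / mfact \<alpha>"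

lemma mabs_3: "mabs \<alpha> = \<alpha> $ 1 + \<alpha> $ 2 + \<alpha> $ 3"
  by (simp add: mabs_def sum_3)

lemma wpow_scaleR: "wpow (t *\<^sub>R v) \<alpha> = t ^ mabs \<alpha> * wpow v \<alpha>"
  by (simp add: wpow_def mabs_3 power_mult_distrib power_add mult_ac)

lemma mfact_3: "mfact \<alpha> = fact (\<alpha> $ 1) * fact (\<alpha> $ 2) * fact (\<alpha> $ 3)"
  unfolding mfact_def UNIV_3 by simp

lemma mfact_pos [simp]: "0 < mfact \<alpha>"
  by (simp add: mfact_def prod_pos)

lemma mcoef_pos [simp]: "0 < mcoef \<alpha>"
  by (simp add: mcoef_def)

lemma finite_mabs [simp]: "finite {\<alpha> :: nat^3. mabs \<alpha> = n}"
proof -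
  let ?f = "\<lambda>\<alpha> :: nat^3. (\<alpha> $ 1, \<alpha> $ 2, \<alpha> $ 3)"
  have "inj_on ?f {\<alpha>. mabs \<alpha> = n}" by (auto simp: inj_on_def vec_eq_iff forall_3)
  moreover have "?f ` {\<alpha>. mabs \<alpha> = n} \<subseteq> {..n} \<times> {..n} \<times> {..n}" by (auto simp: mabs_3)
  then have "finite (?f ` {\<alpha>. mabs \<alpha> = n})" by (rule finite_subset) simp
  ultimately show ?thesis using finite_imageD by blast
qed

lemma mabs_bij: "bij_betw snd (Sigma UNIV (\<lambda>n. {\<alpha> :: nat^3. mabs \<alpha> = n})) UNIV"
  by (auto simp: bij_betw_def inj_on_def image_iff)

lemma has_sum_graded:
  fixes f :: "nat^3 \<Rightarrow> 'a::{topological_comm_monoid_add,t3_space}"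
  assumes "(f has_sum S) UNIV"
  shows "((\<lambda>n. \<Sum>\<alpha> | mabs \<alpha> = n. f \<alpha>) has_sum S) UNIV"
proof (rule has_sum_SigmaD)
  show "((\<lambda>z. f (snd z)) has_sum S) (Sigma UNIV (\<lambda>n. {\<alpha> :: nat^3. mabs \<alpha> = n}))"
    using has_sum_reindex_bij_betw[OF mabs_bij, of f S] assms by simp
  show "((\<lambda>\<alpha>. f (snd (n, \<alpha>))) has_sum (\<Sum>\<alpha> | mabs \<alpha> = n. f \<alpha>)) {\<alpha>. mabs \<alpha> = n}" for n
    by simp
qed

lemma summable_graded:
  fixes f :: "nat^3 \<Rightarrow> real"
  assumes "\<And>\<alpha>. 0 \<le> f \<alpha>" "(\<lambda>n. \<Sum>\<alpha> | mabs \<alpha> = n. f \<alpha>) summable_on UNIV"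
  shows "f summable_on UNIV"
proof -
  have "(\<lambda>z. f (snd z)) summable_on (Sigma UNIV (\<lambda>n. {\<alpha> :: nat^3. mabs \<alpha> = n}))"
    by (rule summable_on_SigmaI[OF _ assms(2)]) (simp_all add: assms(1))
  then show ?thesis
    using summable_on_reindex_bij_betw[OF mabs_bij, of f] by simp
qed

section \<open>Shifts of multi-indices, the multinomial recursion and kernel sums\<close>

definition unit_idx :: "3 \<Rightarrow> nat^3" where
  "unit_idx u = axis u 1"

lemma unit_idx_nth [simp]: "unit_idx u $ i = (if i = u then 1 else 0)"
  by (simp add: unit_idx_def axis_def)

lemma mabs_add_unit [simp]: "mabs (\<alpha> + unit_idx u) = Suc (mabs \<alpha>)"
  using exhaust_3[of u] by (auto simp: mabs_3)

lemma wpow_add_unit [simp]: "wpow v (\<alpha> + unit_idx u) = v $ u * wpow v \<alpha>"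
  using exhaust_3[of u] by (auto simp: wpow_def)

lemma diff_add_unit [simp]: "\<alpha> + unit_idx u - unit_idx u = \<alpha>"
  by (simp add: vec_eq_iff)

lemma add_diff_unit: "0 < \<alpha> $ u \<Longrightarrow> \<alpha> - unit_idx u + unit_idx u = \<alpha>"
  by (simp add: vec_eq_iff)

lemma shift_bij: "bij_betw (\<lambda>\<alpha>. \<alpha> + unit_idx u) UNIV {\<alpha>. 0 < \<alpha> $ u}"
  by (rule bij_betwI[where g = "\<lambda>\<alpha>. \<alpha> - unit_idx u"])
    (auto simp: add_diff_unit)

lemma shift_bij_graded:
  "bij_betw (\<lambda>\<alpha>. \<alpha> + unit_idx u) {\<alpha>. mabs \<alpha> = n} {\<alpha>. mabs \<alpha> = Suc n \<and> 0 < \<alpha> $ u}"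
proof (rule bij_betwI[where g = "\<lambda>\<alpha>. \<alpha> - unit_idx u"])
  show "(\<lambda>\<alpha>. \<alpha> - unit_idx u) \<in> {\<alpha>. mabs \<alpha> = Suc n \<and> 0 < \<alpha> $ u} \<rightarrow> {\<alpha>. mabs \<alpha> = n}"
  proof (intro funcsetI CollectI, elim CollectE conjE)
    fix \<alpha> assume "mabs \<alpha> = Suc n" "0 < \<alpha> $ u"
    then show "mabs (\<alpha> - unit_idx u) = n"
      using mabs_add_unit[of "\<alpha> - unit_idx u" u] by (simp add: add_diff_unit)
  qed
qed (auto simp: add_diff_unit)

text \<open>On coefficients this is multiplication by the variable x_u. The case distinction
  matters: truncated subtraction leaves an index with \<alpha>_u = 0 unchanged.\<close>

definition shift :: "3 \<Rightarrow> (nat^3 \<Rightarrow> 'a::zero) \<Rightarrow> nat^3 \<Rightarrow> 'a" where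
  "shift u f \<alpha> = (if 0 < \<alpha> $ u then f (\<alpha> - unit_idx u) else 0)"

lemma sum_shift:
  fixes g :: "nat^3 \<Rightarrow> 'a::zero \<Rightarrow> 'b::comm_monoid_add"
  assumes "\<And>\<alpha>. g \<alpha> 0 = 0"
  shows "(\<Sum>\<alpha> | mabs \<alpha> = Suc n. g \<alpha> (shift u f \<alpha>)) = (\<Sum>\<alpha> | mabs \<alpha> = n. g (\<alpha> + unit_idx u) (f \<alpha>))"
proof -
  have "(\<Sum>\<alpha> | mabs \<alpha> = Suc n. g \<alpha> (shift u f \<alpha>)) =
      (\<Sum>\<alpha> | mabs \<alpha> = Suc n \<and> 0 < \<alpha> $ u. g \<alpha> (f (\<alpha> - unit_idx u)))"
    by (rule sum.mono_neutral_cong_right) (auto simp: shift_def assms)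
  also have "\<dots> = (\<Sum>\<alpha> | mabs \<alpha> = n. g (\<alpha> + unit_idx u) (f \<alpha>))"
    using sum.reindex_bij_betw[OF shift_bij_graded, of "\<lambda>\<alpha>. g \<alpha> (f (\<alpha> - unit_idx u))" u n] by simp
  finally show ?thesis .
qed

lemma has_sum_shift:
  fixes f :: "nat^3 \<Rightarrow> 'b::real_normed_vector"
  assumes "((\<lambda>\<alpha>. wpow v \<alpha> *\<^sub>R f \<alpha>) has_sum S) UNIV"
  shows "((\<lambda>\<alpha>. wpow v \<alpha> *\<^sub>R shift u f \<alpha>) has_sum v $ u *\<^sub>R S) UNIV"
proof -
  have "((\<lambda>\<alpha>. v $ u *\<^sub>R (wpow v \<alpha> *\<^sub>R f \<alpha>)) has_sum v $ u *\<^sub>R S) UNIV"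
    using assms by (rule has_sum_scaleR)
  then have "((\<lambda>\<alpha>. wpow v (\<alpha> + unit_idx u) *\<^sub>R shift u f (\<alpha> + unit_idx u)) has_sum v $ u *\<^sub>R S) UNIV"
    by (simp add: shift_def)
  then have "((\<lambda>\<alpha>. wpow v \<alpha> *\<^sub>R shift u f \<alpha>) has_sum v $ u *\<^sub>R S) {\<alpha>. 0 < \<alpha> $ u}"
    using has_sum_reindex_bij_betw[OF shift_bij[of u], of "\<lambda>\<alpha>. wpow v \<alpha> *\<^sub>R shift u f \<alpha>"] by simp
  then show ?thesis
    by (rule has_sum_cong_neutral[THEN iffD1, rotated -1]) (auto simp: shift_def)
qed

text \<open>Lowering \<alpha>_u by one multiplies the multinomial coefficient by \<alpha>_u /
  |\<alpha>|, and these fractions add up to 1 over u. Clearing denominators lets the identity cover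
  \<alpha>_u = 0.\<close>

lemma mcoef_shift: "shift u mcoef \<alpha> * real (mabs \<alpha>) = mcoef \<alpha> * real (\<alpha> $ u)"
proof (cases "0 < \<alpha> $ u")
  case True
  define \<beta> where "\<beta> = \<alpha> - unit_idx u"
  have \<alpha>: "\<alpha> = \<beta> + unit_idx u" using add_diff_unit[OF True] by (simp add: \<beta>_def)
  have "mfact \<alpha> = real (\<alpha> $ u) * mfact \<beta>"
    using exhaust_3[of u] by (auto simp: \<alpha> mfact_3)
  moreover have "F / (r * M) * r = F / M" if "r \<noteq> 0" for F r M :: real
    using that by simp
  ultimately have "mcoef \<alpha> * real (\<alpha> $ u) = fact (mabs \<alpha>) / mfact \<beta>"
    using True unfolding mcoef_def by (metis less_numeral_extra(3) of_nat_eq_0_iff)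
  moreover have "fact (mabs \<alpha>) = real (mabs \<alpha>) * fact (mabs \<beta>)" unfolding \<alpha> by simp
  ultimately show ?thesis using True by (simp add: shift_def mcoef_def \<beta>_def)
qed (simp add: shift_def)

lemma mcoef_rec:
  assumes "mabs \<alpha> = Suc n"
  shows "mcoef \<alpha> = (\<Sum>u\<in>UNIV. shift u mcoef \<alpha>)"
proof -
  have "(\<Sum>u\<in>UNIV. shift u mcoef \<alpha>) * real (mabs \<alpha>) = mcoef \<alpha> * real (mabs \<alpha>)"
    unfolding sum_distrib_right mcoef_shift by (simp add: mabs_def sum_distrib_left)
  then show ?thesis using assms by simp
qed

lemma multinomial: "(\<Sum>\<alpha> | mabs \<alpha> = n. wpow t \<alpha> * mcoef \<alpha>) = (\<Sum>u\<in>UNIV. t $ u) ^ n"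
proof (induction n)
  case 0
  have "{\<alpha> :: nat^3. mabs \<alpha> = 0} = {0}" by (auto simp: mabs_3 vec_eq_iff forall_3)
  then show ?case by (simp add: wpow_def mcoef_def mabs_def mfact_def)
next
  case (Suc n)
  have "(\<Sum>\<alpha> | mabs \<alpha> = Suc n. wpow t \<alpha> * mcoef \<alpha>) =
      (\<Sum>\<alpha> | mabs \<alpha> = Suc n. \<Sum>u\<in>UNIV. wpow t \<alpha> * shift u mcoef \<alpha>)"
    by (intro sum.cong) (auto simp: mcoef_rec sum_distrib_left)
  also have "\<dots> = (\<Sum>u\<in>UNIV. \<Sum>\<alpha> | mabs \<alpha> = Suc n. wpow t \<alpha> * shift u mcoef \<alpha>)"
    by (rule sum.swap)
  also have "\<dots> = (\<Sum>u\<in>UNIV. t $ u * (\<Sum>\<alpha> | mabs \<alpha> = n. wpow t \<alpha> * mcoef \<alpha>))"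
    by (simp add: sum_shift[of "\<lambda>\<alpha> x. wpow t \<alpha> * x"] sum_distrib_left mult_ac)
  finally show ?case by (simp add: Suc sum_distrib_right)
qed

lemma multinomial_squares: "(\<Sum>\<alpha> | mabs \<alpha> = n. (wpow m \<alpha>)\<^sup>2 * mcoef \<alpha>) = ((norm m)\<^sup>2) ^ n"
proof -
  have "(norm m)\<^sup>2 = (\<Sum>u\<in>UNIV. (\<chi> u. (m $ u)\<^sup>2) $ u)"
    by (simp add: norm_vec_def L2_set_def sum_nonneg)
  moreover have "(wpow m \<alpha>)\<^sup>2 = wpow (\<chi> u. (m $ u)\<^sup>2) \<alpha>" for \<alpha>
    by (simp add: wpow_def power_mult_distrib flip: power_mult) (simp add: mult.commute)
  ultimately show ?thesis using multinomial[of "\<chi> u. (m $ u)\<^sup>2" n] by simp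
qed

text \<open>By the multinomial theorem the terms of degree n add up to |m|^(2n), a geometric series.
  With m = (|\<mu>_u(x)|) this identifies \<open>Omega_A\<close> with
  \<open>Omega_1\<close>.\<close>

lemma summable_multinomial_squares:
  "(\<lambda>\<alpha>. (wpow m \<alpha>)\<^sup>2 * mcoef \<alpha>) summable_on UNIV \<longleftrightarrow> norm m < 1"
proof
  assume "(\<lambda>\<alpha>. (wpow m \<alpha>)\<^sup>2 * mcoef \<alpha>) summable_on UNIV"
  then obtain S where "((\<lambda>\<alpha>. (wpow m \<alpha>)\<^sup>2 * mcoef \<alpha>) has_sum S) UNIV"
    unfolding summable_on_def by blast
  from has_sum_imp_sums[OF has_sum_graded[OF this]] have "summable (\<lambda>n. ((norm m)\<^sup>2) ^ n)"
    by (simp add: multinomial_squares sums_iff)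
  then show "norm m < 1" by (simp add: summable_geometric_iff abs_square_less_1)
next
  assume "norm m < 1"
  then have "summable (\<lambda>n. norm (((norm m)\<^sup>2) ^ n))"
    by (simp add: summable_geometric_iff abs_square_less_1)
  then have "(\<lambda>n. ((norm m)\<^sup>2) ^ n) summable_on UNIV" by (rule norm_summable_imp_summable_on)
  then show "(\<lambda>\<alpha>. (wpow m \<alpha>)\<^sup>2 * mcoef \<alpha>) summable_on UNIV"
    by (intro summable_graded) (simp_all add: multinomial_squares less_imp_le)
qed

definition arv :: "(nat^3 \<Rightarrow> quat) \<Rightarrow> bool" where
  "arv c \<longleftrightarrow> (\<lambda>\<alpha>. mfact \<alpha> / fact (mabs \<alpha>) * (norm (c \<alpha>))\<^sup>2) summable_on UNIV"

text \<open>The reproducing kernel estimate in termwise form: with w the root of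
  \<open>mcoef \<alpha>\<close>, each term is (|m^\<alpha>| w) (|c_\<alpha>| / w), and 2ab \<le> a^2
  + b^2 bounds it by a kernel term plus a norm term.\<close>

lemma arv_abs_summable:
  assumes "arv c" "norm m < 1"
  shows "(\<lambda>\<alpha>. \<bar>wpow m \<alpha>\<bar> * norm (c \<alpha>)) summable_on UNIV"
proof (rule summable_on_comparison_test)
  show "(\<lambda>\<alpha>. (wpow m \<alpha>)\<^sup>2 * mcoef \<alpha> + mfact \<alpha> / fact (mabs \<alpha>) * (norm (c \<alpha>))\<^sup>2) summable_on UNIV"
    using assms by (intro summable_on_add) (simp_all add: arv_def summable_multinomial_squares)
  fix \<alpha> :: "nat^3"
  define w where "w = sqrt (mcoef \<alpha>)"
  have w: "0 < w" "w\<^sup>2 = mcoef \<alpha>" "mfact \<alpha> / fact (mabs \<alpha>) = 1 / w\<^sup>2"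
    using mcoef_pos[of \<alpha>] by (simp_all add: w_def mcoef_def less_imp_le del: mcoef_pos)
  have "2 * (\<bar>wpow m \<alpha>\<bar> * w * (norm (c \<alpha>) / w)) \<le> (\<bar>wpow m \<alpha>\<bar> * w)\<^sup>2 + (norm (c \<alpha>) / w)\<^sup>2"
    using sum_squares_bound[of "\<bar>wpow m \<alpha>\<bar> * w" "norm (c \<alpha>) / w"] by (simp only: mult.assoc)
  then have "2 * (\<bar>wpow m \<alpha>\<bar> * norm (c \<alpha>)) \<le> (wpow m \<alpha>)\<^sup>2 * mcoef \<alpha> + mfact \<alpha> / fact (mabs \<alpha>) * (norm (c \<alpha>))\<^sup>2"
    using w by (simp add: power_mult_distrib power_divide)
  moreover have "0 \<le> \<bar>wpow m \<alpha>\<bar> * norm (c \<alpha>)" by simp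
  ultimately show "\<bar>wpow m \<alpha>\<bar> * norm (c \<alpha>) \<le> (wpow m \<alpha>)\<^sup>2 * mcoef \<alpha> + mfact \<alpha> / fact (mabs \<alpha>) * (norm (c \<alpha>))\<^sup>2"
    by linarith
qed simp

section \<open>The domain\<close>

lemma norm_cw: "norm w = 1 \<Longrightarrow> norm (cw (vecq w) z) = norm z"
proof -
  assume "norm w = 1"
  then have "(w $ 1)\<^sup>2 + (w $ 2)\<^sup>2 + (w $ 3)\<^sup>2 = 1"
    by (simp add: norm_vec_def L2_set_def sum_3)
  then have "(Re z)\<^sup>2 + (Im z)\<^sup>2 * ((w $ 1)\<^sup>2 + (w $ 2)\<^sup>2 + (w $ 3)\<^sup>2) = (Re z)\<^sup>2 + (Im z)\<^sup>2" by simp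
  then show ?thesis
    by (simp add: cw_def norm_quat_def vecq_def of_real_def quat_mult_simps cmod_def algebra_simps power_mult_distrib)
qed

lemma mu_slice:
  assumes "norm w = 1" "0 < Re z"
  shows "mu u (slice w z) = w $ u *\<^sub>R cw (vecq w) z"
proof -
  have "Re z * (inverse (Re z) * inverse (Re z)) * Re z = 1" using assms(2) by (simp add: field_simps)
  then have *: "Re z *\<^sub>R inverse (vecq (Re z *\<^sub>R w)) = - vecq w"
    using assms by (simp add: vecq_inverse[of "Re z *\<^sub>R w", unfolded vecq_scaleR] power2_eq_square mult_ac)
  have "mu u (slice w z) = w $ u *\<^sub>R (Re z *\<^sub>R (1 - Im z *\<^sub>R inverse (vecq (Re z *\<^sub>R w))))"
    by (simp only: mu_def slice_def divide_quat_def fst_conv snd_conv vector_scaleR_component real_scaleR_def)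
      (simp add: of_real_def mult.commute)
  also have "\<dots> = w $ u *\<^sub>R (Re z *\<^sub>R 1 - Im z *\<^sub>R (Re z *\<^sub>R inverse (vecq (Re z *\<^sub>R w))))"
    by (simp only: scaleR_right_diff_distrib scaleR_left_commute)
  finally show ?thesis unfolding * by (simp add: cw_def of_real_def)
qed

lemma mu_pow_slice:
  assumes "norm w = 1" "0 < Re z"
  shows "mu_pow \<alpha> (slice w z) = wpow w \<alpha> *\<^sub>R cw (vecq w) (z ^ mabs \<alpha>)"
  using assms
  by (simp add: mu_pow_def mu_slice scaleR_power wpow_def mabs_3 power_add cw_power vecq_unit_square cw_mult)

lemma norm_mu_pow: "norm (mu_pow \<alpha> x) = wpow (\<chi> u. norm (mu u x)) \<alpha>"
  by (simp add: mu_pow_def wpow_def norm_mult norm_power)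

lemma sum_norm_mu:
  assumes "snd x \<noteq> 0"
  shows "(\<Sum>u\<in>UNIV. (norm (mu u x))\<^sup>2) = (fst x)\<^sup>2 + (norm (snd x))\<^sup>2"
proof -
  obtain w z where w: "norm w = 1" "0 < Re z" "(norm z)\<^sup>2 = (fst x)\<^sup>2 + (norm (snd x))\<^sup>2" "x = slice w z"
    using slice_surj[of "snd x" "fst x"] assms by auto
  have "(\<Sum>u\<in>UNIV. (norm (mu u x))\<^sup>2) = (\<Sum>u\<in>UNIV. (w $ u)\<^sup>2) * (norm z)\<^sup>2"
    using w by (simp add: mu_slice norm_cw power_mult_distrib sum_distrib_right)
  also have "(\<Sum>u\<in>UNIV. (w $ u)\<^sup>2) = (norm w)\<^sup>2"
    by (simp add: norm_vec_def L2_set_def sum_nonneg)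
  finally show ?thesis using w by simp
qed

lemma norm_mu_vec: "(norm (\<chi> u. norm (mu u x)))\<^sup>2 = (\<Sum>u\<in>UNIV. (norm (mu u x))\<^sup>2)"
  by (simp add: norm_vec_def L2_set_def sum_nonneg)

lemma Omega_A_eq_Omega_1: "Omega_A = Omega_1"
proof -
  have "(\<Sum>u\<in>UNIV. (norm (mu u x))\<^sup>2) < 1 \<longleftrightarrow> norm (\<chi> u. norm (mu u x)) < 1" for x
    unfolding norm_mu_vec[symmetric] by (simp add: abs_square_less_1)
  then show ?thesis
    unfolding Omega_A_def Omega_1_def
    by (simp add: norm_mu_pow summable_multinomial_squares flip: mcoef_def)
qed

lemma Omega_A_iff: "x \<in> Omega_A \<longleftrightarrow> snd x \<noteq> 0 \<and> (fst x)\<^sup>2 + (norm (snd x))\<^sup>2 < 1"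
  by (auto simp: Omega_A_eq_Omega_1 Omega_1_def H_star_def sum_norm_mu)

lemma norm_mu_less_1: "x \<in> Omega_A \<Longrightarrow> norm (\<chi> u. norm (mu u x)) < 1"
proof -
  assume "x \<in> Omega_A"
  then have "(norm (\<chi> u. norm (mu u x)))\<^sup>2 < 1"
    unfolding norm_mu_vec by (simp add: Omega_A_eq_Omega_1 Omega_1_def)
  then show ?thesis by (simp add: abs_square_less_1)
qed

lemma open_Omega_A: "open Omega_A"
proof -
  have "Omega_A = {x. snd x \<noteq> 0} \<inter> {x. (fst x)\<^sup>2 + (norm (snd x))\<^sup>2 < 1}"
    by (auto simp: Omega_A_iff)
  also have "open \<dots>"
  proof (rule open_Int)
    show "open {x :: point. snd x \<noteq> 0}"
      by (intro open_Collect_neq continuous_intros)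
    show "open {x :: point. (fst x)\<^sup>2 + (norm (snd x))\<^sup>2 < 1}"
      by (intro open_Collect_less continuous_intros)
  qed
  finally show ?thesis .
qed

lemma mu_pow_real: "v \<noteq> 0 \<Longrightarrow> mu_pow \<alpha> (0, v) = of_real (wpow v \<alpha>)"
  by (simp add: mu_pow_def mu_def wpow_def)


section \<open>The functions \<open>\<Sum> \<mu>\<^sup>\<alpha> c\<^sub>\<alpha>\<close>\<close>

lemma mu_pow_abs_summable:
  assumes "arv c" "x \<in> Omega_A"
  shows "(\<lambda>\<alpha>. norm (mu_pow \<alpha> x * c \<alpha>)) summable_on UNIV"
  using arv_abs_summable[OF assms(1) norm_mu_less_1[OF assms(2)]]
  by (simp add: norm_mult norm_mu_pow wpow_def abs_mult power_abs)

text \<open>The value 0 outside \<open>Omega_A\<close> matches the normalization in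
  \<open>CK\<close>, so that the two can be equal as total functions.\<close>

definition mu_series :: "(nat^3 \<Rightarrow> quat) \<Rightarrow> point \<Rightarrow> quat" where
  "mu_series c x = (if x \<in> Omega_A then \<Sum>\<^sub>\<infinity>\<alpha>. mu_pow \<alpha> x * c \<alpha> else 0)"

lemma mu_series_has_sum:
  assumes "arv c" "x \<in> Omega_A"
  shows "((\<lambda>\<alpha>. mu_pow \<alpha> x * c \<alpha>) has_sum mu_series c x) UNIV"
  using abs_summable_summable[OF mu_pow_abs_summable[OF assms]] assms(2)
  by (simp add: mu_series_def)

lemma arveson_series_mu_series: "arv c \<Longrightarrow> arveson_series c (mu_series c)"
  unfolding arveson_series_def using mu_series_has_sum by (simp add: arv_def)

lemma an_mu:
  assumes "p \<in> Omega_A"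
  shows "an p (mu u)"
proof -
  have coord: "an p (\<lambda>x. (snd x $ i) *\<^sub>R c)" for i :: 3 and c :: quat
    using an_coord[of "(0, axis i 1) :: point" p c]
    by (auto simp: Basis_prod_def Basis_vec_def inner_prod_def inner_axis)
  have coord0: "an p (\<lambda>x. fst x *\<^sub>R c)" for c :: quat
    using an_coord[of "(1, 0) :: point" p c] by (simp add: Basis_prod_def inner_prod_def)
  have vq: "vecq (snd x) = (snd x $ 1) *\<^sub>R Quat 0 1 0 0 + (snd x $ 2) *\<^sub>R Quat 0 0 1 0
      + (snd x $ 3) *\<^sub>R Quat 0 0 0 1" for x :: point
    by (simp add: quat_eq_iff vecq_def)
  have "an p (\<lambda>x. vecq (snd x))"
    unfolding vq by (intro an_add coord)
  then have "an p (\<lambda>x. inverse (vecq (snd x)))"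
    using assms by (intro an_inverse) (auto simp: Omega_A_iff)
  then have "an p (\<lambda>x. (snd x $ u *\<^sub>R 1) * (1 + (fst x *\<^sub>R 1) * inverse (vecq (snd x))))"
    by (intro an_mult an_add an_const coord coord0)
  then show ?thesis
    by (simp add: mu_def[abs_def] divide_quat_def scaleR_conv_of_real)
qed

text \<open>Near \<open>p\<close> each \<mu>_u has a power series bound \<open>M $ u\<close>
  slightly above |\<mu>_u(p)|. As \<open>M\<close> still lies in the unit ball, the numerical series
  of \<open>wpow M \<alpha> * norm (c \<alpha>)\<close> converges and majorizes the whole
  expansion.\<close>

lemma real_analytic_mu_series:
  assumes "arv c"
  shows "mu_series c real_analytic_on Omega_A"
proof (rule real_analytic_onI)
  fix p assume p: "p \<in> Omega_A"
  define m where "m = (\<chi> u. norm (mu u p))"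
  have m: "norm m < 1" unfolding m_def by (rule norm_mu_less_1[OF p])
  \<comment> \<open>The vector (e, e, e) has norm at most 3 e, so a quarter of the gap keeps
    \<open>M\<close> inside the unit ball.\<close>
  define e where "e = (1 - norm m) / 4"
  have e: "0 < e" using m by (simp add: e_def)
  define M where "M = m + (\<chi> u. e)"
  have "norm (\<chi> u::3. e) \<le> (\<Sum>u\<in>UNIV. \<bar>(\<chi> u::3. e) $ u\<bar>)" by (rule norm_le_l1_cart)
  then have "norm (\<chi> u::3. e) \<le> 3 * e" using e by (simp add: sum_3)
  then have "norm M \<le> norm m + 3 * e" unfolding M_def by norm
  then have M: "norm M < 1" using m by (simp add: e_def field_simps)
  have M_nonneg: "0 \<le> M $ u" for u using e by (simp add: M_def m_def)
  have "\<forall>\<^sub>F r in at_right 0. has_pser p r (M $ u) (mu u)" for u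
    using an_small[OF an_mu[OF p]] e by (simp add: M_def m_def)
  then have "\<forall>\<^sub>F r in at_right 0. \<forall>u. has_pser p r (M $ u) (mu u)"
    by (rule eventually_all_finite)
  then obtain r where r: "0 < r" and mu: "\<And>u. has_pser p r (M $ u) (mu u)"
    using eventually_at_right_ex by blast
  have term_ps: "has_pser p r (wpow M \<alpha> * norm (c \<alpha>)) (\<lambda>x. mu_pow \<alpha> x * c \<alpha>)" for \<alpha>
    unfolding wpow_def mu_pow_def by (intro has_pser_mult has_pser_power mu has_pser_const r)
  have M_sum: "(\<lambda>\<alpha>. wpow M \<alpha> * norm (c \<alpha>)) summable_on UNIV"
    using arv_abs_summable[OF assms M] M_nonneg by (simp add: wpow_def)
  have "has_pser p r (\<Sum>\<^sub>\<infinity>\<alpha>. wpow M \<alpha> * norm (c \<alpha>)) (\<lambda>x. \<Sum>\<^sub>\<infinity>\<alpha>. mu_pow \<alpha> x * c \<alpha>)"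
  proof (rule has_pser_sum[OF r term_ps has_sum_infsum[OF M_sum] has_sum_infsum])
    fix x assume x: "x \<in> box_at p r"
    have "(\<lambda>\<alpha>. norm (mu_pow \<alpha> x * c \<alpha>)) summable_on UNIV"
      using M_sum by (rule summable_on_comparison_test) (use has_pser_norm_le[OF term_ps x] in auto)
    then show "(\<lambda>\<alpha>. mu_pow \<alpha> x * c \<alpha>) summable_on UNIV" by (rule abs_summable_summable)
  qed
  then have "an p (\<lambda>x. \<Sum>\<^sub>\<infinity>\<alpha>. mu_pow \<alpha> x * c \<alpha>)" unfolding an_def by blast
  then show "an p (mu_series c)"
    by (rule an_transform[OF _ open_Omega_A p]) (simp add: mu_series_def)
qed

lemma real_analytic_has_derivative:
  fixes f :: "'a::euclidean_space \<Rightarrow> 'b::euclidean_space"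
  assumes "f real_analytic_on U" "p \<in> U"
  shows "\<exists>L. (f has_derivative L) (at p)"
  using an_has_derivative[OF real_analytic_onD[OF assms]] by blast

lemma slice_in_Omega_A:
  assumes "norm w = 1"
  shows "slice w z \<in> Omega_A \<longleftrightarrow> Re z \<noteq> 0 \<and> norm z < 1"
proof -
  have "w \<noteq> 0" using assms by auto
  moreover have "(Im z)\<^sup>2 + (Re z)\<^sup>2 < 1 \<longleftrightarrow> norm z < 1"
    by (simp add: cmod_def add.commute)
  ultimately show ?thesis using assms by (simp add: Omega_A_iff slice_def)
qed

text \<open>Grouped by degree, the family is an ordinary power series in z converging on the unit
  disc, hence holomorphic there.\<close>

lemma graded_power_series:
  fixes a :: "nat^3 \<Rightarrow> real"
  assumes "\<And>t. 0 < t \<Longrightarrow> t < 1 \<Longrightarrow> (\<lambda>\<alpha>. t ^ mabs \<alpha> * \<bar>a \<alpha>\<bar>) summable_on UNIV"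
    and z: "norm z < 1"
  defines "g \<equiv> \<lambda>z::complex. \<Sum>\<^sub>\<infinity>\<alpha>. of_real (a \<alpha>) * z ^ mabs \<alpha>"
  shows "((\<lambda>\<alpha>. of_real (a \<alpha>) * z ^ mabs \<alpha>) has_sum g z) UNIV" "g field_differentiable at z"
proof -
  have hs: "((\<lambda>\<alpha>. of_real (a \<alpha>) * z ^ mabs \<alpha>) has_sum g z) UNIV" if less_1: "norm z < 1" for z
  proof -
    obtain t where t: "norm z < t" "t < 1" using dense[OF less_1] by blast
    then have "0 < t" using norm_ge_zero[of z] by linarith
    from assms(1)[OF this t(2)] have "(\<lambda>\<alpha>. norm (of_real (a \<alpha>) * z ^ mabs \<alpha>)) summable_on UNIV"
    proof (rule summable_on_comparison_test)
      fix \<alpha> :: "nat^3"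
      have "norm z ^ mabs \<alpha> * \<bar>a \<alpha>\<bar> \<le> t ^ mabs \<alpha> * \<bar>a \<alpha>\<bar>"
        using t by (intro mult_right_mono power_mono) auto
      then show "norm (of_real (a \<alpha>) * z ^ mabs \<alpha>) \<le> t ^ mabs \<alpha> * \<bar>a \<alpha>\<bar>"
        by (simp add: norm_mult norm_power mult.commute)
    qed simp
    then show ?thesis unfolding g_def by (rule has_sum_infsum[OF abs_summable_summable])
  qed
  then show "((\<lambda>\<alpha>. of_real (a \<alpha>) * z ^ mabs \<alpha>) has_sum g z) UNIV" using z .
  have "(\<lambda>n. of_real (\<Sum>\<alpha> | mabs \<alpha> = n. a \<alpha>) * (z - 0) ^ n) sums g z" if "z \<in> ball 0 1" for z
  proof -
    have "(\<Sum>\<alpha> | mabs \<alpha> = n. of_real (a \<alpha>) * z ^ mabs \<alpha>) = of_real (\<Sum>\<alpha> | mabs \<alpha> = n. a \<alpha>) * (z - 0) ^ n" for n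
      by (simp add: sum_distrib_right)
    moreover have "(\<lambda>n. \<Sum>\<alpha> | mabs \<alpha> = n. of_real (a \<alpha>) * z ^ mabs \<alpha>) sums g z"
      using that by (intro has_sum_imp_sums has_sum_graded hs) simp
    ultimately show ?thesis by (simp only:)
  qed
  then have "g holomorphic_on ball 0 1" by (rule power_series_holomorphic)
  then show "g field_differentiable at z"
    using z by (auto simp: holomorphic_on_open field_differentiable_def)
qed

text \<open>On a slice \<mu>^\<alpha> is w^\<alpha> z^|\<alpha>|, with z acting from the left.
  Splitting c_\<alpha> into its four real components on the right leaves four scalar power series in
  z.\<close>

lemma mu_series_slice:
  assumes c: "arv c" and w: "norm w = 1" and z: "0 < Re z" "norm z < 1"
  defines "G \<equiv> \<lambda>e z. \<Sum>\<^sub>\<infinity>\<alpha>. of_real (wpow w \<alpha> * (c \<alpha> \<bullet> e)) * z ^ mabs \<alpha>"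
  shows "mu_series c (slice w z) = (\<Sum>e\<in>Basis. cw (vecq w) (G e z) * e)"
    and "e \<in> Basis \<Longrightarrow> G e field_differentiable at z"
proof -
  have summ: "(\<lambda>\<alpha>. t ^ mabs \<alpha> * \<bar>wpow w \<alpha> * (c \<alpha> \<bullet> e)\<bar>) summable_on UNIV"
    if "0 < t" "t < 1" "e \<in> Basis" for t e
  proof (rule summable_on_comparison_test)
    show "(\<lambda>\<alpha>. \<bar>wpow (t *\<^sub>R w) \<alpha>\<bar> * norm (c \<alpha>)) summable_on UNIV"
      using that w by (intro arv_abs_summable[OF c]) simp
    fix \<alpha> :: "nat^3"
    have "\<bar>c \<alpha> \<bullet> e\<bar> \<le> norm (c \<alpha>)" using that(3) by (rule Basis_le_norm)
    then show "t ^ mabs \<alpha> * \<bar>wpow w \<alpha> * (c \<alpha> \<bullet> e)\<bar> \<le> \<bar>wpow (t *\<^sub>R w) \<alpha>\<bar> * norm (c \<alpha>)"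
      using that by (simp add: wpow_scaleR abs_mult mult_left_mono mult.assoc)
  qed (use that in auto)
  show "G e field_differentiable at z" if "e \<in> Basis"
    unfolding G_def using that by (intro graded_power_series summ z(2))
  have om: "vecq w * vecq w = -1" by (rule vecq_unit_square[OF w])
  have "((\<lambda>\<alpha>. cw (vecq w) (of_real (wpow w \<alpha> * (c \<alpha> \<bullet> e)) * z ^ mabs \<alpha>) * e) has_sum cw (vecq w) (G e z) * e) UNIV"
    if "e \<in> Basis" for e
    unfolding G_def
    using that by (intro has_sum_cmult_left has_sum_bounded_linear[OF bounded_linear_cw, unfolded o_def]
        graded_power_series summ z(2))
  then have 1: "((\<lambda>\<alpha>. \<Sum>e\<in>Basis. cw (vecq w) (of_real (wpow w \<alpha> * (c \<alpha> \<bullet> e)) * z ^ mabs \<alpha>) * e)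
      has_sum (\<Sum>e\<in>Basis. cw (vecq w) (G e z) * e)) UNIV"
    by (rule has_sum_finite_sum)
  have "mu_pow \<alpha> (slice w z) * c \<alpha> =
      (\<Sum>e\<in>Basis. cw (vecq w) (of_real (wpow w \<alpha> * (c \<alpha> \<bullet> e)) * z ^ mabs \<alpha>) * e)" for \<alpha>
  proof -
    have "mu_pow \<alpha> (slice w z) * c \<alpha> =
        (wpow w \<alpha> *\<^sub>R cw (vecq w) (z ^ mabs \<alpha>)) * (\<Sum>e\<in>Basis. (c \<alpha> \<bullet> e) *\<^sub>R e)"
      using w z by (simp add: mu_pow_slice euclidean_representation)
    then show ?thesis by (simp only: cw_of_real_mult sum_distrib_left) (simp add: mult.commute)
  qed
  then have "((\<lambda>\<alpha>. mu_pow \<alpha> (slice w z) * c \<alpha>) has_sum (\<Sum>e\<in>Basis. cw (vecq w) (G e z) * e)) UNIV"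
    using 1 by simp
  moreover have "((\<lambda>\<alpha>. mu_pow \<alpha> (slice w z) * c \<alpha>) has_sum mu_series c (slice w z)) UNIV"
    using z by (intro mu_series_has_sum c) (simp add: slice_in_Omega_A[OF w])
  ultimately show "mu_series c (slice w z) = (\<Sum>e\<in>Basis. cw (vecq w) (G e z) * e)"
    using has_sum_unique by blast
qed

lemma Vq_mu_series:
  assumes c: "arv c" and p: "p \<in> Omega_A"
  shows "Vq (mu_series c) p = 0"
proof -
  obtain w z where w: "norm w = 1" and z: "0 < Re z" and "(norm z)\<^sup>2 = (fst p)\<^sup>2 + (norm (snd p))\<^sup>2"
    and pz: "p = slice w z"
    using slice_surj[of "snd p" "fst p"] p by (auto simp: Omega_A_iff)
  then have z1: "norm z < 1" using p slice_in_Omega_A by blast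
  obtain L where L: "(mu_series c has_derivative L) (at (slice w z))"
    using real_analytic_has_derivative[OF real_analytic_mu_series[OF c] p] pz by blast
  define G where "G e z = (\<Sum>\<^sub>\<infinity>\<alpha>. of_real (wpow w \<alpha> * (c \<alpha> \<bullet> e)) * z ^ mabs \<alpha>)" for e and z :: complex
  have "\<forall>e\<in>Basis. \<exists>D. (G e has_field_derivative D) (at z)"
    using mu_series_slice(2)[OF c w z z1] unfolding G_def field_differentiable_def by blast
  then obtain D where D: "\<And>e. e \<in> Basis \<Longrightarrow> (G e has_field_derivative D e) (at z)" by metis
  have d1: "((\<lambda>z. mu_series c (slice w z)) has_derivative (\<lambda>h. L (slice w h))) (at z)"
    by (rule has_derivative_compose[OF slice_has_derivative L])
  have "((\<lambda>z. \<Sum>e\<in>Basis. cw (vecq w) (G e z) * e) has_derivative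
      (\<lambda>h. \<Sum>e\<in>Basis. cw (vecq w) (D e * h) * e)) (at z)"
    using D by (intro has_derivative_sum has_derivative_mult_left
        bounded_linear.has_derivative[OF bounded_linear_cw]) (auto simp: has_field_derivative_def)
  then have d2: "((\<lambda>z. mu_series c (slice w z)) has_derivative
      (\<lambda>h. \<Sum>e\<in>Basis. cw (vecq w) (D e * h) * e)) (at z)"
  proof (rule has_derivative_transform_within_open)
    show "open ({z. 0 < Re z} \<inter> ball 0 1)" by (intro open_Int open_halfspace_Re_gt open_ball)
    show "z \<in> {z. 0 < Re z} \<inter> ball 0 1" using z z1 by simp
  qed (use mu_series_slice(1)[OF c w] in \<open>simp add: G_def\<close>)
  have eq: "L (slice w h) = (\<Sum>e\<in>Basis. cw (vecq w) (D e * h) * e)" for h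
    using fun_cong[OF has_derivative_unique[OF d1 d2]] .
  have "cw (vecq w) (D e * \<i>) = vecq w * cw (vecq w) (D e)" for e
    using cw_mult[OF vecq_unit_square[OF w], of \<i> "D e"] by (simp add: cw_def mult.commute)
  \<comment> \<open>The complex directions 1 and \<i> correspond to (0, w) and (-1, 0) on the slice.
    That \<i> acts as \<open>vecq w\<close> from the left is the Cauchy-Riemann equation, which
    \<open>Vq_slice\<close> recognizes as vanishing of \<open>Vq\<close>.\<close>
  then have "L (slice w \<i>) = vecq w * L (slice w 1)"
    unfolding eq by (simp add: sum_distrib_left mult.assoc)
  then have "L (- 1, 0) = vecq w * L (0, w)" by (simp add: slice_def)
  moreover have "L (- 1, 0) = - L (1, 0)"
    using linear_neg[OF has_derivative_linear[OF L], of "(1, 0)"] by simp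
  ultimately have "L (1, 0) = - (vecq w * L (0, w))" by (metis minus_minus)
  then show ?thesis unfolding pz Vq_slice[OF L w z] by simp
qed

section \<open>Uniqueness of the Cauchy--Kovalevskaya extension\<close>

lemma Vq_diff:
  assumes "(F has_derivative L) (at p)" "(G has_derivative K) (at p)"
  shows "Vq (\<lambda>x. F x - G x) p = Vq F p - Vq G p"
proof -
  obtain x0 v where p: "p = (x0, v)" by (cases p)
  show ?thesis
    unfolding p Vq_eq[OF assms(1)[unfolded p]] Vq_eq[OF assms(2)[unfolded p]]
      Vq_eq[OF has_derivative_diff[OF assms, unfolded p]]
    by (simp add: right_diff_distrib)
qed

text \<open>The functional \<open>q \<mapsto> \<langle>q, e\<rangle> - \<i> \<langle>\<omega> q, e\<rangle>\<close> turns left multiplication by \<open>\<omega>\<close> into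
  multiplication by \<open>\<i>\<close>, so that it makes solutions holomorphic on slices.\<close>

lemma CK_zero:
  assumes diff: "\<And>p. p \<in> Omega_A \<Longrightarrow> \<exists>L. (F has_derivative L) (at p)"
    and V: "\<And>p. p \<in> Omega_A \<Longrightarrow> Vq F p = 0"
    and init: "\<And>v. (0, v) \<in> Omega_A \<Longrightarrow> F (0, v) = 0"
    and p: "p \<in> Omega_A"
  shows "F p = 0"
proof -
  obtain w z0 where w: "norm w = 1" and z0: "0 < Re z0" and "(norm z0)\<^sup>2 = (fst p)\<^sup>2 + (norm (snd p))\<^sup>2"
    and pz: "p = slice w z0"
    using slice_surj[of "snd p" "fst p"] p by (auto simp: Omega_A_iff)
  then have z1: "norm z0 < 1" using p slice_in_Omega_A by blast
  define S where "S = {z. 0 < Re z} \<inter> ball 0 1"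
  have inO: "slice w z \<in> Omega_A" if "z \<in> S" for z using that slice_in_Omega_A[OF w] by (simp add: S_def)
  have "F (slice w z0) \<bullet> e = 0" for e
  proof -
    define l where "l q = Complex (q \<bullet> e) (- ((vecq w * q) \<bullet> e))" for q
    have l_om: "l (vecq w * q) = \<i> * l q" for q
      using vecq_unit_square[OF w] by (simp add: l_def complex_eq_iff flip: mult.assoc)
    have "bounded_linear (\<lambda>q. complex_of_real (q \<bullet> e) - \<i> * complex_of_real ((vecq w * q) \<bullet> e))"
      by (intro bounded_linear_sub bounded_linear_compose[OF bounded_linear_of_real] bounded_linear_inner_left
          bounded_linear_compose[OF bounded_linear_inner_left bounded_linear_mult_right]
          bounded_linear_compose[OF bounded_linear_mult_right])
    then have bl: "bounded_linear l"
      by (rule back_subst[of bounded_linear]) (auto simp: l_def complex_eq_iff fun_eq_iff)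
    define g where "g z = l (F (slice w z))" for z
    have "g holomorphic_on S"
      unfolding holomorphic_on_def
    proof
      fix z assume z: "z \<in> S"
      obtain L where L: "(F has_derivative L) (at (slice w z))" using diff inO[OF z] by blast
      have lin: "linear L" using L by (rule has_derivative_linear)
      have "Vq F (slice w z) = 0" using V inO[OF z] by blast
      then have L1: "L (1, 0) = - (vecq w * L (0, w))"
        using Vq_slice[OF L w] z by (simp add: S_def add_eq_0_iff2)
      have "l (L (slice w h)) = l (L (0, w)) * h" for h
      proof -
        have "slice w h = (- Im h) *\<^sub>R (1, 0) + Re h *\<^sub>R (0, w)" by (simp add: slice_def)
        then have "L (slice w h) = (- Im h) *\<^sub>R L (1, 0) + Re h *\<^sub>R L (0, w)"
          by (simp only: linear_add[OF lin] linear_scale[OF lin])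
        also have "\<dots> = Im h *\<^sub>R (vecq w * L (0, w)) + Re h *\<^sub>R L (0, w)" by (simp add: L1)
        finally have "l (L (slice w h)) = Im h *\<^sub>R (\<i> * l (L (0, w))) + Re h *\<^sub>R l (L (0, w))"
          using bounded_linear.linear[OF bl] by (simp add: linear_add linear_scale l_om)
        then show ?thesis by (simp add: complex_eq_iff algebra_simps)
      qed
      moreover have "(g has_derivative (\<lambda>h. l (L (slice w h)))) (at z)"
        unfolding g_def
        by (rule bounded_linear.has_derivative[OF bl has_derivative_compose[OF slice_has_derivative L]])
      ultimately have "(g has_field_derivative l (L (0, w))) (at z)"
        by (simp add: has_field_derivative_def)
      then show "g field_differentiable at z within S"
        using field_differentiable_at_within field_differentiable_def by blast
    qed
    then have "g z0 = 0"
    \<comment> \<open>Real z parametrize the part of the slice in x0 = 0, where the initial values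
      vanish; 1/2 is an accumulation point of this segment inside \<open>S\<close>.\<close>
    proof (rule analytic_continuation[where U = "of_real ` {0<..<1}" and \<xi> = "of_real (1/2)"])
      show "open S" unfolding S_def by (intro open_Int open_halfspace_Re_gt open_ball)
      show "connected S" unfolding S_def
        by (intro convex_connected convex_Int convex_halfspace_Re_gt convex_ball)
      show "of_real ` {0<..<1} \<subseteq> S" by (auto simp: S_def)
      show "of_real (1/2) \<in> S" by (simp add: S_def)
      show "of_real (1/2) islimpt (of_real ` {0<..<1} :: complex set)"
        unfolding islimpt_approachable
      proof (intro allI impI)
        fix d :: real assume d: "0 < d"
        define t where "t = 1/2 + min (d/2) (1/4)"
        have "t \<in> {0<..<1}" "t \<noteq> 1/2" "\<bar>t - 1/2\<bar> < d" using d by (auto simp: t_def)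
        moreover from this(2) have "complex_of_real t \<noteq> of_real (1/2)" by (metis of_real_eq_iff)
        moreover have "dist (complex_of_real t) (of_real (1/2)) = \<bar>t - 1/2\<bar>"
          by (simp only: dist_norm norm_of_real flip: of_real_diff)
        ultimately show "\<exists>x'\<in>of_real ` {0<..<1}. x' \<noteq> complex_of_real (1/2) \<and> dist x' (of_real (1/2)) < d"
          by (metis imageI)
      qed
      show "z0 \<in> S" using z0 z1 by (simp add: S_def)
      fix z :: complex assume "z \<in> of_real ` {0<..<1}"
      then obtain t where t: "0 < t" "t < 1" "z = of_real t" by auto
      then have "z \<in> S" by (simp add: S_def)
      from inO[OF this] have "F (slice w z) = 0" using init t by (simp add: slice_def)
      then show "g z = 0" using linear_0[OF bounded_linear.linear[OF bl]] by (simp add: g_def)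
    qed
    then show ?thesis by (simp add: g_def l_def complex_eq_iff)
  qed
  \<comment> \<open>The direction \<open>e\<close> was arbitrary, so it may be the value
    itself.\<close>
  then have "F (slice w z0) \<bullet> F (slice w z0) = 0" .
  then show ?thesis by (simp add: pz)
qed

theorem CK_mu_series:
  assumes c: "arv c"
    and h: "\<And>v. (0, v) \<in> Omega_A \<Longrightarrow> mu_series c (0, v) = h v"
  shows "CK Omega_A h = mu_series c"
  unfolding CK_def
proof (rule the_equality)
  show "mu_series c real_analytic_on Omega_A \<and> (\<forall>x\<in>Omega_A. Vq (mu_series c) x = 0) \<and>
     (\<forall>v. (0, v) \<in> Omega_A \<longrightarrow> mu_series c (0, v) = h v) \<and> (\<forall>x. x \<notin> Omega_A \<longrightarrow> mu_series c x = 0)"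
    using real_analytic_mu_series[OF c] Vq_mu_series[OF c] h by (auto simp: mu_series_def)
  fix F assume F: "F real_analytic_on Omega_A \<and> (\<forall>x\<in>Omega_A. Vq F x = 0) \<and>
     (\<forall>v. (0, v) \<in> Omega_A \<longrightarrow> F (0, v) = h v) \<and> (\<forall>x. x \<notin> Omega_A \<longrightarrow> F x = 0)"
  have dF: "\<exists>L. (F has_derivative L) (at p)" if "p \<in> Omega_A" for p
    using real_analytic_has_derivative F that by blast
  have dG: "\<exists>L. (mu_series c has_derivative L) (at p)" if "p \<in> Omega_A" for p
    using real_analytic_has_derivative real_analytic_mu_series[OF c] that by blast
  have "F p - mu_series c p = 0" if "p \<in> Omega_A" for p
  proof (rule CK_zero[OF _ _ _ that])
    fix q assume q: "q \<in> Omega_A"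
    obtain L K where LK: "(F has_derivative L) (at q)" "(mu_series c has_derivative K) (at q)"
      using dF[OF q] dG[OF q] by blast
    show "\<exists>L. ((\<lambda>p. F p - mu_series c p) has_derivative L) (at q)"
      using has_derivative_diff[OF LK] by blast
    show "Vq (\<lambda>p. F p - mu_series c p) q = 0"
      using Vq_diff[OF LK] F Vq_mu_series[OF c] q by simp
  qed (use F h in simp)
  then show "F = mu_series c" using F by (fastforce simp: mu_series_def fun_eq_iff)
qed


section \<open>Uniqueness of the coefficients\<close>

lemma power_series_coeffs_zero:
  fixes a :: "nat \<Rightarrow> real"
  assumes d: "0 < d" and a: "\<And>t. 0 < t \<Longrightarrow> t < d \<Longrightarrow> ((\<lambda>n. t ^ n * a n) has_sum 0) UNIV"
  shows "a n = 0"
proof (rule ccontr)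
  assume n: "a n \<noteq> 0"
  \<comment> \<open>The series is multiplied by t. Only positive t are known to give 0, but the
    shifted series also vanishes at 0 and has its nonzero coefficient at a positive index, as
    \<open>powser_0_nonzero\<close> demands.\<close>
  define b where "b k = (case k of 0 \<Rightarrow> 0 | Suc j \<Rightarrow> a j)" for k
  define f where "f x = (\<Sum>k. b k * x ^ k)" for x
  have a_sums: "(\<lambda>n. a n * t ^ n) sums 0" if "0 < t" "t < d" for t
    using has_sum_imp_sums[OF a[OF that]] by (simp add: mult.commute)
  have b_sums: "(\<lambda>k. b k * t ^ k) sums 0" if "0 < t" "t < d" for t
  proof -
    have "(\<lambda>k. b (Suc k) * t ^ Suc k) sums 0"
      using sums_mult[OF a_sums[OF that], of t] by (simp add: b_def mult_ac)
    from sums_Suc[OF this] show ?thesis by (simp add: b_def)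
  qed
  have "(\<lambda>k. b k * (x - 0) ^ k) sums f x" if "norm (x - 0) < d / 2" for x
  proof -
    have "summable (\<lambda>k. b k * (d / 2) ^ k)" using b_sums[of "d / 2"] d by (auto simp: sums_iff)
    then have "summable (\<lambda>k. b k * x ^ k)" by (rule powser_inside) (use that in simp)
    then show ?thesis unfolding f_def by (simp add: summable_sums)
  qed
  moreover have "f 0 = 0" unfolding f_def powser_zero by (simp add: b_def)
  moreover have "b (Suc n) \<noteq> 0" using n by (simp add: b_def)
  ultimately obtain s where s: "0 < s" "\<And>z. z \<in> cball 0 s - {0} \<Longrightarrow> f z \<noteq> 0"
    using d by (elim powser_0_nonzero[of "d / 2" 0 b f "Suc n", rotated]) auto
  define t where "t = min s (d / 2)"
  have t: "0 < t" "t < d" "t \<le> s" using s(1) d by (auto simp: t_def)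
  have "f t = 0" unfolding f_def using b_sums[OF t(1,2)] by (simp add: sums_iff)
  then show False using s(2)[of t] t by simp
qed

text \<open>Summing over \<open>k\<close> first leaves a power series in the single variable t, so
  each of its coefficients vanishes. In applications \<open>k\<close> collects the remaining
  indices, and \<open>b\<close> contains the powers of their variables.\<close>

lemma power_series_fiber_zero:
  fixes b :: "nat \<times> 'k \<Rightarrow> real"
  assumes "0 < d" and b: "\<And>t. 0 < t \<Longrightarrow> t < d \<Longrightarrow> ((\<lambda>(i, k). t ^ i * b (i, k)) has_sum 0) (UNIV \<times> UNIV)"
  shows "((\<lambda>k. b (i, k)) has_sum 0) UNIV"
proof -
  have s: "(\<lambda>k. b (i, k)) summable_on UNIV" for i
  proof -
    have "(\<lambda>k. (d / 2) ^ i * b (i, k)) summable_on UNIV"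
      by (rule summable_on_SigmaD1[of "\<lambda>i k. (d / 2) ^ i * b (i, k)" UNIV "\<lambda>_. UNIV"])
        (use has_sum_imp_summable[OF b[of "d / 2"]] assms(1) in auto)
    then show ?thesis using assms(1) by (simp add: summable_on_cmult_right')
  qed
  define B where "B i = (\<Sum>\<^sub>\<infinity>k. b (i, k))" for i
  have "B i = 0"
  proof (rule power_series_coeffs_zero[OF assms(1)])
    fix t :: real assume t: "0 < t" "t < d"
    show "((\<lambda>i. t ^ i * B i) has_sum 0) UNIV"
      unfolding B_def
      by (rule has_sum_SigmaD[OF b[OF t]]) (use s in \<open>auto intro!: has_sum_cmult_right\<close>)
  qed
  then show ?thesis using has_sum_infsum[OF s[of i]] by (simp only: B_def)
qed

definition vec3 :: "'a \<Rightarrow> 'a \<Rightarrow> 'a \<Rightarrow> 'a^3" where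
  "vec3 x y z = (\<chi> u. if u = 1 then x else if u = 2 then y else z)"

lemma vec3_nth [simp]: "vec3 x y z $ 1 = x" "vec3 x y z $ 2 = y" "vec3 x y z $ 3 = z"
  by (simp_all add: vec3_def)

lemma vec3_bij: "bij_betw (\<lambda>(i, j, k). vec3 i j k) (UNIV \<times> UNIV \<times> UNIV) UNIV"
  by (rule bij_betwI[where g = "\<lambda>\<alpha>. (\<alpha> $ 1, \<alpha> $ 2, \<alpha> $ 3)"]) (auto simp: vec_eq_iff forall_3)

text \<open>The variables are removed one at a time. Points with positive coordinates suffice, which
  avoids the origin, where the functions have no prescribed value.\<close>

lemma multi_power_series_coeffs_zero:
  fixes a :: "nat^3 \<Rightarrow> real"
  assumes d: "0 < d"
    and a: "\<And>v. (\<And>u. 0 < v $ u \<and> v $ u < d) \<Longrightarrow> ((\<lambda>\<alpha>. wpow v \<alpha> * a \<alpha>) has_sum 0) UNIV"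
  shows "a \<alpha> = 0"
proof -
  have 1: "((\<lambda>(i, j, k). x ^ i * (y ^ j * (z ^ k * a (vec3 i j k)))) has_sum 0) (UNIV \<times> UNIV \<times> UNIV)"
    if "0 < x" "x < d" "0 < y" "y < d" "0 < z" "z < d" for x y z
  proof -
    have "((\<lambda>\<alpha>. wpow (vec3 x y z) \<alpha> * a \<alpha>) has_sum 0) UNIV"
      using that by (intro a) (simp add: vec3_def)
    then show ?thesis
      using has_sum_reindex_bij_betw[OF vec3_bij, of "\<lambda>\<alpha>. wpow (vec3 x y z) \<alpha> * a \<alpha>"]
      by (simp add: case_prod_unfold wpow_def mult.assoc)
  qed
  have 2: "((\<lambda>(j, k). y ^ j * (z ^ k * a (vec3 i j k))) has_sum 0) (UNIV \<times> UNIV)"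
    if "0 < y" "y < d" "0 < z" "z < d" for i y z
    using power_series_fiber_zero[OF d, of "\<lambda>(i, j, k). y ^ j * (z ^ k * a (vec3 i j k))" i] 1 that
    by (simp add: case_prod_unfold)
  have 3: "((\<lambda>k. z ^ k * a (vec3 i j k)) has_sum 0) UNIV" if "0 < z" "z < d" for i j z
    using power_series_fiber_zero[OF d, of "\<lambda>(j, k). z ^ k * a (vec3 i j k)" j] 2 that
    by (simp add: case_prod_unfold)
  have "a (vec3 i j k) = 0" for i j k
    by (rule power_series_coeffs_zero[OF d 3])
  moreover have "\<alpha> = vec3 (\<alpha> $ 1) (\<alpha> $ 2) (\<alpha> $ 3)" by (simp add: vec_eq_iff forall_3)
  ultimately show ?thesis by metis
qed

lemma real_slice_in_Omega_A: "(0, v) \<in> Omega_A \<longleftrightarrow> v \<noteq> 0 \<and> norm v < 1"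
  by (simp add: Omega_A_iff abs_square_less_1)

lemma arveson_series_real:
  assumes "arveson_series c f" "(0, v) \<in> Omega_A"
  shows "((\<lambda>\<alpha>. wpow v \<alpha> *\<^sub>R c \<alpha>) has_sum f (0, v)) UNIV"
proof -
  have "((\<lambda>\<alpha>. mu_pow \<alpha> (0, v) * c \<alpha>) has_sum f (0, v)) UNIV"
    using assms unfolding arveson_series_def by blast
  then show ?thesis
    using assms(2) by (simp add: real_slice_in_Omega_A mu_pow_real scaleR_conv_of_real)
qed

lemma arveson_series_unique:
  assumes c: "arveson_series c f" and d: "arveson_series d f"
  shows "c = d"
proof
  fix \<alpha>
  have "(c \<alpha> - d \<alpha>) \<bullet> e = 0" for e
  \<comment> \<open>Three coordinates below 1/2 give a squared norm below 3/4, hence a point of the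
    domain.\<close>
  proof (rule multi_power_series_coeffs_zero[of "1/2" "\<lambda>\<alpha>. (c \<alpha> - d \<alpha>) \<bullet> e"])
    fix v :: "real^3" assume v: "\<And>u. 0 < v $ u \<and> v $ u < 1/2"
    have "(v $ u)\<^sup>2 < 1/4" for u
      using v[of u] power_strict_mono[of "v $ u" "1/2" 2] by (simp add: power2_eq_square)
    from this[of 1] this[of 2] this[of 3] have "(norm v)\<^sup>2 < 1"
      by (simp add: norm_vec_def L2_set_def sum_3)
    then have "(0, v) \<in> Omega_A"
      using v[of 1] by (auto simp: real_slice_in_Omega_A abs_square_less_1)
    then have "((\<lambda>\<alpha>. wpow v \<alpha> *\<^sub>R c \<alpha> - wpow v \<alpha> *\<^sub>R d \<alpha>) has_sum f (0, v) - f (0, v)) UNIV"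
      by (intro has_sum_diff_vec arveson_series_real c d)
    from has_sum_bounded_linear[OF bounded_linear_inner_left this, of e]
    show "((\<lambda>\<alpha>. wpow v \<alpha> * ((c \<alpha> - d \<alpha>) \<bullet> e)) has_sum 0) UNIV"
      by (simp add: o_def flip: scaleR_right_diff_distrib)
  qed simp
  then have "(c \<alpha> - d \<alpha>) \<bullet> (c \<alpha> - d \<alpha>) = 0" .
  then show "c \<alpha> = d \<alpha>" by simp
qed

definition arv_sq :: "(nat^3 \<Rightarrow> quat) \<Rightarrow> real" where
  "arv_sq c = (\<Sum>\<^sub>\<infinity>\<alpha>. mfact \<alpha> / fact (mabs \<alpha>) * (norm (c \<alpha>))\<^sup>2)"

lemma arveson_norm_eq:
  assumes "arveson_series c f"
  shows "arveson_norm f = sqrt (arv_sq c)"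
proof -
  have "arveson_coeff f = c"
    unfolding arveson_coeff_def using assms arveson_series_unique by (blast intro: the_equality)
  then show ?thesis by (simp add: arveson_norm_def arv_sq_def)
qed

lemma arv_sq_nonneg: "0 \<le> arv_sq c"
  unfolding arv_sq_def by (rule infsum_nonneg) (simp add: less_imp_le)

section \<open>Closure properties of the coefficient space\<close>

lemma arv_le:
  assumes "arv c" "\<And>\<alpha>. norm (d \<alpha>) \<le> K * norm (c \<alpha>)"
  shows "arv d"
proof -
  have "(\<lambda>\<alpha>. K\<^sup>2 * (mfact \<alpha> / fact (mabs \<alpha>) * (norm (c \<alpha>))\<^sup>2)) summable_on UNIV"
    using assms(1) unfolding arv_def by (rule summable_on_cmult_right)
  then show ?thesis unfolding arv_def
  proof (rule summable_on_comparison_test)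
    fix \<alpha> :: "nat^3"
    have "(norm (d \<alpha>))\<^sup>2 \<le> (K * norm (c \<alpha>))\<^sup>2" by (intro power_mono assms(2)) simp
    then show "mfact \<alpha> / fact (mabs \<alpha>) * (norm (d \<alpha>))\<^sup>2 \<le> K\<^sup>2 * (mfact \<alpha> / fact (mabs \<alpha>) * (norm (c \<alpha>))\<^sup>2)"
      using mult_left_mono[of "(norm (d \<alpha>))\<^sup>2" "(K * norm (c \<alpha>))\<^sup>2" "mfact \<alpha> / fact (mabs \<alpha>)"]
      by (simp add: power_mult_distrib less_imp_le mult_ac)
  qed (simp add: less_imp_le)
qed

lemma arv_scaleR: "arv c \<Longrightarrow> arv (\<lambda>\<alpha>. t *\<^sub>R c \<alpha>)"
  by (erule arv_le[where K = "\<bar>t\<bar>"]) simp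

lemma arv_mult: "arv c \<Longrightarrow> arv (\<lambda>\<alpha>. q * c \<alpha>)"
  by (erule arv_le[where K = "norm q"]) (simp add: norm_mult)

lemma arv_add:
  assumes "arv c" "arv d"
  shows "arv (\<lambda>\<alpha>. c \<alpha> + d \<alpha>)"
proof -
  have "(\<lambda>\<alpha>. 2 * (mfact \<alpha> / fact (mabs \<alpha>) * (norm (c \<alpha>))\<^sup>2) + 2 * (mfact \<alpha> / fact (mabs \<alpha>) * (norm (d \<alpha>))\<^sup>2))
      summable_on UNIV"
    using assms unfolding arv_def by (intro summable_on_add summable_on_cmult_right)
  then show ?thesis unfolding arv_def
  proof (rule summable_on_comparison_test)
    fix \<alpha> :: "nat^3"
    have "(norm (c \<alpha> + d \<alpha>))\<^sup>2 \<le> (norm (c \<alpha>) + norm (d \<alpha>))\<^sup>2"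
      by (intro power_mono norm_triangle_ineq) simp
    also have "\<dots> \<le> 2 * (norm (c \<alpha>))\<^sup>2 + 2 * (norm (d \<alpha>))\<^sup>2"
      using sum_squares_bound[of "norm (c \<alpha>)" "norm (d \<alpha>)"] by (simp add: power2_sum)
    finally have "mfact \<alpha> / fact (mabs \<alpha>) * (norm (c \<alpha> + d \<alpha>))\<^sup>2
        \<le> mfact \<alpha> / fact (mabs \<alpha>) * (2 * (norm (c \<alpha>))\<^sup>2 + 2 * (norm (d \<alpha>))\<^sup>2)"
      by (rule mult_left_mono) (simp add: less_imp_le)
    then show "mfact \<alpha> / fact (mabs \<alpha>) * (norm (c \<alpha> + d \<alpha>))\<^sup>2 \<le>
        2 * (mfact \<alpha> / fact (mabs \<alpha>) * (norm (c \<alpha>))\<^sup>2) + 2 * (mfact \<alpha> / fact (mabs \<alpha>) * (norm (d \<alpha>))\<^sup>2)"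
      by (simp only: distrib_left mult_ac)
  qed (simp add: less_imp_le)
qed

definition const_coeff :: "quat \<Rightarrow> nat^3 \<Rightarrow> quat" where
  "const_coeff q \<alpha> = (if \<alpha> = 0 then q else 0)"

lemma arv_const_coeff: "arv (const_coeff q)"
  unfolding arv_def
  by (rule has_sum_imp_summable[OF has_sum_finite_neutralI[where B = "{0}"]])
    (auto simp: const_coeff_def)

lemma arv_sum: "(\<And>i. i \<in> I \<Longrightarrow> arv (c i)) \<Longrightarrow> arv (\<lambda>\<alpha>. \<Sum>i\<in>I. c i \<alpha>)"
proof (induction I rule: infinite_finite_induct)
  case (insert x I)
  then show ?case using arv_add[of "c x" "\<lambda>\<alpha>. \<Sum>i\<in>I. c i \<alpha>"] by simp
qed (simp_all add: arv_def)

text \<open>The value at x0 = 0, where \<mu>^\<alpha> is a real monomial and \<open>\<star>\<close>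
  is the pointwise product; constants can be moved through the series termwise.\<close>

definition pval :: "real^3 \<Rightarrow> (nat^3 \<Rightarrow> quat) \<Rightarrow> quat" where
  "pval v c = mu_series c (0, v)"

lemma pval_has_sum:
  assumes "arv c" "(0, v) \<in> Omega_A"
  shows "((\<lambda>\<alpha>. wpow v \<alpha> *\<^sub>R c \<alpha>) has_sum pval v c) UNIV"
  unfolding pval_def by (rule arveson_series_real[OF arveson_series_mu_series[OF assms(1)] assms(2)])

lemma pval_unique:
  assumes "arv c" "(0, v) \<in> Omega_A" "((\<lambda>\<alpha>. wpow v \<alpha> *\<^sub>R c \<alpha>) has_sum S) UNIV"
  shows "pval v c = S"
  using pval_has_sum[OF assms(1,2)] assms(3) has_sum_unique by blast

lemma pval_add:
  assumes "arv c" "arv d" "(0, v) \<in> Omega_A"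
  shows "pval v (\<lambda>\<alpha>. c \<alpha> + d \<alpha>) = pval v c + pval v d"
  using has_sum_add[OF pval_has_sum[OF assms(1,3)] pval_has_sum[OF assms(2,3)]]
  by (intro pval_unique arv_add assms) (simp add: scaleR_add_right)

lemma pval_scaleR:
  assumes "arv c" "(0, v) \<in> Omega_A"
  shows "pval v (\<lambda>\<alpha>. t *\<^sub>R c \<alpha>) = t *\<^sub>R pval v c"
  using has_sum_scaleR[OF pval_has_sum[OF assms], of t]
  by (intro pval_unique arv_scaleR assms) (simp add: mult.commute)

lemma pval_mult:
  assumes "arv c" "(0, v) \<in> Omega_A"
  shows "pval v (\<lambda>\<alpha>. q * c \<alpha>) = q * pval v c"
  using has_sum_cmult_right[OF pval_has_sum[OF assms], of q]
  by (intro pval_unique arv_mult assms) simp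

lemma pval_sum:
  assumes "\<And>i. i \<in> I \<Longrightarrow> arv (c i)" "(0, v) \<in> Omega_A"
  shows "pval v (\<lambda>\<alpha>. \<Sum>i\<in>I. c i \<alpha>) = (\<Sum>i\<in>I. pval v (c i))"
  using has_sum_finite_sum[of I "\<lambda>i \<alpha>. wpow v \<alpha> *\<^sub>R c i \<alpha>", OF pval_has_sum[OF assms]]
  by (intro pval_unique arv_sum assms) (simp_all add: scaleR_sum_right)

lemma pval_const_coeff:
  assumes "(0, v) \<in> Omega_A"
  shows "pval v (const_coeff q) = q"
  by (intro pval_unique arv_const_coeff assms has_sum_finite_neutralI[where B = "{0}"])
    (auto simp: const_coeff_def wpow_def)

lemma CK_pval:
  assumes "arv c" "\<And>v. (0, v) \<in> Omega_A \<Longrightarrow> pval v c = h v"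
  shows "CK Omega_A h = mu_series c"
  by (rule CK_mu_series) (use assms in \<open>simp_all add: pval_def\<close>)

section \<open>The colligation\<close>

lemma norm_add_square: "(norm (p + q :: quat))\<^sup>2 = (norm p)\<^sup>2 + 2 * (p \<bullet> q) + (norm q)\<^sup>2"
  by (simp add: power2_norm_eq_inner inner_add inner_commute)

lemma inner_qcnj_mult: "p \<bullet> (qcnj m * q) = (m * p) \<bullet> q"
  by (simp add: inner_quat_def quat_mult_simps algebra_simps)

lemma norm_qcnj [simp]: "norm (qcnj q) = norm q"
  by (simp add: norm_quat_def)

text \<open>Unitarity of the colligation \<open>[[-m, C], [D, m\<^sup>*]]\<close> with \<open>C = (1 - m m\<^sup>*)\<^sup>1\<^sup>/\<^sup>2\<close> and
  \<open>D = (1 - m\<^sup>* m)\<^sup>1\<^sup>/\<^sup>2 = 1 - \<kappa> m\<^sup>* m\<close>, where \<open>\<kappa> = 1 / (1 + C)\<close>.\<close>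

lemma colligation_isometry:
  fixes m f :: "3 \<Rightarrow> quat" and y :: quat
  defines "s \<equiv> \<Sum>u\<in>UNIV. (norm (m u))\<^sup>2"
  defines "C \<equiv> sqrt (1 - s)"
  defines "\<kappa> \<equiv> 1 / (1 + C)"
  defines "t \<equiv> \<Sum>u\<in>UNIV. m u * f u"
  assumes s: "s < 1"
  shows "(norm (C *\<^sub>R y - t))\<^sup>2 + (\<Sum>u\<in>UNIV. (norm (f u + qcnj (m u) * (y - \<kappa> *\<^sub>R t)))\<^sup>2) =
    (\<Sum>u\<in>UNIV. (norm (f u))\<^sup>2) + (norm y)\<^sup>2"
proof -
  have C: "0 < C" "C\<^sup>2 = 1 - s" using s by (simp_all add: C_def)
  have \<kappa>: "\<kappa> * (1 + C) = 1" using C by (simp add: \<kappa>_def)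
  \<comment> \<open>From s = 1 - C^2 = (1 - C)(1 + C). Thus \<kappa> is (1 - C) / s in a form that
    also makes sense for s = 0.\<close>
  have s\<kappa>: "s * \<kappa> = 1 - C"
  proof -
    have "s * \<kappa> = (1 - C\<^sup>2) * \<kappa>" using C(2) by simp
    also have "\<dots> = (1 - C) * (\<kappa> * (1 + C))" by (simp add: algebra_simps power2_eq_square)
    finally have "s * \<kappa> = (1 - C) * (\<kappa> * (1 + C))" .
    then show ?thesis using \<kappa> by simp
  qed
  define z where "z = y - \<kappa> *\<^sub>R t"
  have "(\<Sum>u\<in>UNIV. (norm (f u + qcnj (m u) * z))\<^sup>2) =
      (\<Sum>u\<in>UNIV. (norm (f u))\<^sup>2 + 2 * ((m u * f u) \<bullet> z) + (norm (m u))\<^sup>2 * (norm z)\<^sup>2)"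
    by (simp add: norm_add_square inner_qcnj_mult norm_mult power_mult_distrib)
  also have "\<dots> = (\<Sum>u\<in>UNIV. (norm (f u))\<^sup>2) + 2 * (t \<bullet> z) + s * (norm z)\<^sup>2"
    by (simp add: sum.distrib s_def t_def sum_distrib_left sum_distrib_right inner_sum_left)
  finally have 1: "(\<Sum>u\<in>UNIV. (norm (f u + qcnj (m u) * z))\<^sup>2) =
      (\<Sum>u\<in>UNIV. (norm (f u))\<^sup>2) + 2 * (t \<bullet> z) + s * (norm z)\<^sup>2" .
  have 2: "t \<bullet> z = t \<bullet> y - \<kappa> * (t \<bullet> t)" by (simp add: z_def inner_diff_right)
  have 3: "(norm z)\<^sup>2 = y \<bullet> y - 2 * \<kappa> * (t \<bullet> y) + \<kappa>\<^sup>2 * (t \<bullet> t)"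
    unfolding z_def power2_norm_eq_inner
    by (simp add: inner_diff_left inner_diff_right inner_commute[of y t] algebra_simps power2_eq_square)
  have 4: "(norm (C *\<^sub>R y - t))\<^sup>2 = (1 - s) * (y \<bullet> y) - 2 * C * (t \<bullet> y) + t \<bullet> t"
    unfolding C(2)[symmetric] power2_norm_eq_inner
    by (simp add: inner_diff_left inner_diff_right inner_commute[of y t] algebra_simps power2_eq_square)
  \<comment> \<open>Collected by inner products of \<open>y\<close> and \<open>t\<close>: the
    coefficient of \<open>t \<bullet> y\<close> vanishes by s \<kappa> = 1 - C, that of
    \<open>t \<bullet> t\<close> by \<kappa> (1 + C) = 1.\<close>
  have "2 * (t \<bullet> z) + s * (norm z)\<^sup>2 + (norm (C *\<^sub>R y - t))\<^sup>2 =
      y \<bullet> y + (2 - 2 * (s * \<kappa>) - 2 * C) * (t \<bullet> y) + (1 - 2 * \<kappa> + (s * \<kappa>) * \<kappa>) * (t \<bullet> t)"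
    unfolding 2 3 4 by (simp add: algebra_simps power2_eq_square)
  also have "1 - 2 * \<kappa> + (s * \<kappa>) * \<kappa> = 1 - \<kappa> * (1 + C)" unfolding s\<kappa> by (simp add: algebra_simps)
  finally have "2 * (t \<bullet> z) + s * (norm z)\<^sup>2 + (norm (C *\<^sub>R y - t))\<^sup>2 = (norm y)\<^sup>2"
    by (simp add: s\<kappa> \<kappa> power2_norm_eq_inner)
  with 1 show ?thesis by (simp add: z_def)
qed

text \<open>A shift strictly raises the degree, so the coefficients of degree n are determined by
  those of lower degree. This closes the feedback loop formally, before any convergence is
  known.\<close>

lemma shift_fixpoint:
  fixes G :: "3 \<Rightarrow> nat^3 \<Rightarrow> 'a \<Rightarrow> 'a::comm_monoid_add"
  shows "\<exists>y. \<forall>\<alpha>. y \<alpha> = (\<Sum>u\<in>UNIV. shift u (\<lambda>\<beta>. G u \<beta> (y \<beta>)) \<alpha>)"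
proof -
  \<comment> \<open>Stage n of the iteration is read only at indices of degree n.\<close>
  define Y where "Y = rec_nat (\<lambda>\<alpha>. 0) (\<lambda>_ y \<alpha>. \<Sum>u\<in>UNIV. shift u (\<lambda>\<beta>. G u \<beta> (y \<beta>)) \<alpha>)"
  have "Y (mabs \<alpha>) \<alpha> = (\<Sum>u\<in>UNIV. shift u (\<lambda>\<beta>. G u \<beta> (Y (mabs \<beta>) \<beta>)) \<alpha>)" for \<alpha>
  proof (cases "mabs \<alpha>")
    case 0
    then have "\<alpha> $ u = 0" for u using exhaust_3[of u] by (auto simp: mabs_3)
    then show ?thesis by (simp add: 0 Y_def shift_def)
  next
    case (Suc n)
    have "mabs (\<alpha> - unit_idx u) = n" if "0 < \<alpha> $ u" for u
      using mabs_add_unit[of "\<alpha> - unit_idx u" u] add_diff_unit[OF that] Suc by simp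
    then show ?thesis unfolding Suc by (simp add: Y_def shift_def cong: if_cong)
  qed
  then show ?thesis by (intro exI[of _ "\<lambda>\<alpha>. Y (mabs \<alpha>) \<alpha>"]) blast
qed

text \<open>Cauchy--Schwarz with the weights of the recursion \<open>mcoef_rec\<close>.\<close>

lemma row_shift_contractive:
  fixes w :: "3 \<Rightarrow> nat^3 \<Rightarrow> quat"
  shows "(\<Sum>\<alpha> | mabs \<alpha> = Suc n. (norm (\<Sum>u\<in>UNIV. shift u (w u) \<alpha>))\<^sup>2 / mcoef \<alpha>) \<le>
    (\<Sum>\<alpha> | mabs \<alpha> = n. (\<Sum>u\<in>UNIV. (norm (w u \<alpha>))\<^sup>2) / mcoef \<alpha>)"
proof -
  have "(norm (\<Sum>u\<in>UNIV. shift u (w u) \<alpha>))\<^sup>2 / mcoef \<alpha> \<le>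
      (\<Sum>u\<in>UNIV. shift u (\<lambda>\<beta>. (norm (w u \<beta>))\<^sup>2 / mcoef \<beta>) \<alpha>)" if "mabs \<alpha> = Suc n" for \<alpha>
  proof -
    define a b where "a u = sqrt (shift u mcoef \<alpha>)"
      and "b u = shift u (\<lambda>\<beta>. norm (w u \<beta>) / sqrt (mcoef \<beta>)) \<alpha>" for u
    have ab: "a u * b u = norm (shift u (w u) \<alpha>)" for u
      using less_imp_neq[OF mcoef_pos[of "\<alpha> - unit_idx u"]] by (simp add: a_def b_def shift_def)
    have aa: "(a u)\<^sup>2 = shift u mcoef \<alpha>" for u
      using mcoef_pos[of "\<alpha> - unit_idx u"] by (simp add: a_def shift_def less_imp_le)
    have bb: "(b u)\<^sup>2 = shift u (\<lambda>\<beta>. (norm (w u \<beta>))\<^sup>2 / mcoef \<beta>) \<alpha>" for u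
      using mcoef_pos[of "\<alpha> - unit_idx u"] by (simp add: b_def shift_def power_divide less_imp_le)
    have "(norm (\<Sum>u\<in>UNIV. shift u (w u) \<alpha>))\<^sup>2 \<le> (\<Sum>u\<in>UNIV. a u * b u)\<^sup>2"
      unfolding ab by (intro power_mono norm_sum) simp
    also have "\<dots> \<le> (\<Sum>u\<in>UNIV. (a u)\<^sup>2) * (\<Sum>u\<in>UNIV. (b u)\<^sup>2)"
      by (rule Cauchy_Schwarz_ineq_sum)
    also have "(\<Sum>u\<in>UNIV. (a u)\<^sup>2) = mcoef \<alpha>" unfolding aa mcoef_rec[OF that] ..
    finally show ?thesis
      unfolding bb using mcoef_pos[of \<alpha>] by (simp add: pos_divide_le_eq mult.commute)
  qed
  then have "(\<Sum>\<alpha> | mabs \<alpha> = Suc n. (norm (\<Sum>u\<in>UNIV. shift u (w u) \<alpha>))\<^sup>2 / mcoef \<alpha>) \<le>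
      (\<Sum>\<alpha> | mabs \<alpha> = Suc n. \<Sum>u\<in>UNIV. shift u (\<lambda>\<beta>. (norm (w u \<beta>))\<^sup>2 / mcoef \<beta>) \<alpha>)"
    by (intro sum_mono) simp
  also have "\<dots> = (\<Sum>u\<in>UNIV. \<Sum>\<alpha> | mabs \<alpha> = Suc n. shift u (\<lambda>\<beta>. (norm (w u \<beta>))\<^sup>2 / mcoef \<beta>) \<alpha>)"
    by (rule sum.swap)
  also have "\<dots> = (\<Sum>u\<in>UNIV. \<Sum>\<alpha> | mabs \<alpha> = n. (norm (w u \<alpha>))\<^sup>2 / mcoef \<alpha>)"
    by (simp add: sum_shift[of "\<lambda>\<alpha> x. x"])
  also have "\<dots> = (\<Sum>\<alpha> | mabs \<alpha> = n. (\<Sum>u\<in>UNIV. (norm (w u \<alpha>))\<^sup>2) / mcoef \<alpha>)"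
    by (subst sum.swap) (simp add: sum_divide_distrib)
  finally show ?thesis .
qed

lemma arv_sq_graded:
  assumes "arv c"
  shows "(\<lambda>n. \<Sum>\<alpha> | mabs \<alpha> = n. (norm (c \<alpha>))\<^sup>2 / mcoef \<alpha>) sums arv_sq c"
proof -
  have "((\<lambda>\<alpha>. mfact \<alpha> / fact (mabs \<alpha>) * (norm (c \<alpha>))\<^sup>2) has_sum arv_sq c) UNIV"
    using assms unfolding arv_def arv_sq_def by (rule has_sum_infsum)
  from has_sum_imp_sums[OF has_sum_graded[OF this]] show ?thesis
    by (simp add: mcoef_def mult.commute)
qed

lemma arvI_graded:
  assumes "\<And>N. (\<Sum>n<N. \<Sum>\<alpha> | mabs \<alpha> = n. (norm (c \<alpha>))\<^sup>2 / mcoef \<alpha>) \<le> K"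
  shows "arv c" "arv_sq c \<le> K"
proof -
  let ?b = "\<lambda>n. \<Sum>\<alpha> | mabs \<alpha> = n. (norm (c \<alpha>))\<^sup>2 / mcoef \<alpha>"
  have nonneg: "0 \<le> ?b n" for n by (intro sum_nonneg) (simp add: less_imp_le)
  have s: "summable ?b" using nonneg assms by (rule summableI_nonneg_bounded)
  then have "summable (\<lambda>n. norm (?b n))" using nonneg by simp
  then have "?b summable_on UNIV" by (rule norm_summable_imp_summable_on)
  then have "(\<lambda>\<alpha>. (norm (c \<alpha>))\<^sup>2 / mcoef \<alpha>) summable_on UNIV"
    by (intro summable_graded) (simp add: less_imp_le)
  then show "arv c" by (simp add: arv_def mcoef_def mult.commute)
  from arv_sq_graded[OF this] have "arv_sq c = suminf ?b" by (simp add: sums_iff)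
  also have "\<dots> \<le> K" using s assms by (rule suminf_le_const)
  finally show "arv_sq c \<le> K" .
qed

text \<open>The internal signal \<open>y\<close> is returned along with the output \<open>b\<close>,
  because the resolvent is later read off from it.\<close>

lemma colligation:
  fixes m :: "3 \<Rightarrow> quat" and f :: "3 \<Rightarrow> nat^3 \<Rightarrow> quat"
  defines "s \<equiv> \<Sum>u\<in>UNIV. (norm (m u))\<^sup>2"
  defines "C \<equiv> sqrt (1 - s)"
  defines "\<kappa> \<equiv> 1 / (1 + C)"
  assumes s: "s < 1" and f: "\<And>u. arv (f u)"
  obtains b y where "arv b" "arv y" "arv_sq b \<le> (\<Sum>u\<in>UNIV. arv_sq (f u))"
    "\<And>v. (0, v) \<in> Omega_A \<Longrightarrow> pval v b = C *\<^sub>R pval v y - (\<Sum>u\<in>UNIV. m u * pval v (f u))"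
    "\<And>v. (0, v) \<in> Omega_A \<Longrightarrow> pval v y = (\<Sum>u\<in>UNIV. v $ u *\<^sub>R (pval v (f u) +
       qcnj (m u) * (pval v y - \<kappa> *\<^sub>R (\<Sum>u\<in>UNIV. m u * pval v (f u)))))"
proof -
  have C: "0 < C" using s by (simp add: C_def)
  define t where "t \<alpha> = (\<Sum>u\<in>UNIV. m u * f u \<alpha>)" for \<alpha>
  from shift_fixpoint[of "\<lambda>u \<beta> y. f u \<beta> + qcnj (m u) * (y - \<kappa> *\<^sub>R t \<beta>)"]
  obtain y where y: "\<forall>\<alpha>. y \<alpha> = (\<Sum>u\<in>UNIV. shift u (\<lambda>\<beta>. f u \<beta> + qcnj (m u) * (y \<beta> - \<kappa> *\<^sub>R t \<beta>)) \<alpha>)"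
    by (rule exE)
  define w where "w u \<alpha> = f u \<alpha> + qcnj (m u) * (y \<alpha> - \<kappa> *\<^sub>R t \<alpha>)" for u \<alpha>
  define b where "b \<alpha> = C *\<^sub>R y \<alpha> - t \<alpha>" for \<alpha>
  have yw: "y \<alpha> = (\<Sum>u\<in>UNIV. shift u (w u) \<alpha>)" for \<alpha> unfolding w_def[abs_def] by (rule y[rule_format])
  have t_arv: "arv t" unfolding t_def[abs_def] by (intro arv_sum arv_mult f)
  define B W Y F where "B n = (\<Sum>\<alpha> | mabs \<alpha> = n. (norm (b \<alpha>))\<^sup>2 / mcoef \<alpha>)"
    and "W n = (\<Sum>\<alpha> | mabs \<alpha> = n. (\<Sum>u\<in>UNIV. (norm (w u \<alpha>))\<^sup>2) / mcoef \<alpha>)"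
    and "Y n = (\<Sum>\<alpha> | mabs \<alpha> = n. (norm (y \<alpha>))\<^sup>2 / mcoef \<alpha>)"
    and "F n = (\<Sum>\<alpha> | mabs \<alpha> = n. (\<Sum>u\<in>UNIV. (norm (f u \<alpha>))\<^sup>2) / mcoef \<alpha>)" for n
  have iso: "B n + W n = F n + Y n" for n
  proof -
    have "(norm (b \<alpha>))\<^sup>2 + (\<Sum>u\<in>UNIV. (norm (w u \<alpha>))\<^sup>2) = (\<Sum>u\<in>UNIV. (norm (f u \<alpha>))\<^sup>2) + (norm (y \<alpha>))\<^sup>2" for \<alpha>
      using colligation_isometry[where m = m and y = "y \<alpha>" and f = "\<lambda>u. f u \<alpha>"] s
      unfolding b_def w_def t_def \<kappa>_def C_def s_def by simp
    then show ?thesis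
      unfolding B_def W_def F_def Y_def by (simp flip: sum.distrib add_divide_distrib)
  qed
  \<comment> \<open>Every term of \<open>y\<close> contains a variable, so there is none of degree
    0; this starts the telescoping.\<close>
  have Y0: "Y 0 = 0"
  proof -
    have "y \<alpha> = 0" if "mabs \<alpha> = 0" for \<alpha>
    proof -
      have "\<alpha> $ u = 0" for u using that exhaust_3[of u] by (auto simp: mabs_3)
      then show ?thesis by (simp add: yw[of \<alpha>] shift_def)
    qed
    then show ?thesis by (simp add: Y_def)
  qed
  have YS: "Y (Suc n) \<le> W n" for n
    unfolding Y_def W_def yw by (rule row_shift_contractive)
  have W_nonneg: "0 \<le> W n" for n
    unfolding W_def by (intro sum_nonneg divide_nonneg_nonneg) (auto simp: less_imp_le)
  \<comment> \<open>Carrying the top term \<open>Y N\<close> closes the induction, since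
    \<open>B N + Y (Suc N) \<le> B N + W N = F N + Y N\<close>.\<close>
  have partial: "(\<Sum>n<N. B n) + Y N \<le> (\<Sum>n<N. F n)" for N
  proof (induction N)
    case (Suc N)
    then show ?case using iso[of N] YS[of N] by simp
  qed (simp add: Y0)
  have F_sums: "F sums (\<Sum>u\<in>UNIV. arv_sq (f u))"
  proof -
    have "(\<lambda>n. \<Sum>u\<in>UNIV. \<Sum>\<alpha> | mabs \<alpha> = n. (norm (f u \<alpha>))\<^sup>2 / mcoef \<alpha>) sums (\<Sum>u\<in>UNIV. arv_sq (f u))"
      by (intro sums_sum arv_sq_graded f)
    then show ?thesis unfolding F_def by (subst (asm) sum.swap) (simp add: sum_divide_distrib)
  qed
  have F_nonneg: "0 \<le> F n" for n
    unfolding F_def by (intro sum_nonneg divide_nonneg_nonneg) (auto simp: less_imp_le)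
  have Y_nonneg: "0 \<le> Y n" for n
    unfolding Y_def by (intro sum_nonneg) (simp add: less_imp_le)
  have "(\<Sum>n<N. B n) \<le> (\<Sum>u\<in>UNIV. arv_sq (f u))" for N
  proof -
    have "(\<Sum>n<N. F n) \<le> (\<Sum>u\<in>UNIV. arv_sq (f u))"
      using sum_le_suminf[of F "{..<N}"] F_sums F_nonneg by (simp add: sums_iff)
    then show ?thesis using partial[of N] Y_nonneg[of N] by simp
  qed
  then have b: "arv b" "arv_sq b \<le> (\<Sum>u\<in>UNIV. arv_sq (f u))"
    unfolding B_def by (rule arvI_graded)+
  \<comment> \<open>Since C y = b + t with C positive, finiteness of the norm passes from the output
    back to the internal signal.\<close>
  have "arv (\<lambda>\<alpha>. (1 / C) *\<^sub>R (b \<alpha> + t \<alpha>))" by (intro arv_scaleR arv_add b t_arv)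
  then have y_arv: "arv y" using C by (simp add: b_def)
  have w_eq: "w u \<alpha> = f u \<alpha> + qcnj (m u) * (y \<alpha> + (- \<kappa>) *\<^sub>R t \<alpha>)" for u \<alpha>
    by (simp add: w_def)
  have w_arv: "arv (w u)" for u
    unfolding w_eq[abs_def] by (intro arv_add arv_mult arv_scaleR f y_arv t_arv)
  show ?thesis
  proof (rule that[OF b(1) y_arv b(2)])
    fix v assume v: "(0, v) \<in> Omega_A"
    have pt: "pval v t = (\<Sum>u\<in>UNIV. m u * pval v (f u))"
      unfolding t_def[abs_def] using v f by (subst pval_sum) (simp_all add: arv_mult pval_mult)
    have "pval v b = pval v (\<lambda>\<alpha>. C *\<^sub>R y \<alpha> + (- 1) *\<^sub>R t \<alpha>)"
      by (rule arg_cong[of _ _ "pval v"]) (simp add: b_def fun_eq_iff)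
    also have "\<dots> = C *\<^sub>R pval v y + (- 1) *\<^sub>R pval v t"
      using v y_arv t_arv by (simp only: pval_add pval_scaleR arv_scaleR)
    finally show "pval v b = C *\<^sub>R pval v y - (\<Sum>u\<in>UNIV. m u * pval v (f u))" by (simp add: pt)
    have pw: "pval v (w u) = pval v (f u) + qcnj (m u) * (pval v y - \<kappa> *\<^sub>R pval v t)" for u
    proof -
      have "pval v (w u) = pval v (f u) + qcnj (m u) * (pval v y + (- \<kappa>) *\<^sub>R pval v t)"
        unfolding w_eq[abs_def] using v y_arv t_arv f
        by (simp only: pval_add pval_mult pval_scaleR arv_scaleR arv_mult arv_add)
      then show ?thesis by simp
    qed
    have "((\<lambda>\<alpha>. \<Sum>u\<in>UNIV. wpow v \<alpha> *\<^sub>R shift u (w u) \<alpha>) has_sum (\<Sum>u\<in>UNIV. v $ u *\<^sub>R pval v (w u))) UNIV"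
      by (intro has_sum_finite_sum has_sum_shift pval_has_sum w_arv v)
    then have "((\<lambda>\<alpha>. wpow v \<alpha> *\<^sub>R y \<alpha>) has_sum (\<Sum>u\<in>UNIV. v $ u *\<^sub>R pval v (w u))) UNIV"
      unfolding yw scaleR_sum_right .
    then show "pval v y = (\<Sum>u\<in>UNIV. v $ u *\<^sub>R (pval v (f u) +
       qcnj (m u) * (pval v y - \<kappa> *\<^sub>R (\<Sum>u\<in>UNIV. m u * pval v (f u)))))"
      using pval_unique[OF y_arv v] by (simp add: pw pt)
  qed
qed


section \<open>Quaternionic matrices\<close>

lemma qcnj_mult: "qcnj (p * q) = qcnj q * qcnj p"
  by (simp add: quat_eq_iff quat_mult_simps algebra_simps)

lemma qcnj_sum: "qcnj (\<Sum>i\<in>I. f i) = (\<Sum>i\<in>I. qcnj (f i))"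
  by (induction I rule: infinite_finite_induct) (simp_all add: quat_eq_iff)

lemma adj_nth: "adj A $ i $ j = qcnj (A $ j $ i)"
  by (simp add: adj_def)

lemma adj_adj: "adj (adj A) = A"
  by (simp add: vec_eq_iff adj_nth quat_eq_iff)

lemma adj_mul: "adj (A ** B) = adj B ** adj A"
  by (simp add: vec_eq_iff adj_nth matrix_matrix_mult_def qcnj_sum qcnj_mult)

lemma adj_diff: "adj (A - B) = adj A - adj B"
  by (simp add: vec_eq_iff adj_nth quat_eq_iff)

lemma adj_scaleR: "adj (r *\<^sub>R A) = r *\<^sub>R adj A"
  by (simp add: vec_eq_iff adj_nth quat_eq_iff)

lemma adj_mat: "adj (mat 1 :: quat^'n^'n) = mat 1"
  by (simp add: vec_eq_iff adj_nth mat_def quat_eq_iff)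

lemma matrix_scaleR_left: "(r *\<^sub>R A) ** B = r *\<^sub>R (A ** B)"
  for A :: "'a::real_algebra_1^'n^'m" and B :: "'a^'k^'n"
  by (simp add: vec_eq_iff matrix_matrix_mult_def scaleR_sum_right)

lemma matrix_scaleR_right: "A ** (r *\<^sub>R B) = r *\<^sub>R (A ** B)"
  for A :: "'a::real_algebra_1^'n^'m" and B :: "'a^'k^'n"
  by (simp add: vec_eq_iff matrix_matrix_mult_def scaleR_sum_right)

lemma matrix_diff_left: "(A - B) ** C = A ** C - B ** C"
  for A B :: "'a::ring_1^'n^'m" and C :: "'a^'k^'n"
  by (simp add: vec_eq_iff matrix_matrix_mult_def left_diff_distrib sum_subtractf)

lemma matrix_diff_right: "A ** (B - C) = A ** B - A ** C"
  for A :: "'a::ring_1^'n^'m" and B C :: "'a^'k^'n"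
  by (simp add: vec_eq_iff matrix_matrix_mult_def right_diff_distrib sum_subtractf)

lemma matrix_add_left: "(A + B) ** C = A ** C + B ** C"
  for A B :: "'a::ring_1^'n^'m" and C :: "'a^'k^'n"
  by (simp add: vec_eq_iff matrix_matrix_mult_def distrib_right sum.distrib)

lemma matrix_add_right: "A ** (B + C) = A ** B + A ** C"
  for A :: "'a::ring_1^'n^'m" and B C :: "'a^'k^'n"
  by (simp add: vec_eq_iff matrix_matrix_mult_def distrib_left sum.distrib)

lemmas matrix_ring_simps = matrix_scaleR_left matrix_scaleR_right matrix_diff_left matrix_diff_right
  matrix_add_left matrix_add_right

lemma matrix_inv_eqI:
  fixes A B :: "'a::semiring_1^'n^'n"
  assumes "A ** B = mat 1" "B ** A = mat 1"
  shows "matrix_inv A = B"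
proof -
  have *: "A ** matrix_inv A = mat 1 \<and> matrix_inv A ** A = mat 1"
    unfolding matrix_inv_def by (rule someI[of _ B]) (use assms in simp)
  have "matrix_inv A = (B ** A) ** matrix_inv A" using assms by simp
  also have "\<dots> = B ** (A ** matrix_inv A)" by (simp add: matrix_mul_assoc)
  finally show ?thesis using * by simp
qed

section \<open>Quadratic forms and uniqueness of positive square roots\<close>

definition qform :: "quat^'n^'n \<Rightarrow> quat^1^'n \<Rightarrow> real" where
  "qform A \<xi> = Qre ((adj \<xi> ** A ** \<xi>) $ 1 $ 1)"

definition col_sq :: "quat^1^'n \<Rightarrow> real" where
  "col_sq \<xi> = (\<Sum>i\<in>UNIV. (norm (\<xi> $ i $ 1))\<^sup>2)"

lemma Qre_sum: "Qre (\<Sum>i\<in>I. f i) = (\<Sum>i\<in>I. Qre (f i))"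
  by (induction I rule: infinite_finite_induct) simp_all

lemma Qre_adj_mul_self: "Qre ((adj \<xi> ** \<xi>) $ 1 $ 1) = col_sq \<xi>"
proof -
  have "Qre (qcnj q * q) = (norm q)\<^sup>2" for q by (simp add: quat_mult_qcnj_aux)
  then show ?thesis
    by (simp add: matrix_matrix_mult_def adj_nth col_sq_def Qre_sum)
qed

lemma col_sq_nonneg: "0 \<le> col_sq \<xi>"
  by (simp add: col_sq_def sum_nonneg)

lemma col_sq_eq_0: "col_sq \<xi> = 0 \<longleftrightarrow> \<xi> = 0"
  by (auto simp: col_sq_def sum_nonneg_eq_0_iff vec_eq_iff forall_1)

text \<open>A positive root \<open>R\<close> of \<open>S\<^sup>2\<close> commutes with \<open>S\<^sup>2\<close>, hence with \<open>S = \<alpha> + \<beta> S\<^sup>2\<close>; so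
  \<open>(R - S) (R + S) = 0\<close>, where \<open>R + S\<close> is positive definite.\<close>

lemma msqrt_eqI:
  fixes S :: "quat^'n^'n"
  assumes herm: "adj S = S" and c: "0 < c" and pos: "\<And>\<xi>. c * col_sq \<xi> \<le> qform S \<xi>"
    and S: "S = \<alpha> *\<^sub>R mat 1 + \<beta> *\<^sub>R (S ** S)"
  shows "msqrt (S ** S) = S"
  unfolding msqrt_def
proof (rule the_equality)
  have "0 \<le> qform S \<xi>" for \<xi>
    using order_trans[OF mult_nonneg_nonneg pos[of \<xi>]] c col_sq_nonneg[of \<xi>] by simp
  then show "pos_semidef S \<and> S ** S = S ** S"
    using herm by (simp add: pos_semidef_def flip: qform_def)
  fix R assume "pos_semidef R \<and> R ** R = S ** S"
  then have RR: "R ** R = S ** S" and R: "adj R = R" "\<And>\<xi>. 0 \<le> qform R \<xi>"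
    by (simp_all add: pos_semidef_def qform_def)
  have "R ** S = R ** (\<alpha> *\<^sub>R mat 1 + \<beta> *\<^sub>R (R ** R))" using S RR by simp
  also have "\<dots> = (\<alpha> *\<^sub>R mat 1 + \<beta> *\<^sub>R (R ** R)) ** R"
    by (simp add: matrix_ring_simps matrix_mul_assoc)
  also have "\<dots> = S ** R" using S RR by simp
  finally have comm: "R ** S = S ** R" .
  have sum_diff: "(R + S) ** (R - S) = 0"
    by (simp add: matrix_ring_simps RR comm)
  have zero: "(R - S) ** \<eta> = 0" for \<eta> :: "quat^1^'n"
  proof -
    define \<xi> where "\<xi> = (R - S) ** \<eta>"
    have "(R + S) ** \<xi> = ((R + S) ** (R - S)) ** \<eta>" by (simp add: \<xi>_def matrix_mul_assoc)
    then have "(R + S) ** \<xi> = 0" by (simp add: sum_diff)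
    then have "adj \<xi> ** R ** \<xi> + adj \<xi> ** S ** \<xi> = 0"
      using matrix_mul_assoc[of "adj \<xi>" "R + S" \<xi>] by (simp add: matrix_ring_simps)
    then have "qform R \<xi> + qform S \<xi> = 0"
      unfolding qform_def by (metis quat_add_simps(1,5) vector_add_component zero_index)
    then have "c * col_sq \<xi> \<le> 0" using R(2)[of \<xi>] pos[of \<xi>] by linarith
    then have "col_sq \<xi> = 0" using c col_sq_nonneg[of \<xi>] by (simp add: mult_le_0_iff)
    then show ?thesis by (simp add: col_sq_eq_0 \<xi>_def)
  qed
  have "(R - S) $ i $ j = 0" for i j
  proof -
    have "((R - S) ** (\<chi> k l. if k = j then 1 else 0)) $ i $ (1::1) = (R - S) $ i $ j"
      by (simp add: matrix_matrix_mult_def if_distrib cong: if_cong)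
    then show ?thesis by (simp add: zero)
  qed
  then show "R = S" by (simp add: vec_eq_iff)
qed

section \<open>The matrices of the Blaschke factor\<close>

lemma row_mul_adj:
  fixes A :: "quat^'n^1"
  shows "A ** adj A = (\<Sum>u\<in>UNIV. (norm (A $ 1 $ u))\<^sup>2) *\<^sub>R mat 1"
  by (simp add: vec_eq_iff forall_1 matrix_matrix_mult_def adj_nth quat_mult_qcnj_aux mat_def
      scaleR_sum_left)

lemma row_mul_col_sq:
  fixes A :: "quat^'n^1" and \<xi> :: "quat^1^'n"
  shows "col_sq (A ** \<xi>) \<le> (\<Sum>u\<in>UNIV. (norm (A $ 1 $ u))\<^sup>2) * col_sq \<xi>"
proof -
  have "col_sq (A ** \<xi>) = (norm (\<Sum>k\<in>UNIV. A $ 1 $ k * \<xi> $ k $ 1))\<^sup>2"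
    by (simp add: col_sq_def matrix_matrix_mult_def)
  also have "\<dots> \<le> (\<Sum>k\<in>UNIV. norm (A $ 1 $ k) * norm (\<xi> $ k $ 1))\<^sup>2"
    by (intro power_mono sum_norm_le) (simp_all add: norm_mult)
  also have "\<dots> \<le> (\<Sum>u\<in>UNIV. (norm (A $ 1 $ u))\<^sup>2) * (\<Sum>k\<in>UNIV. (norm (\<xi> $ k $ 1))\<^sup>2)"
    by (rule Cauchy_Schwarz_ineq_sum)
  finally show ?thesis by (simp add: col_sq_def)
qed

locale contractive_row =
  fixes A :: "quat^'n^1" and s C \<kappa> :: real
  assumes s_def: "s = (\<Sum>u\<in>UNIV. (norm (A $ 1 $ u))\<^sup>2)" and s: "s < 1"
    and C_def: "C = sqrt (1 - s)" and \<kappa>_def: "\<kappa> = 1 / (1 + C)"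
begin

lemma C_pos: "0 < C"
  using s by (simp add: C_def)

lemma C_square: "C * C = 1 - s"
  using s by (simp add: C_def)

lemma \<kappa>_mult: "\<kappa> * (1 + C) = 1"
  using C_pos by (simp add: \<kappa>_def)

lemma s_\<kappa>: "s * \<kappa> = 1 - C"
proof -
  have "s * \<kappa> = (1 - C * C) * \<kappa>" by (simp add: C_square)
  also have "\<dots> = (1 - C) * (\<kappa> * (1 + C))" by (simp add: algebra_simps)
  finally show ?thesis by (simp add: \<kappa>_mult)
qed

text \<open>The matrix P = \<open>adj A ** A\<close> satisfies P^2 = s P, so matrices of the form 1
  + c P are closed under multiplication. The square root of 1 - P must have eigenvalue C where P has
  eigenvalue s, which gives c = -\<kappa>; \<open>E\<close> is its inverse.\<close>

definition D :: "quat^'n^'n" where "D = mat 1 - \<kappa> *\<^sub>R (adj A ** A)"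

definition E :: "quat^'n^'n" where "E = mat 1 + (\<kappa> / C) *\<^sub>R (adj A ** A)"

lemma AA: "A ** adj A = s *\<^sub>R mat 1"
  by (simp add: row_mul_adj s_def)

lemma P_square: "(adj A ** A) ** (adj A ** A) = s *\<^sub>R (adj A ** A)"
proof -
  have "(adj A ** A) ** (adj A ** A) = adj A ** (A ** adj A) ** A" by (simp add: matrix_mul_assoc)
  then show ?thesis by (simp add: AA matrix_ring_simps)
qed

lemma D_square: "D ** D = mat 1 - adj A ** A"
proof -
  have "D ** D = mat 1 - (\<kappa> + \<kappa> - \<kappa> * (s * \<kappa>)) *\<^sub>R (adj A ** A)"
  proof -
    have "D ** D = (mat 1 - \<kappa> *\<^sub>R (adj A ** A)) - \<kappa> *\<^sub>R (adj A ** A - \<kappa> *\<^sub>R (s *\<^sub>R (adj A ** A)))"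
      unfolding D_def by (simp only: matrix_ring_simps P_square matrix_mul_lid matrix_mul_rid)
    moreover have "(mat 1 - \<kappa> *\<^sub>R P) - \<kappa> *\<^sub>R (P - \<kappa> *\<^sub>R (s *\<^sub>R P)) =
        mat 1 - (\<kappa> + \<kappa> - \<kappa> * (s * \<kappa>)) *\<^sub>R P" for P :: "quat^'n^'n"
      by (simp add: vec_eq_iff quat_eq_iff algebra_simps)
    ultimately show ?thesis by simp
  qed
  also have "\<kappa> + \<kappa> - \<kappa> * (s * \<kappa>) = \<kappa> * (1 + C)" unfolding s_\<kappa> by (simp add: algebra_simps)
  finally show ?thesis by (simp add: \<kappa>_mult)
qed

lemma A_D: "A ** D = C *\<^sub>R A"
proof -
  have "A ** D = A - \<kappa> *\<^sub>R ((A ** adj A) ** A)"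
    by (simp add: D_def matrix_ring_simps matrix_mul_assoc)
  also have "\<dots> = (1 - s * \<kappa>) *\<^sub>R A" by (simp add: AA matrix_ring_simps algebra_simps)
  finally show ?thesis by (simp add: s_\<kappa>)
qed

lemma D_E: "D ** E = mat 1" and E_D: "E ** D = mat 1"
proof -
  have *: "\<kappa> / C - \<kappa> - \<kappa> / C * (s * \<kappa>) = 0"
    unfolding s_\<kappa> using C_pos by (simp add: field_simps)
  have "D ** E = mat 1 + (\<kappa> / C - \<kappa> - \<kappa> / C * (s * \<kappa>)) *\<^sub>R (adj A ** A)"
    unfolding D_def E_def by (simp add: matrix_ring_simps P_square algebra_simps)
  then show "D ** E = mat 1" by (simp only: *) simp
  have "E ** D = mat 1 + (\<kappa> / C - \<kappa> - \<kappa> / C * (s * \<kappa>)) *\<^sub>R (adj A ** A)"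
    unfolding D_def E_def by (simp add: matrix_ring_simps P_square algebra_simps)
  then show "E ** D = mat 1" by (simp only: *) simp
qed

lemma matrix_inv_D: "matrix_inv D = E"
  by (rule matrix_inv_eqI[OF D_E E_D])

lemma msqrt_col: "msqrt (mat 1 - adj A ** A) = D"
proof -
  have "msqrt (D ** D) = D"
  proof (rule msqrt_eqI[OF _ C_pos])
    show "adj D = D" by (simp add: D_def adj_diff adj_scaleR adj_mul adj_adj adj_mat)
    \<comment> \<open>As \<open>adj A ** A\<close> is 1 - D^2, the matrix \<open>D\<close> is affine
      in its own square.\<close>
    show "D = (1 - \<kappa>) *\<^sub>R mat 1 + \<kappa> *\<^sub>R (D ** D)"
      unfolding D_square by (simp add: D_def algebra_simps)
    fix \<xi> :: "quat^1^'n"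
    have "adj \<xi> ** D ** \<xi> = adj \<xi> ** \<xi> - \<kappa> *\<^sub>R (adj (A ** \<xi>) ** (A ** \<xi>))"
      by (simp add: D_def matrix_ring_simps adj_mul matrix_mul_assoc)
    then have "qform D \<xi> = Qre ((adj \<xi> ** \<xi>) $ 1 $ 1) - \<kappa> * Qre ((adj (A ** \<xi>) ** (A ** \<xi>)) $ 1 $ 1)"
      by (simp add: qform_def)
    also have "\<dots> = col_sq \<xi> - \<kappa> * col_sq (A ** \<xi>)"
      unfolding Qre_adj_mul_self ..
    \<comment> \<open>Cauchy-Schwarz for A \<xi> leaves the strictly positive lower bound 1 - s
      \<kappa> = C for the form.\<close>
    also have "\<dots> \<ge> col_sq \<xi> - \<kappa> * (s * col_sq \<xi>)"
      using row_mul_col_sq[of A \<xi>] C_pos unfolding s_def[symmetric]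
      by (simp add: \<kappa>_def divide_right_mono)
    also have "col_sq \<xi> - \<kappa> * (s * col_sq \<xi>) = (1 - s * \<kappa>) * col_sq \<xi>"
      by (simp add: algebra_simps)
    finally show "C * col_sq \<xi> \<le> qform D \<xi>" by (simp add: s_\<kappa>)
  qed
  then show ?thesis by (simp add: D_square)
qed

lemma msqrt_row: "msqrt (mat 1 - A ** adj A) = C *\<^sub>R mat 1"
proof -
  have "msqrt ((C *\<^sub>R mat 1) ** (C *\<^sub>R mat 1)) = (C *\<^sub>R mat 1 :: quat^1^1)"
  proof (rule msqrt_eqI[OF _ C_pos, where \<alpha> = C and \<beta> = 0])
    show "adj (C *\<^sub>R mat 1) = (C *\<^sub>R mat 1 :: quat^1^1)" by (simp add: adj_scaleR adj_mat)
    fix \<xi> :: "quat^1^1"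
    have "adj \<xi> ** (C *\<^sub>R mat 1) ** \<xi> = C *\<^sub>R (adj \<xi> ** \<xi>)"
      by (simp add: matrix_ring_simps)
    then show "C * col_sq \<xi> \<le> qform (C *\<^sub>R mat 1) \<xi>"
      by (simp add: qform_def Qre_adj_mul_self)
  qed simp
  moreover have "mat 1 - A ** adj A = (C *\<^sub>R mat 1) ** (C *\<^sub>R mat 1)"
    by (simp add: AA matrix_ring_simps C_square algebra_simps)
  ultimately show ?thesis by simp
qed

text \<open>The left-hand side is the output of the colligation at input \<open>F\<close> with internal
  signal \<open>Y\<close>; the factor \<open>E = D\<^sup>-\<^sup>1\<close> on the right brings it into the form of \<open>B\<^sub>a\<close>.\<close>

lemma transfer_function:
  fixes F :: "quat^1^'n" and Y K :: "quat^1^1" and X :: "quat^'n^1"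
  assumes K: "K ** (mat 1 - X ** adj A) = mat 1"
    and Y: "Y = X ** (F + adj A ** (Y - \<kappa> *\<^sub>R (A ** F)))"
  shows "C *\<^sub>R Y - A ** F = C *\<^sub>R (K ** (X - A) ** E) ** F"
proof -
  have "Y - X ** adj A ** Y = X ** D ** F"
  proof -
    have "X ** (F + adj A ** (Y - \<kappa> *\<^sub>R (A ** F))) = X ** D ** F + X ** adj A ** Y"
      by (simp add: D_def matrix_ring_simps matrix_mul_assoc)
    with Y have "Y = X ** D ** F + X ** adj A ** Y" by (rule trans)
    then show ?thesis by (simp only: diff_eq_eq)
  qed
  then have "(mat 1 - X ** adj A) ** Y = X ** D ** F" by (simp add: matrix_ring_simps)
  then have "K ** ((mat 1 - X ** adj A) ** Y) = K ** (X ** D ** F)" by simp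
  then have Y': "Y = K ** X ** D ** F" by (simp add: matrix_mul_assoc K)
  \<comment> \<open>Writing \<open>F\<close> as \<open>D ** G\<close> produces \<open>D ** D\<close>
    in one term and, through \<open>A_D\<close>, the common factor \<open>C\<close> in the
    other.\<close>
  define G where "G = E ** F"
  have F: "F = D ** G" by (simp add: G_def matrix_mul_assoc D_E)
  have "K - K ** X ** adj A = mat 1" using K by (simp add: matrix_ring_simps matrix_mul_assoc)
  then have A: "A = K ** A - K ** X ** adj A ** A"
    by (metis matrix_diff_left matrix_mul_lid)
  have "C *\<^sub>R Y - A ** F = C *\<^sub>R (K ** X ** (D ** D) ** G) - (A ** D) ** G"
    by (simp add: Y' F matrix_mul_assoc)
  also have "\<dots> = C *\<^sub>R ((K ** X - K ** X ** adj A ** A - A) ** G)"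
    unfolding D_square A_D by (simp add: matrix_ring_simps matrix_mul_assoc algebra_simps)
  \<comment> \<open>Expanding the last \<open>A\<close> through \<open>K\<close> cancels the terms
    in \<open>adj A ** A\<close>.\<close>
  also have "K ** X - K ** X ** adj A ** A - A = K ** X - K ** A" by (subst (2) A) simp
  finally show ?thesis by (simp add: G_def matrix_ring_simps matrix_mul_assoc)
qed

end


section \<open>Multipliers\<close>

lemma index_1: "(i :: 1) = 1"
  using forall_1[of "\<lambda>i. i = 1"] by simp

text \<open>A sufficient condition for \<open>CK_mat\<close> to be computable: each entry is the
  restriction to x0 = 0 of a series with Arveson coefficients, hence has an extension to all of
  \<open>Omega_A\<close>.\<close>

definition arv_mat :: "(real^3 \<Rightarrow> quat^'n^'m) \<Rightarrow> bool" where
  "arv_mat h \<longleftrightarrow> (\<forall>i j. \<exists>c. arv c \<and> (\<forall>v. (0, v) \<in> Omega_A \<longrightarrow> pval v c = h v $ i $ j))"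

lemma arv_mat_cong:
  assumes "arv_mat h" "\<And>v. (0, v) \<in> Omega_A \<Longrightarrow> h v = h' v"
  shows "arv_mat h'"
  using assms unfolding arv_mat_def by simp

lemma CK_mat_value:
  assumes "arv_mat h" "(0, v) \<in> Omega_A"
  shows "CK_mat h (0, v) = h v"
proof -
  have "CK Omega_A (\<lambda>v. h v $ i $ j) (0, v) = h v $ i $ j" for i j
  proof -
    obtain c where c: "arv c" "\<And>v. (0, v) \<in> Omega_A \<Longrightarrow> pval v c = h v $ i $ j"
      using assms(1) unfolding arv_mat_def by blast
    then show ?thesis using CK_pval[of c "\<lambda>v. h v $ i $ j"] assms(2) by (simp flip: pval_def)
  qed
  then show ?thesis by (simp add: CK_mat_def vec_eq_iff)
qed

lemma arveson_series_arv: "arveson_series c f \<Longrightarrow> arv c"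
  by (simp add: arveson_series_def arv_def)

lemma arveson_pow_norm_eq:
  fixes f :: "point \<Rightarrow> quat^1^'n"
  assumes "\<And>u. arveson_series (c u) (\<lambda>x. f x $ u $ 1)"
  shows "arveson_pow_norm f = sqrt (\<Sum>u\<in>UNIV. arv_sq (c u))"
  unfolding arveson_pow_norm_def arveson_norm_eq[OF assms] by (simp add: arv_sq_nonneg)

lemma arveson_operator_bound:
  fixes T :: "(point \<Rightarrow> quat^1^'n) \<Rightarrow> point \<Rightarrow> quat^1^1"
  assumes K: "0 \<le> K"
    and T: "\<And>c f. (\<And>u. arveson_series (c u) (\<lambda>x. f x $ u $ 1)) \<Longrightarrow>
      \<exists>b. arv b \<and> arv_sq b \<le> K\<^sup>2 * (\<Sum>u\<in>UNIV. arv_sq (c u)) \<and> (\<forall>x. T f x $ 1 $ 1 = mu_series b x)"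
  shows "T ` arveson_pow \<subseteq> arveson_pow" "arveson_op_norm T \<le> ennreal K"
proof -
  have main: "T f \<in> arveson_pow \<and> arveson_pow_norm (T f) \<le> K * arveson_pow_norm f" if f: "f \<in> arveson_pow" for f
  proof -
    have "\<forall>u. \<exists>c. arveson_series c (\<lambda>x. f x $ u $ 1)"
      using f by (simp add: arveson_pow_def arveson_def)
    then obtain c where c: "\<And>u. arveson_series (c u) (\<lambda>x. f x $ u $ 1)" by metis
    obtain b where b: "arv b" "arv_sq b \<le> K\<^sup>2 * (\<Sum>u\<in>UNIV. arv_sq (c u))"
        "\<And>x. T f x $ 1 $ 1 = mu_series b x"
      using T[OF c] by blast
    have Tf: "arveson_series b (\<lambda>x. T f x $ u $ 1)" for u :: 1
      using arveson_series_mu_series[OF b(1)] by (simp add: index_1[of u] b(3))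
    then have "T f \<in> arveson_pow" unfolding arveson_pow_def arveson_def by blast
    moreover have "arveson_pow_norm (T f) \<le> sqrt (K\<^sup>2 * (\<Sum>u\<in>UNIV. arv_sq (c u)))"
      unfolding arveson_pow_norm_eq[of "\<lambda>u. b", OF Tf] using b(2) by simp
    ultimately show ?thesis
      unfolding arveson_pow_norm_eq[OF c] using K by (simp add: real_sqrt_mult)
  qed
  then show "T ` arveson_pow \<subseteq> arveson_pow" by blast
  show "arveson_op_norm T \<le> ennreal K"
    unfolding arveson_op_norm_def
  proof (rule Inf_lower, intro CollectI ballI)
    fix f :: "point \<Rightarrow> quat^1^'n" assume "f \<in> arveson_pow"
    then have "ennreal (arveson_pow_norm (T f)) \<le> ennreal (K * arveson_pow_norm f)"
      using main by (intro ennreal_leI) blast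
    then show "ennreal (arveson_pow_norm (T f)) \<le> ennreal K * ennreal (arveson_pow_norm f)"
      using K by (simp add: ennreal_mult')
  qed
qed

lemma pval_arveson_series:
  assumes "arveson_series c f" "(0, v) \<in> Omega_A"
  shows "pval v c = f (0, v)"
  by (rule pval_unique[OF arveson_series_arv[OF assms(1)] assms(2) arveson_series_real[OF assms]])

text \<open>A constant row acts on each coefficient separately, so the weights do not interfere and
  Cauchy-Schwarz gives the bound sqrt s, below 1.\<close>

lemma strict_contraction_left_mult:
  fixes A :: "quat^'n^1"
  assumes "(\<Sum>u\<in>UNIV. (norm (A $ 1 $ u))\<^sup>2) < 1"
  shows "strict_contraction (left_mult A)"
proof -
  define s where "s = (\<Sum>u\<in>UNIV. (norm (A $ 1 $ u))\<^sup>2)"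
  have s: "0 \<le> s" "s < 1" using assms by (simp_all add: s_def sum_nonneg)
  have "\<exists>b. arv b \<and> arv_sq b \<le> (sqrt s)\<^sup>2 * (\<Sum>u\<in>UNIV. arv_sq (c u)) \<and>
      (\<forall>x. left_mult A f x $ 1 $ 1 = mu_series b x)"
    if c: "\<And>u. arveson_series (c u) (\<lambda>x. f x $ u $ 1)" for c and f :: "point \<Rightarrow> quat^1^'n"
  proof (intro exI conjI allI)
    note arv_c = arveson_series_arv[OF c]
    define b where "b \<alpha> = (\<Sum>u\<in>UNIV. A $ 1 $ u * c u \<alpha>)" for \<alpha>
    show arv_b: "arv b" unfolding b_def[abs_def] by (intro arv_sum arv_mult arv_c)
    have bound: "(norm (b \<alpha>))\<^sup>2 \<le> s * (\<Sum>u\<in>UNIV. (norm (c u \<alpha>))\<^sup>2)" for \<alpha>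
      using row_mul_col_sq[of A "\<chi> u i. c u \<alpha>"]
      by (simp add: col_sq_def matrix_matrix_mult_def s_def b_def)
    have le: "mfact \<alpha> / fact (mabs \<alpha>) * (norm (b \<alpha>))\<^sup>2 \<le>
        s * (\<Sum>u\<in>UNIV. mfact \<alpha> / fact (mabs \<alpha>) * (norm (c u \<alpha>))\<^sup>2)" for \<alpha>
    proof -
      have "mfact \<alpha> / fact (mabs \<alpha>) * (norm (b \<alpha>))\<^sup>2 \<le>
          mfact \<alpha> / fact (mabs \<alpha>) * (s * (\<Sum>u\<in>UNIV. (norm (c u \<alpha>))\<^sup>2))"
        using bound by (rule mult_left_mono) (simp add: less_imp_le)
      then show ?thesis by (simp only: sum_distrib_left mult.left_commute)
    qed
    have big: "((\<lambda>\<alpha>. s * (\<Sum>u\<in>UNIV. mfact \<alpha> / fact (mabs \<alpha>) * (norm (c u \<alpha>))\<^sup>2)) has_sum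
        s * (\<Sum>u\<in>UNIV. arv_sq (c u))) UNIV"
      unfolding arv_sq_def
      using arv_c by (intro has_sum_cmult_right has_sum_finite_sum has_sum_infsum) (simp add: arv_def)
    have small: "((\<lambda>\<alpha>. mfact \<alpha> / fact (mabs \<alpha>) * (norm (b \<alpha>))\<^sup>2) has_sum arv_sq b) UNIV"
      unfolding arv_sq_def using arv_b by (intro has_sum_infsum) (simp add: arv_def)
    have "arv_sq b \<le> s * (\<Sum>u\<in>UNIV. arv_sq (c u))" by (rule has_sum_mono[OF small big le])
    then show "arv_sq b \<le> (sqrt s)\<^sup>2 * (\<Sum>u\<in>UNIV. arv_sq (c u))" using s(1) by simp
    fix x
    have "CK Omega_A (\<lambda>v. (A ** f (0, v)) $ 1 $ 1) = mu_series b"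
    proof (rule CK_pval[OF arv_b])
      fix v assume v: "(0, v) \<in> Omega_A"
      show "pval v b = (A ** f (0, v)) $ 1 $ 1"
        unfolding b_def[abs_def] using v arv_c
        by (simp add: pval_sum arv_mult pval_mult pval_arveson_series[OF c] matrix_matrix_mult_def)
    qed
    then show "left_mult A f x $ 1 $ 1 = mu_series b x"
      by (simp add: left_mult_def ck_prod_def CK_mat_def)
  qed
  from arveson_operator_bound[OF _ this] s
  have "left_mult A ` arveson_pow \<subseteq> arveson_pow" "arveson_op_norm (left_mult A) \<le> ennreal (sqrt s)"
    by simp_all
  moreover have "ennreal (sqrt s) < 1"
    using s by (simp add: ennreal_less_one_iff)
  ultimately show ?thesis unfolding strict_contraction_def by (metis order_le_less_trans)
qed

section \<open>The colligation and the Blaschke factor of a fixed point\<close>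

context
  fixes a :: point and s C \<kappa> :: real
  assumes a: "a \<in> Omega_1"
    and s_eq: "s = (\<Sum>u\<in>UNIV. (norm (mu u a))\<^sup>2)"
    and C_eq: "C = sqrt (1 - s)" and \<kappa>_eq: "\<kappa> = 1 / (1 + C)"
begin

interpretation contractive_row "mu_row a" s C \<kappa>
  using a by unfold_locales (simp_all add: s_eq C_eq \<kappa>_eq mu_row_def Omega_1_def)

lemma mu_row_real: "(0, v) \<in> Omega_A \<Longrightarrow> mu_row (0, v) $ i $ u = of_real (v $ u)"
  by (simp add: mu_row_def mu_def)

lemma colligation_mu:
  assumes "\<And>u. arv (f u)"
  shows "\<exists>b y. arv b \<and> arv y \<and> arv_sq b \<le> (\<Sum>u\<in>UNIV. arv_sq (f u)) \<and>
    (\<forall>v. (0, v) \<in> Omega_A \<longrightarrow> pval v b = C *\<^sub>R pval v y - (\<Sum>u\<in>UNIV. mu u a * pval v (f u))) \<and>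
    (\<forall>v. (0, v) \<in> Omega_A \<longrightarrow> pval v y = (\<Sum>u\<in>UNIV. v $ u *\<^sub>R (pval v (f u) +
       qcnj (mu u a) * (pval v y - \<kappa> *\<^sub>R (\<Sum>u\<in>UNIV. mu u a * pval v (f u))))))"
proof (rule colligation[of "\<lambda>u. mu u a" f, folded s_eq, folded C_eq, folded \<kappa>_eq, OF s assms])
  fix b y
  assume "arv b" "arv y" "arv_sq b \<le> (\<Sum>u\<in>UNIV. arv_sq (f u))"
    and 1: "\<And>v. (0, v) \<in> Omega_A \<Longrightarrow>
      pval v b = C *\<^sub>R pval v y - (\<Sum>u\<in>UNIV. mu u a * pval v (f u))"
    and 2: "\<And>v. (0, v) \<in> Omega_A \<Longrightarrow> pval v y = (\<Sum>u\<in>UNIV. v $ u *\<^sub>R (pval v (f u) +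
       qcnj (mu u a) * (pval v y - \<kappa> *\<^sub>R (\<Sum>u\<in>UNIV. mu u a * pval v (f u)))))"
  then show ?thesis
    by (intro exI[of _ b] exI[of _ y] conjI allI impI) (assumption | rule 1 2)+
qed

definition resolvent :: "real^3 \<Rightarrow> quat^1^1" where
  "resolvent v = matrix_inv (mat 1 - mu_row (0, v) ** adj (mu_row a))"

text \<open>The inverse of \<open>1 - \<mu>(x) \<mu>(a)\<^sup>*\<close> is read off the colligation at the constant input
  \<open>\<mu>(a)\<^sup>*\<close>: there \<open>y = C (1 - \<mu>(x) \<mu>(a)\<^sup>*)\<^sup>-\<^sup>1 - C\<close>.\<close>

lemma resolvent:
  shows "arv_mat resolvent"
    and "(0, v) \<in> Omega_A \<Longrightarrow> resolvent v ** (mat 1 - mu_row (0, v) ** adj (mu_row a)) = mat 1"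
proof -
  obtain y where y: "arv y" and y_eq: "\<And>v. (0, v) \<in> Omega_A \<Longrightarrow>
      pval v y = (\<Sum>u\<in>UNIV. v $ u *\<^sub>R (pval v (const_coeff (qcnj (mu u a))) +
       qcnj (mu u a) * (pval v y - \<kappa> *\<^sub>R (\<Sum>u\<in>UNIV. mu u a * pval v (const_coeff (qcnj (mu u a)))))))"
    using colligation_mu[of "\<lambda>u. const_coeff (qcnj (mu u a))", OF arv_const_coeff] by blast
  define k where "k \<alpha> = const_coeff 1 \<alpha> + (1 / C) *\<^sub>R y \<alpha>" for \<alpha>
  have k: "arv k" unfolding k_def[abs_def] by (intro arv_add arv_scaleR arv_const_coeff y)
  have mm: "(\<Sum>u\<in>UNIV. mu u a * qcnj (mu u a)) = s *\<^sub>R 1"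
    by (simp add: quat_mult_qcnj_aux s_eq scaleR_sum_left)
  have inv: "resolvent v = (\<chi> i j. pval v k) \<and>
      resolvent v ** (mat 1 - mu_row (0, v) ** adj (mu_row a)) = mat 1" if v: "(0, v) \<in> Omega_A" for v
  proof -
    define p where "p = (\<Sum>u\<in>UNIV. v $ u *\<^sub>R qcnj (mu u a))"
    have "pval v y = (\<Sum>u\<in>UNIV. v $ u *\<^sub>R (qcnj (mu u a) * (1 + (pval v y - \<kappa> *\<^sub>R (s *\<^sub>R 1)))))"
      using y_eq[OF v] unfolding pval_const_coeff[OF v] mm
      by (simp only: distrib_left mult_1_right)
    also have "\<dots> = p * (1 + (pval v y - \<kappa> *\<^sub>R (s *\<^sub>R 1)))"
      by (simp only: p_def sum_distrib_right mult_scaleR_left)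
    also have "1 + (pval v y - \<kappa> *\<^sub>R (s *\<^sub>R 1)) = (1 - s * \<kappa>) *\<^sub>R 1 + pval v y"
      by (simp add: algebra_simps)
    also have "1 - s * \<kappa> = C" by (simp add: s_\<kappa>)
    finally have yp: "pval v y = p * (C *\<^sub>R 1 + pval v y)" .
    have kv: "pval v k = (1 / C) *\<^sub>R (C *\<^sub>R 1 + pval v y)"
      unfolding k_def[abs_def] using v y C_pos
      by (simp add: pval_add pval_scaleR pval_const_coeff arv_scaleR arv_const_coeff scaleR_add_right)
    have "(1 - p) * (C *\<^sub>R 1 + pval v y) = C *\<^sub>R 1"
      unfolding left_diff_distrib yp[symmetric] by simp
    then have 1: "(1 - p) * pval v k = 1"
      unfolding kv using C_pos by simp
    then have 2: "pval v k * (1 - p) = 1"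
      by (metis inverse_unique left_inverse mult_zero_left zero_neq_one)
    have q: "mat 1 - mu_row (0, v) ** adj (mu_row a) = (\<chi> i j. 1 - p)"
      by (simp add: vec_eq_iff forall_1 mat_def matrix_matrix_mult_def adj_nth mu_row_real[OF v] p_def
          scaleR_conv_of_real) (simp add: mu_row_def)
    have "((\<chi> i j. 1 - p) :: quat^1^1) ** ((\<chi> i j. pval v k) :: quat^1^1) = mat 1"
      "((\<chi> i j. pval v k) :: quat^1^1) ** ((\<chi> i j. 1 - p) :: quat^1^1) = mat 1"
      using 1 2 by (simp_all add: vec_eq_iff forall_1 mat_def matrix_matrix_mult_def)
    with matrix_inv_eqI[OF this] show ?thesis unfolding resolvent_def q by simp
  qed
  show "arv_mat resolvent"
    unfolding arv_mat_def using k inv by auto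
  show "(0, v) \<in> Omega_A \<Longrightarrow> resolvent v ** (mat 1 - mu_row (0, v) ** adj (mu_row a)) = mat 1"
    using inv by blast
qed

definition blaschke_real :: "real^3 \<Rightarrow> quat^3^1" where
  "blaschke_real v = C *\<^sub>R (resolvent v ** (mu_row (0, v) - mu_row a) ** E)"

lemma blaschke_real_contractive:
  assumes f: "\<And>u. arv (f u)"
  shows "\<exists>b. arv b \<and> arv_sq b \<le> (\<Sum>u\<in>UNIV. arv_sq (f u)) \<and>
    (\<forall>v. (0, v) \<in> Omega_A \<longrightarrow> pval v b = (blaschke_real v ** (\<chi> u i. pval v (f u))) $ 1 $ (1::1))"
proof -
  obtain b y where b: "arv b" and b_le: "arv_sq b \<le> (\<Sum>u\<in>UNIV. arv_sq (f u))" and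
    bv: "\<And>v. (0, v) \<in> Omega_A \<Longrightarrow> pval v b = C *\<^sub>R pval v y - (\<Sum>u\<in>UNIV. mu u a * pval v (f u))" and
    yv: "\<And>v. (0, v) \<in> Omega_A \<Longrightarrow> pval v y = (\<Sum>u\<in>UNIV. v $ u *\<^sub>R (pval v (f u) +
       qcnj (mu u a) * (pval v y - \<kappa> *\<^sub>R (\<Sum>u\<in>UNIV. mu u a * pval v (f u)))))"
    using colligation_mu[of f, OF f] by blast
  have "pval v b = (blaschke_real v ** (\<chi> u i. pval v (f u))) $ 1 $ (1::1)" if v: "(0, v) \<in> Omega_A" for v
  proof -
    define F :: "quat^1^3" where "F = (\<chi> u i. pval v (f u))"
    define Y :: "quat^1^1" where "Y = (\<chi> i j. pval v y)"
    have AF: "(mu_row a ** F) $ 1 $ 1 = (\<Sum>u\<in>UNIV. mu u a * pval v (f u))"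
      by (simp add: matrix_matrix_mult_def mu_row_def F_def)
    have inner_nth: "(F + adj (mu_row a) ** (Y - \<kappa> *\<^sub>R (mu_row a ** F))) $ u $ 1 =
        pval v (f u) + qcnj (mu u a) * (pval v y - \<kappa> *\<^sub>R (\<Sum>u\<in>UNIV. mu u a * pval v (f u)))" for u
      unfolding AF[symmetric]
      by (simp add: matrix_matrix_mult_def[of "adj (mu_row a)"] adj_nth F_def Y_def) (simp add: mu_row_def)
    have "Y = mu_row (0, v) ** (F + adj (mu_row a) ** (Y - \<kappa> *\<^sub>R (mu_row a ** F)))"
    proof -
      have "(mu_row (0, v) ** (F + adj (mu_row a) ** (Y - \<kappa> *\<^sub>R (mu_row a ** F)))) $ 1 $ 1 = pval v y"
        unfolding matrix_matrix_mult_def[of "mu_row (0, v)"]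
        by (simp only: vec_lambda_beta inner_nth mu_row_real[OF v] scaleR_conv_of_real[symmetric]
            yv[OF v, symmetric])
      then show ?thesis by (simp add: vec_eq_iff forall_1 Y_def)
    qed
    from transfer_function[OF resolvent(2)[OF v] this]
    have "(C *\<^sub>R Y - mu_row a ** F) $ 1 $ 1 = (blaschke_real v ** F) $ 1 $ 1"
      by (simp add: blaschke_real_def)
    then show ?thesis using bv[OF v] unfolding F_def[symmetric] by (simp add: AF Y_def)
  qed
  then show ?thesis using b b_le by blast
qed

text \<open>The columns of \<open>M\<close> serve as constant inputs of the colligation.
  \<open>M = D\<close> covers the partial product before the last factor, and
  \<open>M = mat 1\<close> the Blaschke factor itself.\<close>

lemma arv_mat_blaschke_real: "arv_mat (\<lambda>v. blaschke_real v ** M)" for M :: "quat^3^3"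
  unfolding arv_mat_def
proof (intro allI)
  fix i :: 1 and j :: 3
  obtain b where b: "arv b" "\<And>v. (0, v) \<in> Omega_A \<Longrightarrow>
      pval v b = (blaschke_real v ** (\<chi> u i. pval v (const_coeff (M $ u $ j)))) $ 1 $ (1::1)"
    using blaschke_real_contractive[of "\<lambda>u. const_coeff (M $ u $ j)"] arv_const_coeff by blast
  then show "\<exists>c. arv c \<and> (\<forall>v. (0, v) \<in> Omega_A \<longrightarrow> pval v c = (blaschke_real v ** M) $ i $ j)"
    by (intro exI[of _ b]) (simp add: index_1[of i] pval_const_coeff matrix_matrix_mult_def)
qed

lemma ck_prod_value:
  fixes f :: "point \<Rightarrow> quat^'k^'m" and g :: "point \<Rightarrow> quat^'n^'k"
  assumes "arv_mat h" "\<And>v. (0, v) \<in> Omega_A \<Longrightarrow> f (0, v) ** g (0, v) = h v" "(0, v) \<in> Omega_A"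
  shows "(f \<star> g) (0, v) = h v"
proof -
  have "arv_mat (\<lambda>v. f (0, v) ** g (0, v))"
    using assms(1) by (rule arv_mat_cong) (simp add: assms(2))
  then show ?thesis unfolding ck_prod_def using assms(2,3) by (simp add: CK_mat_value)
qed

text \<open>Along the left-associated product the values at x0 = 0 are, up to the last factor, C K
  and B_a D, where K is the resolvent; the last factor \<open>E\<close> removes D. Each stage is an
  \<open>arv_mat\<close>, so no extension is left undetermined.\<close>

lemma blaschke_value:
  assumes "(0, v) \<in> Omega_A"
  shows "blaschke a (0, v) = blaschke_real v"
proof -
  have inv: "ck_inverse (\<lambda>x. mat 1 - mu_row x ** adj (mu_row a)) (0, v) = resolvent v"
    if "(0, v) \<in> Omega_A" for v
    unfolding ck_inverse_def resolvent_def[symmetric] by (rule CK_mat_value[OF resolvent(1) that])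
  have "arv_mat (\<lambda>v. C *\<^sub>R resolvent v)"
    unfolding arv_mat_def
  proof (intro allI)
    fix i j :: 1
    obtain c where "arv c" "\<forall>v. (0, v) \<in> Omega_A \<longrightarrow> pval v c = resolvent v $ i $ j"
      using resolvent(1) unfolding arv_mat_def by blast
    then show "\<exists>c. arv c \<and> (\<forall>v. (0, v) \<in> Omega_A \<longrightarrow> pval v c = (C *\<^sub>R resolvent v) $ i $ j)"
      by (intro exI[of _ "\<lambda>\<alpha>. C *\<^sub>R c \<alpha>"]) (simp add: arv_scaleR pval_scaleR)
  qed
  note arv_C = this
  define S1 where "S1 = (\<lambda>x. msqrt (mat 1 - mu_row a ** adj (mu_row a)))
      \<star> ck_inverse (\<lambda>x. mat 1 - mu_row x ** adj (mu_row a))"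
  have S1: "S1 (0, v) = C *\<^sub>R resolvent v" if "(0, v) \<in> Omega_A" for v
    unfolding S1_def
    by (rule ck_prod_value[OF arv_C _ that]) (simp add: inv msqrt_row matrix_scaleR_left)
  have BD: "blaschke_real v ** D = C *\<^sub>R resolvent v ** (mu_row (0, v) - mu_row a)" for v
  proof -
    have "blaschke_real v ** D = C *\<^sub>R (resolvent v ** (mu_row (0, v) - mu_row a) ** (E ** D))"
      by (simp add: blaschke_real_def matrix_scaleR_left matrix_mul_assoc)
    then show ?thesis by (simp add: E_D matrix_scaleR_left)
  qed
  define S2 where "S2 = S1 \<star> (\<lambda>x. mu_row x - mu_row a)"
  have S2: "S2 (0, v) = blaschke_real v ** D" if "(0, v) \<in> Omega_A" for v
    unfolding S2_def
    by (rule ck_prod_value[OF arv_mat_blaschke_real _ that]) (simp add: S1 BD)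
  have BDE: "blaschke_real v ** D ** E = blaschke_real v ** mat 1" for v
    by (simp add: D_E flip: matrix_mul_assoc)
  have "blaschke a (0, v) = blaschke_real v ** mat 1"
    unfolding blaschke_def S1_def[symmetric] S2_def[symmetric]
    by (rule ck_prod_value[OF arv_mat_blaschke_real _ assms])
      (simp only: S2 BDE msqrt_col matrix_inv_D)
  then show ?thesis by simp
qed

lemma schur_multiplier_blaschke: "schur_multiplier (blaschke a)"
proof -
  have "\<exists>b. arv b \<and> arv_sq b \<le> 1\<^sup>2 * (\<Sum>u\<in>UNIV. arv_sq (c u)) \<and>
      (\<forall>x. (blaschke a \<star> f) x $ 1 $ 1 = mu_series b x)"
    if c: "\<And>u. arveson_series (c u) (\<lambda>x. f x $ u $ 1)" for c and f :: "point \<Rightarrow> quat^1^3"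
  proof -
    obtain b where b: "arv b" "arv_sq b \<le> (\<Sum>u\<in>UNIV. arv_sq (c u))" and
      bv: "\<And>v. (0, v) \<in> Omega_A \<Longrightarrow> pval v b = (blaschke_real v ** (\<chi> u i. pval v (c u))) $ 1 $ (1::1)"
      using blaschke_real_contractive[of c] arveson_series_arv[OF c] by blast
    have "CK Omega_A (\<lambda>v. (blaschke a (0, v) ** f (0, v)) $ 1 $ 1) = mu_series b"
    proof (rule CK_pval[OF b(1)])
      fix v assume v: "(0, v) \<in> Omega_A"
      have "(\<chi> u i. pval v (c u)) = f (0, v)"
        by (simp add: vec_eq_iff forall_1 pval_arveson_series[OF c v])
      then show "pval v b = (blaschke a (0, v) ** f (0, v)) $ 1 $ 1"
        by (simp add: bv[OF v] blaschke_value[OF v])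
    qed
    then show ?thesis using b by (intro exI[of _ b]) (simp add: ck_prod_def CK_mat_def)
  qed
  from arveson_operator_bound[OF zero_le_one this] show ?thesis
    unfolding schur_multiplier_def by simp
qed

end

theorem theorem7p2:
  fixes a :: point
  assumes "a \<in> Omega_1"
  shows "strict_contraction (left_mult (mu_row a)) \<and> schur_multiplier (blaschke a)"
proof
  show "strict_contraction (left_mult (mu_row a))"
    using assms by (intro strict_contraction_left_mult) (simp add: mu_row_def Omega_1_def)
  show "schur_multiplier (blaschke a)"
    by (rule schur_multiplier_blaschke[OF assms refl refl refl])
qed

end
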